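(* The set $A$ of atoms is not countable in the generic extension $\mathcal{B}[G]$.
   Context: Let $V$ be a model of $\mathrm{ZFA}$ plus the axiom of choice, with set of atoms $A$, $|A|>\aleph_0$. Let $\mathcal{S}$ be the group of all permutations of $A$, acting on $V$ by $\pi(x)=\{\pi(t)\mid t\in x\}$; $sym(x)=\{\pi\in\mathcal{S}\mid\pi(x)=x\}$; for at most countable $C\subseteq A$, $\mathcal{S}_C$ is the pointwise stabilizer of $C$; $F$ is the filter of subgroups of $\mathcal{S}$ containing some such $\mathcal{S}_C$; $x$ is symmetric iff $sym(x)\in F$; $\mathcal{B}$ is the permutation model of all $x$ whose transitive closure consists of symmetric elements. Working in $\mathcal{B}$: $Q$ is the set of functions $h\colon D\to\{0,1\}$ with $D\subseteq\omega$ finite, $h_0\le_Q h_1$ iff $h_0$ extends $h_1$; $I=\{h\in Q\mid\exists n,\ h(n)=0\}$. For $n\in\omega$ (identified with $\{0,\dots,n-1\}$), $P_n$ is the set of functions $f\colon A\to Q$ in $\mathcal{B}$ with (1) $\mathrm{dom}\,f(a)=n$ for all $a$; (2) $f^{-1}(I)$ at most countable; (3) for each $t\colon n\to\{0,1\}$ infinitely many $a\in A$ satisfy $f(a)=t$. $P=\bigcup_n P_n$, with $f_0\le f_1$ ($f_0$ stronger) iff $f_0(a)\le_Q f_1(a)$ for all $a\in A$. $G$ is a $P$-generic filter over $\mathcal{B}$ and $\mathcal{B}[G]$ is the generic extension. *)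

theory Defs
  imports Main
begin

section \<open>Structures for the language of ZFA\<close>

text \<open>
  The language has a membership relation and a constant for the set of atoms.  Models are
  arbitrary structures: neither transitivity nor well-foundedness is presupposed.  Hence all
  set-theoretic notions below are relative to a structure \<open>S\<close>: they quantify over elements of
  \<open>S\<close> only.  A HOL set of elements of \<open>S\<close> plays the role of a class; \<open>elts S x\<close> is the class
  of all elements of \<open>x\<close>.
\<close>

record 'a str =
  Univ :: "'a set"
  In :: "'a \<Rightarrow> 'a \<Rightarrow> bool"
  Atoms :: 'a

definition elts :: "('a, 'm) str_scheme \<Rightarrow> 'a \<Rightarrow> 'a set" where
  "elts S x = {y \<in> Univ S. In S y x}"

definition atom :: "('a, 'm) str_scheme \<Rightarrow> 'a \<Rightarrow> bool" where
  "atom S x \<longleftrightarrow> x \<in> elts S (Atoms S)"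

definition is_set :: "('a, 'm) str_scheme \<Rightarrow> 'a \<Rightarrow> bool" where
  "is_set S x \<longleftrightarrow> x \<in> Univ S \<and> \<not> atom S x"

text \<open>First-order formulas with de Bruijn indices, for the axiom schemes. Parameters are
  supplied by the environment.\<close>

datatype fm = FMem nat nat | FEq nat nat | FNeg fm | FAnd fm fm | FEx fm

primrec sat :: "('a, 'm) str_scheme \<Rightarrow> (nat \<Rightarrow> 'a) \<Rightarrow> fm \<Rightarrow> bool" where
  "sat S e (FMem i j) \<longleftrightarrow> In S (e i) (e j)"
| "sat S e (FEq i j) \<longleftrightarrow> e i = e j"
| "sat S e (FNeg \<phi>) \<longleftrightarrow> \<not> sat S e \<phi>"
| "sat S e (FAnd \<phi> \<psi>) \<longleftrightarrow> sat S e \<phi> \<and> sat S e \<psi>"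
| "sat S e (FEx \<phi>) = (\<exists>x\<in>Univ S. sat S (case_nat x e) \<phi>)"


section \<open>Basic set-theoretic notions relative to a structure\<close>

definition is_upair :: "('a, 'm) str_scheme \<Rightarrow> 'a \<Rightarrow> 'a \<Rightarrow> 'a \<Rightarrow> bool" where
  "is_upair S z a b \<longleftrightarrow> is_set S z \<and> elts S z = {a, b}"

definition is_opair :: "('a, 'm) str_scheme \<Rightarrow> 'a \<Rightarrow> 'a \<Rightarrow> 'a \<Rightarrow> bool" where
  "is_opair S z a b \<longleftrightarrow>
     (\<exists>u v. is_upair S u a a \<and> is_upair S v a b \<and> is_upair S z u v)"

definition graph :: "('a, 'm) str_scheme \<Rightarrow> 'a \<Rightarrow> ('a \<times> 'a) set" where
  "graph S f = {(a, b). \<exists>z\<in>elts S f. is_opair S z a b}"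

definition fun_in :: "('a, 'm) str_scheme \<Rightarrow> 'a \<Rightarrow> 'a set \<Rightarrow> 'a set \<Rightarrow> bool" where
  "fun_in S f K L \<longleftrightarrow>
     is_set S f \<and> (\<forall>z\<in>elts S f. \<exists>a b. is_opair S z a b) \<and>
     single_valued (graph S f) \<and> Domain (graph S f) = K \<and> Range (graph S f) \<subseteq> L"

definition inj_in :: "('a, 'm) str_scheme \<Rightarrow> 'a \<Rightarrow> 'a set \<Rightarrow> 'a set \<Rightarrow> bool" where
  "inj_in S f K L \<longleftrightarrow> fun_in S f K L \<and> single_valued ((graph S f)\<inverse>)"

definition is_zero :: "('a, 'm) str_scheme \<Rightarrow> 'a \<Rightarrow> bool" where
  "is_zero S z \<longleftrightarrow> is_set S z \<and> elts S z = {}"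

definition is_one :: "('a, 'm) str_scheme \<Rightarrow> 'a \<Rightarrow> bool" where
  "is_one S y \<longleftrightarrow> is_set S y \<and> (\<exists>z. is_zero S z \<and> elts S y = {z})"

definition bits :: "('a, 'm) str_scheme \<Rightarrow> 'a set" where
  "bits S = {b. is_zero S b \<or> is_one S b}"

definition is_succ :: "('a, 'm) str_scheme \<Rightarrow> 'a \<Rightarrow> 'a \<Rightarrow> bool" where
  "is_succ S y x \<longleftrightarrow> is_set S y \<and> elts S y = insert x (elts S x)"

definition inductive_in :: "('a, 'm) str_scheme \<Rightarrow> 'a \<Rightarrow> bool" where
  "inductive_in S w \<longleftrightarrow> is_set S w \<and> (\<exists>z\<in>elts S w. is_zero S z) \<and>
     (\<forall>x\<in>elts S w. \<exists>y\<in>elts S w. is_succ S y x)"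

text \<open>The elements of the \<open>\<omega>\<close> of \<open>S\<close>; they may include nonstandard numbers.\<close>

definition nats :: "('a, 'm) str_scheme \<Rightarrow> 'a set" where
  "nats S = {n \<in> Univ S. \<forall>w\<in>Univ S. inductive_in S w \<longrightarrow> n \<in> elts S w}"

text \<open>\<open>S\<close> contains an injection of the class \<open>K\<close> into a natural number, respectively into \<open>\<omega>\<close>;
  so \<open>countable_in\<close> means at most countable.\<close>

definition finite_in :: "('a, 'm) str_scheme \<Rightarrow> 'a set \<Rightarrow> bool" where
  "finite_in S K \<longleftrightarrow> (\<exists>n\<in>nats S. \<exists>f\<in>Univ S. inj_in S f K (elts S n))"

definition countable_in :: "('a, 'm) str_scheme \<Rightarrow> 'a set \<Rightarrow> bool" where
  "countable_in S K \<longleftrightarrow> (\<exists>f\<in>Univ S. inj_in S f K (nats S))"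

definition greater_aleph0_in :: "('a, 'm) str_scheme \<Rightarrow> 'a set \<Rightarrow> bool" where
  "greater_aleph0_in S K \<longleftrightarrow> (\<exists>f\<in>Univ S. inj_in S f (nats S) K) \<and> \<not> countable_in S K"


section \<open>The axioms of ZFA and the axiom of choice\<close>

definition ZFA :: "('a, 'm) str_scheme \<Rightarrow> bool" where
  "ZFA S \<longleftrightarrow>
     \<comment> \<open>atoms\<close>
     Atoms S \<in> Univ S \<and> (\<forall>a. atom S a \<longrightarrow> elts S a = {}) \<and>
     \<comment> \<open>empty set\<close>
     (\<exists>z. is_zero S z) \<and>
     \<comment> \<open>extensionality for sets\<close>
     (\<forall>x y. is_set S x \<longrightarrow> is_set S y \<longrightarrow> elts S x = elts S y \<longrightarrow> x = y) \<and>
     \<comment> \<open>pairing\<close>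
     (\<forall>x\<in>Univ S. \<forall>y\<in>Univ S. \<exists>z. is_upair S z x y) \<and>
     \<comment> \<open>union\<close>
     (\<forall>x. is_set S x \<longrightarrow> (\<exists>u. is_set S u \<and> elts S u = (\<Union>y\<in>elts S x. elts S y))) \<and>
     \<comment> \<open>power set\<close>
     (\<forall>x. is_set S x \<longrightarrow> (\<exists>u. is_set S u \<and> elts S u = {y. is_set S y \<and> elts S y \<subseteq> elts S x})) \<and>
     \<comment> \<open>infinity\<close>
     (\<exists>w. inductive_in S w) \<and>
     \<comment> \<open>regularity\<close>
     (\<forall>x. is_set S x \<longrightarrow> elts S x \<noteq> {} \<longrightarrow> (\<exists>y\<in>elts S x. elts S y \<inter> elts S x = {})) \<and>
     \<comment> \<open>separation scheme\<close>
     (\<forall>\<phi> e x. range e \<subseteq> Univ S \<longrightarrow> is_set S x \<longrightarrow>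
        (\<exists>u. is_set S u \<and> elts S u = {y \<in> elts S x. sat S (case_nat y e) \<phi>})) \<and>
     \<comment> \<open>replacement scheme\<close>
     (\<forall>\<phi> e x. range e \<subseteq> Univ S \<longrightarrow> is_set S x \<longrightarrow>
        (\<forall>y\<in>elts S x. \<forall>z\<in>Univ S. \<forall>z'\<in>Univ S.
           sat S (case_nat y (case_nat z e)) \<phi> \<longrightarrow> sat S (case_nat y (case_nat z' e)) \<phi> \<longrightarrow> z = z') \<longrightarrow>
        (\<exists>u. is_set S u \<and>
           elts S u = {z \<in> Univ S. \<exists>y\<in>elts S x. sat S (case_nat y (case_nat z e)) \<phi>}))"

definition AC :: "('a, 'm) str_scheme \<Rightarrow> bool" where
  "AC S \<longleftrightarrow>
     (\<forall>x. is_set S x \<longrightarrow> (\<forall>y\<in>elts S x. elts S y \<noteq> {}) \<longrightarrow>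
        (\<forall>y\<in>elts S x. \<forall>y'\<in>elts S x. y \<noteq> y' \<longrightarrow> elts S y \<inter> elts S y' = {}) \<longrightarrow>
        (\<exists>c. is_set S c \<and> (\<forall>y\<in>elts S x. \<exists>!z. z \<in> elts S c \<inter> elts S y)))"


section \<open>The permutation model\<close>

definition Perms :: "('a, 'm) str_scheme \<Rightarrow> 'a set" where
  "Perms V = {\<pi> \<in> Univ V. inj_in V \<pi> (elts V (Atoms V)) (elts V (Atoms V)) \<and>
                Range (graph V \<pi>) = elts V (Atoms V)}"

text \<open>\<open>acts V \<pi> x y\<close> means \<open>\<pi>(x) = y\<close>.  The value is computed by \<open>\<in>\<close>-recursion inside \<open>V\<close>; the
  element \<open>h\<close> is a partial run of the recursion.\<close>

definition acts :: "('a, 'm) str_scheme \<Rightarrow> 'a \<Rightarrow> 'a \<Rightarrow> 'a \<Rightarrow> bool" where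
  "acts V \<pi> x y \<longleftrightarrow>
     (\<exists>h\<in>Univ V. (x, y) \<in> graph V h \<and>
        (\<forall>(u, v) \<in> graph V h.
           if atom V u then (u, v) \<in> graph V \<pi>
           else is_set V v \<and> elts V u \<subseteq> Domain (graph V h) \<and>
                elts V v = graph V h `` elts V u))"

definition sym_grp :: "('a, 'm) str_scheme \<Rightarrow> 'a \<Rightarrow> 'a set" where
  "sym_grp V x = {\<pi> \<in> Perms V. acts V \<pi> x x}"

definition fix_grp :: "('a, 'm) str_scheme \<Rightarrow> 'a set \<Rightarrow> 'a set" where
  "fix_grp V C = {\<pi> \<in> Perms V. \<forall>c\<in>C. (c, c) \<in> graph V \<pi>}"

definition perm_subgroup :: "('a, 'm) str_scheme \<Rightarrow> 'a set \<Rightarrow> bool" where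
  "perm_subgroup V H \<longleftrightarrow> H \<subseteq> Perms V \<and>
     (\<forall>\<iota>\<in>Perms V. graph V \<iota> = Id_on (elts V (Atoms V)) \<longrightarrow> \<iota> \<in> H) \<and>
     (\<forall>\<pi>\<in>H. \<forall>\<rho>\<in>H. \<forall>\<sigma>\<in>Perms V. graph V \<sigma> = graph V \<rho> O graph V \<pi> \<longrightarrow> \<sigma> \<in> H) \<and>
     (\<forall>\<pi>\<in>H. \<forall>\<sigma>\<in>Perms V. graph V \<sigma> = (graph V \<pi>)\<inverse> \<longrightarrow> \<sigma> \<in> H)"

definition F_filter :: "('a, 'm) str_scheme \<Rightarrow> 'a set set" where
  "F_filter V = {H. perm_subgroup V H \<and>
     (\<exists>C. is_set V C \<and> elts V C \<subseteq> elts V (Atoms V) \<and> countable_in V (elts V C) \<and>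
          fix_grp V (elts V C) \<subseteq> H)}"

definition symmetric :: "('a, 'm) str_scheme \<Rightarrow> 'a \<Rightarrow> bool" where
  "symmetric V x \<longleftrightarrow> sym_grp V x \<in> F_filter V"

text \<open>The elements of the transitive closure of \<open>{x}\<close>, i.e. of the least transitive set of \<open>V\<close>
  that has \<open>x\<close> as an element.\<close>

definition trcl_sing :: "('a, 'm) str_scheme \<Rightarrow> 'a \<Rightarrow> 'a set" where
  "trcl_sing V x = {y \<in> Univ V. \<forall>T. is_set V T \<and> x \<in> elts V T \<and>
                       (\<forall>u\<in>elts V T. elts V u \<subseteq> elts V T) \<longrightarrow> y \<in> elts V T}"

definition perm_model :: "'a str \<Rightarrow> 'a str" where
  "perm_model V =
     \<lparr>Univ = {x \<in> Univ V. \<forall>y\<in>trcl_sing V x. symmetric V y}, In = In V, Atoms = Atoms V\<rparr>"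


section \<open>The notion of forcing\<close>

definition QQ :: "('a, 'm) str_scheme \<Rightarrow> 'a set" where
  "QQ S = {h \<in> Univ S. \<exists>D \<subseteq> nats S. finite_in S D \<and> fun_in S h D (bits S)}"

definition Q_le :: "('a, 'm) str_scheme \<Rightarrow> 'a \<Rightarrow> 'a \<Rightarrow> bool" where
  "Q_le S h0 h1 \<longleftrightarrow> graph S h1 \<subseteq> graph S h0"

definition II :: "('a, 'm) str_scheme \<Rightarrow> 'a set" where
  "II S = {h \<in> QQ S. \<exists>n z. is_zero S z \<and> (n, z) \<in> graph S h}"

definition PPn :: "('a, 'm) str_scheme \<Rightarrow> 'a \<Rightarrow> 'a set" where
  "PPn S n = {f \<in> Univ S. fun_in S f (elts S (Atoms S)) (QQ S) \<and>
     (\<forall>(a, h) \<in> graph S f. Domain (graph S h) = elts S n) \<and>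
     countable_in S {a. \<exists>h\<in>II S. (a, h) \<in> graph S f} \<and>
     (\<forall>t\<in>Univ S. fun_in S t (elts S n) (bits S) \<longrightarrow> \<not> finite_in S {a. (a, t) \<in> graph S f})}"

definition PP :: "('a, 'm) str_scheme \<Rightarrow> 'a set" where
  "PP S = (\<Union>n\<in>nats S. PPn S n)"

definition P_le :: "('a, 'm) str_scheme \<Rightarrow> 'a \<Rightarrow> 'a \<Rightarrow> bool" where
  "P_le S f0 f1 \<longleftrightarrow>
     (\<forall>a h0 h1. (a, h0) \<in> graph S f0 \<longrightarrow> (a, h1) \<in> graph S f1 \<longrightarrow> Q_le S h0 h1)"


section \<open>Generic filters and generic extensions\<close>

text \<open>\<open>P\<close> is the class of conditions and \<open>le p q\<close> means that \<open>p\<close> is stronger than \<open>q\<close>.\<close>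

definition dense_in :: "('a, 'm) str_scheme \<Rightarrow> 'a set \<Rightarrow> ('a \<Rightarrow> 'a \<Rightarrow> bool) \<Rightarrow> 'a \<Rightarrow> bool" where
  "dense_in S P le D \<longleftrightarrow> is_set S D \<and> elts S D \<subseteq> P \<and> (\<forall>p\<in>P. \<exists>d\<in>elts S D. le d p)"

definition generic_filter ::
    "('a, 'm) str_scheme \<Rightarrow> 'a set \<Rightarrow> ('a \<Rightarrow> 'a \<Rightarrow> bool) \<Rightarrow> 'a set \<Rightarrow> bool" where
  "generic_filter S P le G \<longleftrightarrow>
     G \<subseteq> P \<and> G \<noteq> {} \<and>
     (\<forall>p\<in>G. \<forall>q\<in>P. le p q \<longrightarrow> q \<in> G) \<and>
     (\<forall>p\<in>G. \<forall>q\<in>G. \<exists>r\<in>G. le r p \<and> le r q) \<and>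
     (\<forall>D. dense_in S P le D \<longrightarrow> G \<inter> elts S D \<noteq> {})"

text \<open>A \<open>P\<close>-name is an atom (naming itself) or a set of pairs \<open>(\<sigma>, p)\<close> with \<open>\<sigma>\<close> a \<open>P\<close>-name and
  \<open>p \<in> P\<close>.  By regularity, this recursion amounts to membership in a set that is closed in the
  following sense.\<close>

definition name_closed :: "('a, 'm) str_scheme \<Rightarrow> 'a set \<Rightarrow> 'a \<Rightarrow> bool" where
  "name_closed S P N \<longleftrightarrow> is_set S N \<and>
     (\<forall>x\<in>elts S N. is_set S x \<longrightarrow>
        (\<forall>z\<in>elts S x. \<exists>\<sigma>\<in>elts S N. \<exists>p\<in>P. is_opair S z \<sigma> p))"

definition names :: "('a, 'm) str_scheme \<Rightarrow> 'a set \<Rightarrow> 'a set" where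
  "names S P = {\<tau>. \<exists>N. name_closed S P N \<and> \<tau> \<in> elts S N}"

text \<open>The usual recursion for \<open>p \<tturnstile> \<sigma> = \<tau>\<close>: if \<open>\<sigma>\<close> or \<open>\<tau>\<close> is an atom, then \<open>\<sigma> = \<tau>\<close>; otherwise,
  for each \<open>(\<sigma>', s) \<in> \<sigma>\<close>, densely many \<open>r\<close> below \<open>p\<close> and \<open>s\<close> force \<open>\<sigma>' = \<tau>'\<close> for some
  \<open>(\<tau>', u) \<in> \<tau>\<close> with \<open>r \<le> u\<close>, and symmetrically.\<close>

definition forces_eq_step ::
    "('a, 'm) str_scheme \<Rightarrow> 'a set \<Rightarrow> ('a \<Rightarrow> 'a \<Rightarrow> bool) \<Rightarrow> ('a \<Rightarrow> 'a \<Rightarrow> 'a \<Rightarrow> bool) \<Rightarrow>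
     'a \<Rightarrow> 'a \<Rightarrow> 'a \<Rightarrow> bool" where
  "forces_eq_step S P le R p \<sigma> \<tau> \<longleftrightarrow>
     (if atom S \<sigma> \<or> atom S \<tau> then \<sigma> = \<tau>
      else
        (\<forall>(\<sigma>', s) \<in> graph S \<sigma>. \<forall>q\<in>P. le q p \<longrightarrow> le q s \<longrightarrow>
           (\<exists>r\<in>P. le r q \<and> (\<exists>(\<tau>', u) \<in> graph S \<tau>. le r u \<and> R r \<sigma>' \<tau>'))) \<and>
        (\<forall>(\<tau>', u) \<in> graph S \<tau>. \<forall>q\<in>P. le q p \<longrightarrow> le q u \<longrightarrow>
           (\<exists>r\<in>P. le r q \<and> (\<exists>(\<sigma>', s) \<in> graph S \<sigma>. le r s \<and> R r \<sigma>' \<tau>'))))"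

definition triple_in :: "('a, 'm) str_scheme \<Rightarrow> 'a \<Rightarrow> 'a \<Rightarrow> 'a \<Rightarrow> 'a \<Rightarrow> bool" where
  "triple_in S R p \<sigma> \<tau> \<longleftrightarrow> (\<exists>w. is_opair S w \<sigma> \<tau> \<and> (p, w) \<in> graph S R)"

text \<open>As \<open>S\<close> need not be well-founded, the recursion is carried out inside \<open>S\<close>: the element \<open>R\<close>
  is a run of it on a closed set \<open>N\<close> of names.\<close>

definition forces_eq ::
    "('a, 'm) str_scheme \<Rightarrow> 'a set \<Rightarrow> ('a \<Rightarrow> 'a \<Rightarrow> bool) \<Rightarrow> 'a \<Rightarrow> 'a \<Rightarrow> 'a \<Rightarrow> bool" where
  "forces_eq S P le p \<sigma> \<tau> \<longleftrightarrow>
     (\<exists>N. \<exists>R\<in>Univ S. name_closed S P N \<and> \<sigma> \<in> elts S N \<and> \<tau> \<in> elts S N \<and>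
        (\<forall>p'\<in>P. \<forall>\<sigma>'\<in>elts S N. \<forall>\<tau>'\<in>elts S N.
           triple_in S R p' \<sigma>' \<tau>' \<longleftrightarrow> forces_eq_step S P le (triple_in S R) p' \<sigma>' \<tau>') \<and>
        triple_in S R p \<sigma> \<tau>)"

text \<open>\<open>val S P le G \<tau>\<close> is the value of the name \<open>\<tau>\<close>, represented by the class of all names with
  the same value: \<open>\<sigma>\<close> and \<open>\<tau>\<close> have the same value iff some \<open>p \<in> G\<close> forces \<open>\<sigma> = \<tau>\<close>.\<close>

definition val ::
    "('a, 'm) str_scheme \<Rightarrow> 'a set \<Rightarrow> ('a \<Rightarrow> 'a \<Rightarrow> bool) \<Rightarrow> 'a set \<Rightarrow> 'a \<Rightarrow> 'a set" where
  "val S P le G \<tau> = {\<sigma> \<in> names S P. \<exists>p\<in>G. forces_eq S P le p \<sigma> \<tau>}"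

text \<open>The canonical name \<open>{(a, p) | a \<in> A, p \<in> P}\<close> of the set \<open>A\<close> of atoms.\<close>

definition atoms_name :: "('a, 'm) str_scheme \<Rightarrow> 'a set \<Rightarrow> 'a" where
  "atoms_name S P = (THE \<tau>. is_set S \<tau> \<and>
     elts S \<tau> = {z. \<exists>a\<in>elts S (Atoms S). \<exists>p\<in>P. is_opair S z a p})"

text \<open>The generic extension consists of the values of names, where the elements of the value of
  \<open>\<tau>\<close> are the values of those \<open>\<sigma>\<close> with \<open>(\<sigma>, p) \<in> \<tau>\<close> for some \<open>p \<in> G\<close>.  For well-founded \<open>S\<close>, this
  is isomorphic to the structure of the recursively computed values.\<close>

definition generic_ext ::
    "'a str \<Rightarrow> 'a set \<Rightarrow> ('a \<Rightarrow> 'a \<Rightarrow> bool) \<Rightarrow> 'a set \<Rightarrow> 'a set str" where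
  "generic_ext S P le G =
     \<lparr>Univ = val S P le G ` names S P,
      In = (\<lambda>X Y. \<exists>\<tau>\<in>names S P. Y = val S P le G \<tau> \<and>
              (\<exists>(\<sigma>, p) \<in> graph S \<tau>. p \<in> G \<and> X = val S P le G \<sigma>)),
      Atoms = val S P le G (atoms_name S P)\<rparr>"

end

theory Submission
  imports Defs
begin

text \<open>
  Suppose a name \<open>\<tau>\<close> with countable support \<open>C\<^sub>0\<close> is forced by \<open>p\<close> to be an injection of \<open>A\<close> into \<open>\<omega>\<close>, and
  let \<open>C = C\<^sub>0 \<union> p\<inverse>(I)\<close>.  If \<open>q \<le> p\<close> decides \<open>\<tau>(a)\<close> for some \<open>a \<notin> C\<close> and \<open>q(a) = q(b)\<close> for some
  \<open>b \<notin> C\<close> other than \<open>a\<close>, then the transposition of \<open>a\<close> and \<open>b\<close> fixes \<open>\<tau>\<close> and \<open>q\<close>, so \<open>q\<close> decides \<open>\<tau>(b)\<close> in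
  the same way, a contradiction.  Such a \<open>b\<close> exists if \<open>q(a) \<notin> I\<close>, because \<open>A\<close> is uncountable.
  Otherwise put \<open>t = q(a)\<close> and modify \<open>q\<close> to a condition \<open>p' \<le> p\<close> whose fibre over \<open>t\<close> is disjoint
  from \<open>C\<close>; here \<open>p(e)\<close> is the constant sequence 1 for all \<open>e \<notin> C\<close>, so any countable set
  of new atoms can be used, and the axiom of choice in \<open>V\<close> provides one.  If \<open>q' \<le> p'\<close> decides
  \<open>\<tau>(a')\<close> for some \<open>a'\<close> with \<open>p'(a') = t\<close>, then the fibre of \<open>q'\<close> over \<open>q'(a')\<close> is infinite and disjoint
  from \<open>C\<close>, and the transposition argument applies to \<open>q'\<close>.

  As the models may be ill-founded, induction and recursion in them are available for definable
  properties only.  The same definability also yields invariance under automorphisms.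
\<close>

section \<open>Definability with parameters\<close>

text \<open>The only formula whose forcing is analysed is equality. Being an injection of
  \<open>A\<close> into \<open>\<omega>\<close> enters through two properties of a name (every atom
  gets a value, no two atoms share one), and both are phrased with forced equality. A transposition
  of \<open>a\<close> and \<open>b\<close> fixes \<open>q\<close> as soon as
  \<open>q(a) = q(b)\<close>, because members of \<open>Q\<close> are built from natural numbers,
  which no permutation moves: a permutation acts on a condition through its arguments alone. For the
  same reason the candidate values of \<open>\<tau>(a)\<close> are canonical names fixed by every
  permutation. The axioms are divided between the two models. In \<open>B\<close> the axioms of
  \<open>zermelo\<close> are verified by exhibiting supports, and forcing over \<open>B\<close>
  rests on these. Whatever comes from recursion, replacement or choice is built in \<open>V\<close>
  and then shown to lie in \<open>B\<close>. This works for conditions too: a countable set of atoms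
  supports each of its enumerations, so countability and finiteness of sets of atoms mean the same
  in \<open>V\<close> and \<open>B\<close>.\<close>

primrec ren :: "(nat \<Rightarrow> nat) \<Rightarrow> fm \<Rightarrow> fm" where
  "ren f (FMem i j) = FMem (f i) (f j)"
| "ren f (FEq i j) = FEq (f i) (f j)"
| "ren f (FNeg \<phi>) = FNeg (ren f \<phi>)"
| "ren f (FAnd \<phi> \<psi>) = FAnd (ren f \<phi>) (ren f \<psi>)"
| "ren f (FEx \<phi>) = FEx (ren (case_nat 0 (\<lambda>i. Suc (f i))) \<phi>)"

lemma sat_ren: "sat S e (ren f \<phi>) = sat S (\<lambda>i. e (f i)) \<phi>"
proof (induction \<phi> arbitrary: e f)
  case (FEx \<phi>)
  have "(\<lambda>i. case_nat x e (case_nat 0 (\<lambda>i. Suc (f i)) i)) = case_nat x (\<lambda>i. e (f i))" for x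
    by (auto split: nat.split)
  then show ?case by (simp add: FEx)
qed auto

text \<open>A formula sees only finitely many entries of its environment. This bounds the parameters
  in \<open>dfb_finite_params\<close>, whose supports are later united.\<close>

lemma sat_finite_support:
  "\<exists>k. \<forall>e e'. (\<forall>i<k. e i = e' i) \<longrightarrow> sat S e \<phi> = sat S e' \<phi>"
proof (induction \<phi>)
  case (FMem i j)
  show ?case by (rule exI[of _ "Suc (max i j)"]) auto
next
  case (FEq i j)
  show ?case by (rule exI[of _ "Suc (max i j)"]) auto
next
  case (FNeg \<phi>)
  then show ?case by auto
next
  case (FAnd \<phi> \<psi>)
  then obtain k l where k: "\<forall>e e'. (\<forall>i<k. e i = e' i) \<longrightarrow> sat S e \<phi> = sat S e' \<phi>"
    and l: "\<forall>e e'. (\<forall>i<l. e i = e' i) \<longrightarrow> sat S e \<psi> = sat S e' \<psi>" by blast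
  show ?case
  proof (intro exI[of _ "max k l"] allI impI)
    fix e e' :: "nat \<Rightarrow> 'a"
    assume h: "\<forall>i<max k l. e i = e' i"
    have "sat S e \<phi> = sat S e' \<phi>" using h by (intro k[rule_format]) auto
    moreover have "sat S e \<psi> = sat S e' \<psi>" using h by (intro l[rule_format]) auto
    ultimately show "sat S e (FAnd \<phi> \<psi>) = sat S e' (FAnd \<phi> \<psi>)" by simp
  qed
next
  case (FEx \<phi>)
  then obtain k where k: "\<forall>e e'. (\<forall>i<k. e i = e' i) \<longrightarrow> sat S e \<phi> = sat S e' \<phi>" by blast
  show ?case
  proof (intro exI[of _ k] allI impI)
    fix e e' :: "nat \<Rightarrow> 'a"
    assume h: "\<forall>i<k. e i = e' i"
    have "sat S (case_nat x e) \<phi> = sat S (case_nat x e') \<phi>" for x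
      using h by (intro k[rule_format]) (auto split: nat.split)
    then show "sat S e (FEx \<phi>) = sat S e' (FEx \<phi>)" by simp
  qed
qed

definition mix :: "(nat \<Rightarrow> 'a) \<Rightarrow> (nat \<Rightarrow> 'a) \<Rightarrow> nat \<Rightarrow> 'a" where
  "mix e c = (\<lambda>i. if even i then e (i div 2) else c (i div 2))"

text \<open>\<open>dfb S X Q\<close>: the relation \<open>Q\<close> on environments is definable over \<open>S\<close> with parameters from
  \<open>X\<close>. Environments occupy the even indices and parameters the odd ones, so that the closure rules
  below need no bookkeeping of free variables; the constant for the atoms is always a parameter.\<close>

definition dfb :: "('a, 'm) str_scheme \<Rightarrow> 'a set \<Rightarrow> ((nat \<Rightarrow> 'a) \<Rightarrow> bool) \<Rightarrow> bool" where
  "dfb S X Q \<longleftrightarrow> (\<exists>\<phi> c. range c \<subseteq> insert (Atoms S) X \<and>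
     (\<forall>e. range e \<subseteq> Univ S \<longrightarrow> Q e = sat S (mix e c) \<phi>))"

text \<open>Terms are functions on environments, so that the closure rules match by unification.
  They are projections and constant parameters only; a compound expression such as
  \<open>H u\<close> needs a definability hypothesis of its own.\<close>

definition tm :: "('a, 'm) str_scheme \<Rightarrow> 'a set \<Rightarrow> ((nat \<Rightarrow> 'a) \<Rightarrow> 'a) \<Rightarrow> bool" where
  "tm S X t \<longleftrightarrow> (\<exists>i. t = (\<lambda>e. e i)) \<or> (\<exists>c\<in>insert (Atoms S) X. t = (\<lambda>e. c))"

lemma tm_var: "tm S X (\<lambda>e. e i)"
  by (auto simp: tm_def)

lemma tm_const: "c \<in> X \<Longrightarrow> tm S X (\<lambda>e. c)"
  by (auto simp: tm_def)

lemma tm_Atoms: "tm S X (\<lambda>e. Atoms S)"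
  by (auto simp: tm_def)

text \<open>Below a quantifier a term reappears applied to the shifted environment; there is one
  rule for each shift depth from 1 to 4.\<close>

lemma tm_shift: "tm S X t \<Longrightarrow> tm S X (\<lambda>e. t (\<lambda>i. e (Suc i)))"
  by (auto simp: tm_def)

lemma tm_shift2: "tm S X t \<Longrightarrow> tm S X (\<lambda>e. t (\<lambda>i. e (Suc (Suc i))))"
  by (auto simp: tm_def)

lemma tm_shift3: "tm S X t \<Longrightarrow> tm S X (\<lambda>e. t (\<lambda>i. e (Suc (Suc (Suc i)))))"
  by (auto simp: tm_def)

lemma tm_shift4: "tm S X t \<Longrightarrow> tm S X (\<lambda>e. t (\<lambda>i. e (Suc (Suc (Suc (Suc i))))))"
  by (auto simp: tm_def)

lemma tm_obtain:
  assumes "tm S X t"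
  obtains i c where "\<And>e. mix e (\<lambda>_. c) i = t e" "c \<in> insert (Atoms S) X"
proof -
  from assms consider j where "t = (\<lambda>e. e j)" | d where "d \<in> insert (Atoms S) X" "t = (\<lambda>e. d)"
    by (auto simp: tm_def)
  then show thesis
  proof cases
    case 1
    then show ?thesis using that[of "Atoms S" "2 * j"] by (simp add: mix_def)
  next
    case 2
    then show ?thesis using that[of d 1] by (simp add: mix_def)
  qed
qed

lemma double_not_Suc_double: "2 * b \<noteq> Suc (2 * c)"
  by presburger

text \<open>Two parameter sequences are merged by interleaving them on the odd positions. Position
  \<open>i = 2 * k + 1\<close> of \<open>mix e c\<close> moves to
  \<open>4 * k + 1 = 2 * i - 1\<close>, the same position of \<open>mix e d\<close> to
  \<open>4 * k + 3 = 2 * i + 1\<close>.\<close>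

lemma mix_mix:
  "mix e c = (\<lambda>i. mix e (mix c d) (if even i then i else 2 * i - 1))"
  "mix e d = (\<lambda>i. mix e (mix c d) (if even i then i else 2 * i + 1))"
  by (auto simp: mix_def fun_eq_iff double_not_Suc_double elim!: oddE)

lemma dfb_join:
  assumes "dfb S X Q" "dfb S X R"
  obtains \<phi> \<psi> c where "range c \<subseteq> insert (Atoms S) X"
    "\<And>e. range e \<subseteq> Univ S \<Longrightarrow> Q e = sat S (mix e c) \<phi>"
    "\<And>e. range e \<subseteq> Univ S \<Longrightarrow> R e = sat S (mix e c) \<psi>"
proof -
  obtain \<phi> c where 1: "range c \<subseteq> insert (Atoms S) X" "\<And>e. range e \<subseteq> Univ S \<Longrightarrow> Q e = sat S (mix e c) \<phi>"
    using assms(1) by (auto simp: dfb_def)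
  obtain \<psi> d where 2: "range d \<subseteq> insert (Atoms S) X" "\<And>e. range e \<subseteq> Univ S \<Longrightarrow> R e = sat S (mix e d) \<psi>"
    using assms(2) by (auto simp: dfb_def)
  have r: "range (mix c d) \<subseteq> insert (Atoms S) X" using 1(1) 2(1) by (auto simp: mix_def)
  show thesis
  proof (rule that[OF r])
    fix e :: "nat \<Rightarrow> 'a" assume e: "range e \<subseteq> Univ S"
    show "Q e = sat S (mix e (mix c d)) (ren (\<lambda>i. if even i then i else 2 * i - 1) \<phi>)"
      using 1(2)[OF e] by (simp only: sat_ren mix_mix(1)[of e c d, symmetric])
    show "R e = sat S (mix e (mix c d)) (ren (\<lambda>i. if even i then i else 2 * i + 1) \<psi>)"
      using 2(2)[OF e] by (simp only: sat_ren mix_mix(2)[of e d c, symmetric])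
  qed
qed

lemma tm_join:
  assumes "tm S X t" "tm S X u"
  obtains i j c where "range c \<subseteq> insert (Atoms S) X" "\<And>e. mix e c i = t e" "\<And>e. mix e c j = u e"
proof -
  obtain i c where 1: "\<And>e. mix e (\<lambda>_. c) i = t e" "c \<in> insert (Atoms S) X"
    using tm_obtain[OF assms(1)] by blast
  obtain j d where 2: "\<And>e. mix e (\<lambda>_. d) j = u e" "d \<in> insert (Atoms S) X"
    using tm_obtain[OF assms(2)] by blast
  have r: "range (mix (\<lambda>_. c) (\<lambda>_. d)) \<subseteq> insert (Atoms S) X"
    using 1(2) 2(2) by (auto simp: mix_def)
  show thesis
    by (rule that[OF r, of "if even i then i else 2 * i - 1" "if even j then j else 2 * j + 1"])
      (metis 1(1) mix_mix(1), metis 2(1) mix_mix(2))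
qed

lemma dfb_mem: "tm S X t \<Longrightarrow> tm S X u \<Longrightarrow> dfb S X (\<lambda>e. In S (t e) (u e))"
proof -
  assume "tm S X t" "tm S X u"
  then obtain i j c where c: "range c \<subseteq> insert (Atoms S) X" "\<And>e. mix e c i = t e" "\<And>e. mix e c j = u e"
    by (rule tm_join) blast
  show ?thesis unfolding dfb_def
    by (intro exI[of _ "FMem i j"] exI[of _ c]) (simp add: c)
qed

lemma dfb_eq: "tm S X t \<Longrightarrow> tm S X u \<Longrightarrow> dfb S X (\<lambda>e. t e = u e)"
proof -
  assume "tm S X t" "tm S X u"
  then obtain i j c where c: "range c \<subseteq> insert (Atoms S) X" "\<And>e. mix e c i = t e" "\<And>e. mix e c j = u e"
    by (rule tm_join) blast
  show ?thesis unfolding dfb_def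
    by (intro exI[of _ "FEq i j"] exI[of _ c]) (simp add: c)
qed

lemma dfb_not: "dfb S X Q \<Longrightarrow> dfb S X (\<lambda>e. \<not> Q e)"
proof -
  assume "dfb S X Q"
  then obtain \<phi> c where "range c \<subseteq> insert (Atoms S) X" "\<forall>e. range e \<subseteq> Univ S \<longrightarrow> Q e = sat S (mix e c) \<phi>"
    by (auto simp: dfb_def)
  then show ?thesis unfolding dfb_def
    by (intro exI[of _ "FNeg \<phi>"] exI[of _ c]) simp
qed

lemma dfb_conj: "dfb S X Q \<Longrightarrow> dfb S X R \<Longrightarrow> dfb S X (\<lambda>e. Q e \<and> R e)"
proof -
  assume "dfb S X Q" "dfb S X R"
  then obtain \<phi> \<psi> c where c: "range c \<subseteq> insert (Atoms S) X"
    "\<And>e. range e \<subseteq> Univ S \<Longrightarrow> Q e = sat S (mix e c) \<phi>"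
    "\<And>e. range e \<subseteq> Univ S \<Longrightarrow> R e = sat S (mix e c) \<psi>"
    by (rule dfb_join) blast
  show ?thesis unfolding dfb_def
    by (intro exI[of _ "FAnd \<phi> \<psi>"] exI[of _ c]) (simp add: c)
qed

lemma dfb_cong:
  "dfb S X Q \<Longrightarrow> (\<And>e. range e \<subseteq> Univ S \<Longrightarrow> R e = Q e) \<Longrightarrow> dfb S X R"
  by (fastforce simp: dfb_def)

lemma dfb_disj: "dfb S X Q \<Longrightarrow> dfb S X R \<Longrightarrow> dfb S X (\<lambda>e. Q e \<or> R e)"
  by (rule dfb_cong[where Q="\<lambda>e. \<not> (\<not> Q e \<and> \<not> R e)"]) ((intro dfb_not dfb_conj; assumption), auto)

lemma dfb_imp: "dfb S X Q \<Longrightarrow> dfb S X R \<Longrightarrow> dfb S X (\<lambda>e. Q e \<longrightarrow> R e)"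
  by (rule dfb_cong[where Q="\<lambda>e. \<not> (Q e \<and> \<not> R e)"]) ((intro dfb_not dfb_conj; assumption), auto)

lemma dfb_iff: "dfb S X Q \<Longrightarrow> dfb S X R \<Longrightarrow> dfb S X (\<lambda>e. Q e \<longleftrightarrow> R e)"
  by (rule dfb_cong[where Q="\<lambda>e. (Q e \<longrightarrow> R e) \<and> (R e \<longrightarrow> Q e)"]) ((intro dfb_not dfb_conj dfb_imp; assumption), auto)

lemma dfb_if: "dfb S X Q \<Longrightarrow> dfb S X R \<Longrightarrow> dfb S X R' \<Longrightarrow> dfb S X (\<lambda>e. if Q e then R e else R' e)"
  by (rule dfb_cong[where Q="\<lambda>e. (Q e \<longrightarrow> R e) \<and> (\<not> Q e \<longrightarrow> R' e)"]) ((intro dfb_not dfb_conj dfb_imp; assumption), auto)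

lemma dfb_ex:
  assumes "dfb S X (\<lambda>e. Q (e 0) (\<lambda>i. e (Suc i)))"
  shows "dfb S X (\<lambda>e. \<exists>x\<in>Univ S. Q x e)"
proof -
  obtain \<phi> c where c: "range c \<subseteq> insert (Atoms S) X"
      "\<And>e. range e \<subseteq> Univ S \<Longrightarrow> Q (e 0) (\<lambda>i. e (Suc i)) = sat S (mix e c) \<phi>"
    using assms by (auto simp: dfb_def)
  \<comment> \<open>\<open>FEx\<close> pushes the new element in front of the interleaved sequence,
    whereas \<open>mix (case_nat x e) c\<close> interleaves after the push. So a variable at
    \<open>2 * j\<close> with \<open>j > 0\<close> is found one place lower, and a parameter at
    \<open>2 * j + 1\<close> one place higher.\<close>
  define f where "f i = (if i = 0 then 0 else if even i then i - 1 else i + 1)" for i :: nat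
  have f: "(\<lambda>i. case_nat x (mix e c) (f i)) = mix (case_nat x e) c" for x e
  proof
    fix i show "case_nat x (mix e c) (f i) = mix (case_nat x e) c i"
    proof (cases "even i")
      case True
      then obtain j where "i = 2 * j" by (elim evenE)
      then show ?thesis by (cases j) (auto simp: f_def mix_def)
    next
      case False
      then obtain j where "i = 2 * j + 1" by (elim oddE)
      then show ?thesis by (auto simp: f_def mix_def)
    qed
  qed
  show ?thesis unfolding dfb_def
  proof (intro exI conjI allI impI)
    show "range c \<subseteq> insert (Atoms S) X" by fact
    fix e :: "nat \<Rightarrow> 'a" assume e: "range e \<subseteq> Univ S"
    have "Q x e = sat S (mix (case_nat x e) c) \<phi>" if "x \<in> Univ S" for x
    proof -
      have "range (case_nat x e) \<subseteq> Univ S" using that e by (auto split: nat.splits intro: subsetD[OF e rangeI])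
      then show ?thesis using c(2)[of "case_nat x e"] by simp
    qed
    then show "(\<exists>x\<in>Univ S. Q x e) = sat S (mix e c) (FEx (ren f \<phi>))"
      by (simp add: sat_ren f)
  qed
qed

lemma dfb_all:
  assumes "dfb S X (\<lambda>e. Q (e 0) (\<lambda>i. e (Suc i)))"
  shows "dfb S X (\<lambda>e. \<forall>x\<in>Univ S. Q x e)"
  by (rule dfb_cong[OF dfb_not[OF dfb_ex[where Q = "\<lambda>x e. \<not> Q x e"]]]) (auto intro: dfb_not assms)

lemma dfb_True: "dfb S X (\<lambda>e. True)"
  by (rule dfb_cong[OF dfb_eq[of _ _ "\<lambda>e. e 0" "\<lambda>e. e 0"]]) (auto intro: tm_var)

lemma dfb_triv: "dfb S X (\<lambda>e. b)"
  using dfb_True dfb_not[OF dfb_True] by (cases b) auto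

lemma dfb_Collect: "dfb S X (\<lambda>e. Q (t e) e) \<Longrightarrow> dfb S X (\<lambda>e. t e \<in> {a. Q a e})"
  by simp

lemmas tm_intros = tm_var tm_Atoms tm_const tm_shift tm_shift2 tm_shift3 tm_shift4
lemmas dfb_base = dfb_mem dfb_eq dfb_not dfb_conj dfb_disj dfb_imp dfb_iff dfb_if dfb_ex dfb_all

lemma tm_Univ: "tm S X t \<Longrightarrow> X \<subseteq> Univ S \<Longrightarrow> Atoms S \<in> Univ S \<Longrightarrow> range e \<subseteq> Univ S \<Longrightarrow> t e \<in> Univ S"
  by (auto simp: tm_def)

section \<open>Definability of the basic notions\<close>

locale str =
  fixes S :: "('a, 'm) str_scheme"
  assumes AtomsU: "Atoms S \<in> Univ S"
begin

lemma eltsU: "y \<in> elts S x \<Longrightarrow> y \<in> Univ S"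
  by (simp add: elts_def)

text \<open>Definitions such as \<open>is_opair\<close> and \<open>graph\<close> quantify over the
  whole type, formulas only over \<open>Univ S\<close>. Facts of this kind show that both readings
  agree.\<close>

lemma is_upairD: "is_upair S z a b \<Longrightarrow> z \<in> Univ S \<and> a \<in> Univ S \<and> b \<in> Univ S"
  by (auto simp: is_upair_def is_set_def elts_def)

lemma is_opairD: "is_opair S z a b \<Longrightarrow> z \<in> Univ S \<and> a \<in> Univ S \<and> b \<in> Univ S"
  unfolding is_opair_def using is_upairD by blast

lemma graphU: "(a, b) \<in> graph S f \<Longrightarrow> a \<in> Univ S \<and> b \<in> Univ S"
  by (auto simp: graph_def dest: is_opairD)

lemma graph_fst: "(a, b) \<in> graph S f \<Longrightarrow> a \<in> Univ S"
  and graph_snd: "(a, b) \<in> graph S f \<Longrightarrow> b \<in> Univ S"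
  using graphU by auto

context
  fixes X assumes XU: "X \<subseteq> Univ S"
begin

lemmas tmU = tm_Univ[OF _ XU AtomsU]

lemma dfb_elts: "tm S X t \<Longrightarrow> tm S X u \<Longrightarrow> dfb S X (\<lambda>e. t e \<in> elts S (u e))"
  by (rule dfb_cong[OF dfb_mem]) (auto simp: elts_def tmU)

lemma dfb_atom: "tm S X t \<Longrightarrow> dfb S X (\<lambda>e. atom S (t e))"
  unfolding atom_def by (intro dfb_elts tm_Atoms)

lemma dfb_is_set: "tm S X t \<Longrightarrow> dfb S X (\<lambda>e. is_set S (t e))"
  by (rule dfb_cong[OF dfb_not[OF dfb_atom]]) (auto simp: is_set_def tmU)

lemma dfb_ball: "tm S X u \<Longrightarrow> dfb S X (\<lambda>e. Q (e 0) (\<lambda>i. e (Suc i))) \<Longrightarrow> dfb S X (\<lambda>e. \<forall>x\<in>elts S (u e). Q x e)"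
  by (rule dfb_cong[where Q="\<lambda>e. \<forall>x\<in>Univ S. x \<in> elts S (u e) \<longrightarrow> Q x e"])
   ((intro dfb_all dfb_imp dfb_elts tm_intros; assumption), auto simp: elts_def)

lemma dfb_bex: "tm S X u \<Longrightarrow> dfb S X (\<lambda>e. Q (e 0) (\<lambda>i. e (Suc i))) \<Longrightarrow> dfb S X (\<lambda>e. \<exists>x\<in>elts S (u e). Q x e)"
  by (rule dfb_cong[where Q="\<lambda>e. \<exists>x\<in>Univ S. x \<in> elts S (u e) \<and> Q x e"])
   ((intro dfb_ex dfb_conj dfb_elts tm_intros; assumption), auto simp: elts_def)

lemma dfb_is_upair: "tm S X z \<Longrightarrow> tm S X a \<Longrightarrow> tm S X b \<Longrightarrow> dfb S X (\<lambda>e. is_upair S (z e) (a e) (b e))"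
  by (rule dfb_cong[where Q="\<lambda>e. is_set S (z e) \<and> (\<forall>x\<in>Univ S. x \<in> elts S (z e) \<longleftrightarrow> x = a e \<or> x = b e)"],
     intro dfb_base dfb_is_set dfb_elts tm_intros; assumption?)
   (auto simp: is_upair_def elts_def tmU)

lemma dfb_is_opair: "tm S X z \<Longrightarrow> tm S X a \<Longrightarrow> tm S X b \<Longrightarrow> dfb S X (\<lambda>e. is_opair S (z e) (a e) (b e))"
  by (rule dfb_cong[where Q="\<lambda>e. \<exists>u\<in>Univ S. \<exists>v\<in>Univ S. is_upair S u (a e) (a e) \<and> is_upair S v (a e) (b e) \<and> is_upair S (z e) u v"],
     intro dfb_base dfb_is_upair tm_intros; assumption?)
   (use is_upairD in \<open>unfold is_opair_def, blast\<close>)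

lemma dfb_graph: "tm S X f \<Longrightarrow> tm S X a \<Longrightarrow> tm S X b \<Longrightarrow> dfb S X (\<lambda>e. (a e, b e) \<in> graph S (f e))"
  unfolding graph_def mem_Collect_eq case_prod_conv
  by (intro dfb_bex dfb_is_opair tm_intros; assumption?)

text \<open>Here the bound is a class that may depend on the environment, not the extension of a
  term.\<close>

lemma dfb_bexK:
  assumes "\<And>e. range e \<subseteq> Univ S \<Longrightarrow> K e \<subseteq> Univ S"
    and "dfb S X (\<lambda>e. e 0 \<in> K (\<lambda>i. e (Suc i)))" "dfb S X (\<lambda>e. Q (e 0) (\<lambda>i. e (Suc i)))"
  shows "dfb S X (\<lambda>e. \<exists>x\<in>K e. Q x e)"
  by (rule dfb_cong[where Q="\<lambda>e. \<exists>x\<in>Univ S. x \<in> K e \<and> Q x e"])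
    (intro dfb_ex dfb_conj assms, use assms(1) in blast)

lemma dfb_ballK:
  assumes "\<And>e. range e \<subseteq> Univ S \<Longrightarrow> K e \<subseteq> Univ S"
    and "dfb S X (\<lambda>e. e 0 \<in> K (\<lambda>i. e (Suc i)))" "dfb S X (\<lambda>e. Q (e 0) (\<lambda>i. e (Suc i)))"
  shows "dfb S X (\<lambda>e. \<forall>x\<in>K e. Q x e)"
  by (rule dfb_cong[where Q="\<lambda>e. \<forall>x\<in>Univ S. x \<in> K e \<longrightarrow> Q x e"])
    (intro dfb_all dfb_imp assms, use assms(1) in blast)

lemma dfb_ball_graph:
  assumes "tm S X f" "dfb S X (\<lambda>e. Q (e 1) (e 0) (\<lambda>i. e (Suc (Suc i))))"
  shows "dfb S X (\<lambda>e. \<forall>(a, b)\<in>graph S (f e). Q a b e)"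
  by (rule dfb_cong[where Q="\<lambda>e. \<forall>a\<in>Univ S. \<forall>b\<in>Univ S. (a, b) \<in> graph S (f e) \<longrightarrow> Q a b e"],
      intro dfb_base dfb_graph tm_intros assms(1))
    (use assms(2) graphU in \<open>auto\<close>)

lemma dfb_bex_graph:
  assumes "tm S X f" "dfb S X (\<lambda>e. Q (e 1) (e 0) (\<lambda>i. e (Suc (Suc i))))"
  shows "dfb S X (\<lambda>e. \<exists>(a, b)\<in>graph S (f e). Q a b e)"
  by (rule dfb_cong[where Q="\<lambda>e. \<exists>a\<in>Univ S. \<exists>b\<in>Univ S. (a, b) \<in> graph S (f e) \<and> Q a b e"],
      intro dfb_base dfb_graph tm_intros assms(1))
    (use assms(2) in simp, use graphU in \<open>unfold case_prod_unfold, force\<close>)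

lemma dfb_fun_in:
  assumes f: "tm S X f" and K: "\<And>e. range e \<subseteq> Univ S \<Longrightarrow> K e \<subseteq> Univ S"
    and dK: "dfb S X (\<lambda>e. e 0 \<in> K (\<lambda>i. e (Suc i)))" and dL: "dfb S X (\<lambda>e. e 0 \<in> L (\<lambda>i. e (Suc i)))"
  shows "dfb S X (\<lambda>e. fun_in S (f e) (K e) (L e))"
proof -
  \<comment> \<open>The equations and inclusions between HOL sets in \<open>fun_in\<close> are
    replaced by membership tests at elements of \<open>Univ S\<close>, which a formula can
    express.\<close>
  have eq: "fun_in S h A B \<longleftrightarrow> is_set S h \<and> (\<forall>z\<in>elts S h. \<exists>a\<in>Univ S. \<exists>b\<in>Univ S. is_opair S z a b) \<and>
    (\<forall>a\<in>Univ S. \<forall>b\<in>Univ S. \<forall>c\<in>Univ S. (a, b) \<in> graph S h \<longrightarrow> (a, c) \<in> graph S h \<longrightarrow> b = c) \<and>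
    (\<forall>a\<in>Univ S. (\<exists>b\<in>Univ S. (a, b) \<in> graph S h) \<longleftrightarrow> a \<in> A) \<and>
    (\<forall>b\<in>Univ S. (\<exists>a\<in>Univ S. (a, b) \<in> graph S h) \<longrightarrow> b \<in> B)" (is "?l \<longleftrightarrow> ?r") if "A \<subseteq> Univ S" for h A B
  proof
    assume ?l
    then show ?r unfolding fun_in_def single_valued_def Domain_def Range_def
      by (safe; (meson graphU is_opairD)?) (blast dest: graphU is_opairD)+
  next
    assume ?r
    then show ?l unfolding fun_in_def single_valued_def Domain_def Range_def
      using that by (auto dest: graphU is_opairD) (blast dest: graphU is_opairD)+
  qed
  show ?thesis
    by (rule dfb_cong[OF _ eq[OF K]],
        (intro dfb_base dfb_ball dfb_is_set dfb_graph dfb_is_opair tm_intros f))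
     (use dK dL in \<open>simp_all\<close>)
qed
end
end

text \<open>Only the even positions are renamed, so the parameters keep their places.\<close>

lemma dfb_reindex:
  assumes "dfb S X Q"
  shows "dfb S X (\<lambda>e. Q (\<lambda>i. e (f i)))"
proof -
  obtain \<phi> c where c: "range c \<subseteq> insert (Atoms S) X"
      "\<And>e. range e \<subseteq> Univ S \<Longrightarrow> Q e = sat S (mix e c) \<phi>"
    using assms by (auto simp: dfb_def)
  define g where "g i = (if even i then 2 * f (i div 2) else i)" for i
  have g: "mix (\<lambda>i. e (f i)) c = (\<lambda>i. mix e c (g i))" for e
    by (auto simp: mix_def g_def)
  show ?thesis unfolding dfb_def
    by (intro exI[of _ "ren g \<phi>"] exI[of _ c] conjI c(1) allI impI)
      (subst c(2), auto simp: g sat_ren)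
qed

lemma dfb_class_shift:
  assumes "dfb S X (\<lambda>e. e 0 \<in> K (\<lambda>i. e (Suc i)))"
  shows "dfb S X (\<lambda>e. e 0 \<in> K (\<lambda>i. e (Suc (Suc i))))"
    "dfb S X (\<lambda>e. e 0 \<in> K (\<lambda>i. e (Suc (Suc (Suc i)))))"
  using dfb_reindex[OF assms, of "case_nat 0 (\<lambda>i. Suc (Suc i))"]
    dfb_reindex[OF assms, of "case_nat 0 (\<lambda>i. Suc (Suc (Suc i)))"] by simp_all

context str
begin

lemma natsU: "n \<in> nats S \<Longrightarrow> n \<in> Univ S"
  by (simp add: nats_def)

lemma QQU: "h \<in> QQ S \<Longrightarrow> h \<in> Univ S"
  by (simp add: QQ_def)

lemma IIU: "h \<in> II S \<Longrightarrow> h \<in> Univ S"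
  by (simp add: II_def QQU)

lemma PPU: "f \<in> PP S \<Longrightarrow> f \<in> Univ S"
  by (auto simp: PP_def PPn_def)

lemma fun_inU: "fun_in S f K L \<Longrightarrow> f \<in> Univ S"
  by (auto simp: fun_in_def is_set_def)

lemma eltsU': "elts S x \<subseteq> Univ S"
  using eltsU by blast

lemma DomainU: "Domain (graph S f) \<subseteq> Univ S"
  by (auto intro: graph_fst)

text \<open>The class \<open>D\<close> in the definition of \<open>QQ\<close> is bound by a
  second-order quantifier. It can only be the domain of \<open>h\<close>, and naming it makes
  membership in \<open>QQ\<close> a first-order condition.\<close>

lemma QQ_iff: "h \<in> QQ S \<longleftrightarrow> h \<in> Univ S \<and> (\<forall>a\<in>Univ S. a \<in> Domain (graph S h) \<longrightarrow> a \<in> nats S) \<and>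
   finite_in S (Domain (graph S h)) \<and> fun_in S h (Domain (graph S h)) (bits S)"
(is "?l \<longleftrightarrow> ?r")
proof
  assume ?l
  then obtain D where "h \<in> Univ S" "D \<subseteq> nats S" "finite_in S D" "fun_in S h D (bits S)"
    by (auto simp: QQ_def)
  moreover from this have "D = Domain (graph S h)" by (simp add: fun_in_def)
  ultimately show ?r by (simp add: subset_iff)
next
  assume r: ?r
  then have "Domain (graph S h) \<subseteq> nats S" using DomainU by (meson subset_iff)
  with r show ?l unfolding QQ_def mem_Collect_eq by (intro conjI exI[of _ "Domain (graph S h)"]) simp_all
qed

lemma fiberU1: "{a. \<exists>h\<in>Univ S. h \<in> II S \<and> (a, h) \<in> graph S f} \<subseteq> Univ S"
  by (auto intro: graph_fst)

lemma fiberU2: "{a. (a, t) \<in> graph S f} \<subseteq> Univ S"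
  by (auto intro: graph_fst)

lemma PPn_iff: "f \<in> PPn S n \<longleftrightarrow> f \<in> Univ S \<and> fun_in S f (elts S (Atoms S)) (QQ S) \<and>
     (\<forall>(a, h) \<in> graph S f. \<forall>x\<in>Univ S. x \<in> Domain (graph S h) \<longleftrightarrow> x \<in> elts S n) \<and>
     countable_in S {a. \<exists>h\<in>Univ S. h \<in> II S \<and> (a, h) \<in> graph S f} \<and>
     (\<forall>t\<in>Univ S. fun_in S t (elts S n) (bits S) \<longrightarrow> \<not> finite_in S {a. (a, t) \<in> graph S f})"
proof -
  have 1: "{a. \<exists>h\<in>Univ S. h \<in> II S \<and> (a, h) \<in> graph S f} = {a. \<exists>h\<in>II S. (a, h) \<in> graph S f}"
    using IIU by (intro Collect_cong) blast
  have "Domain (graph S h) = elts S n \<longleftrightarrow> (\<forall>x\<in>Univ S. x \<in> Domain (graph S h) \<longleftrightarrow> x \<in> elts S n)" for h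
    using DomainU[of h] eltsU'[of n] unfolding set_eq_iff subset_iff by meson
  then show ?thesis unfolding PPn_def mem_Collect_eq 1 by simp
qed

lemma Perms_iff: "\<pi> \<in> Perms S \<longleftrightarrow> inj_in S \<pi> (elts S (Atoms S)) (elts S (Atoms S)) \<and>
     (\<forall>b\<in>elts S (Atoms S). \<exists>a\<in>Univ S. (a, b) \<in> graph S \<pi>)"
proof
  assume "\<pi> \<in> Perms S"
  then have "inj_in S \<pi> (elts S (Atoms S)) (elts S (Atoms S))" "Range (graph S \<pi>) = elts S (Atoms S)"
    by (auto simp: Perms_def)
  then show "inj_in S \<pi> (elts S (Atoms S)) (elts S (Atoms S)) \<and>
     (\<forall>b\<in>elts S (Atoms S). \<exists>a\<in>Univ S. (a, b) \<in> graph S \<pi>)" by (metis Range_iff graph_fst)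
next
  assume h: "inj_in S \<pi> (elts S (Atoms S)) (elts S (Atoms S)) \<and>
     (\<forall>b\<in>elts S (Atoms S). \<exists>a\<in>Univ S. (a, b) \<in> graph S \<pi>)"
  then have "fun_in S \<pi> (elts S (Atoms S)) (elts S (Atoms S))" by (simp add: inj_in_def)
  then have "Range (graph S \<pi>) \<subseteq> elts S (Atoms S)" "\<pi> \<in> Univ S" by (simp_all add: fun_in_def is_set_def)
  moreover have "elts S (Atoms S) \<subseteq> Range (graph S \<pi>)" using h by blast
  ultimately show "\<pi> \<in> Perms S" using h by (simp add: Perms_def)
qed

lemma acts_iff: "acts S \<pi> x y \<longleftrightarrow> (\<exists>h\<in>Univ S. (x, y) \<in> graph S h \<and>
        (\<forall>(u, v) \<in> graph S h.
           if atom S u then (u, v) \<in> graph S \<pi>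
           else is_set S v \<and> (\<forall>a\<in>elts S u. a \<in> Domain (graph S h)) \<and>
                (\<forall>b\<in>Univ S. b \<in> elts S v \<longleftrightarrow> (\<exists>a\<in>elts S u. (a, b) \<in> graph S h))))"
proof -
  have "elts S v = graph S h `` elts S u \<longleftrightarrow>
     (\<forall>b\<in>Univ S. b \<in> elts S v \<longleftrightarrow> (\<exists>a\<in>elts S u. (a, b) \<in> graph S h))" for u v h
    by (auto simp: set_eq_iff dest: eltsU intro: graph_snd)
  then show ?thesis unfolding acts_def subset_iff Ball_def by presburger
qed

context
  fixes X assumes XU: "X \<subseteq> Univ S"
begin

lemmas dfb1 = dfb_elts[OF XU] dfb_atom[OF XU] dfb_is_set[OF XU] dfb_ball[OF XU] dfb_bex[OF XU]
  dfb_is_upair[OF XU] dfb_is_opair[OF XU] dfb_graph[OF XU] dfb_base tm_intros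
lemmas tmU1 = tm_Univ[OF _ XU AtomsU]

lemma dfb_is_zero: "tm S X z \<Longrightarrow> dfb S X (\<lambda>e. is_zero S (z e))"
  by (rule dfb_cong[where Q="\<lambda>e. is_set S (z e) \<and> (\<forall>x\<in>Univ S. \<not> x \<in> elts S (z e))"],
    intro dfb1; assumption?) (auto simp: is_zero_def elts_def)

lemma dfb_is_one: "tm S X z \<Longrightarrow> dfb S X (\<lambda>e. is_one S (z e))"
  by (rule dfb_cong[where Q="\<lambda>e. is_set S (z e) \<and> (\<exists>y\<in>Univ S. is_zero S y \<and> (\<forall>x\<in>Univ S. x \<in> elts S (z e) \<longleftrightarrow> x = y))"],
    intro dfb1 dfb_is_zero; assumption?) (auto simp: is_one_def is_zero_def is_set_def elts_def)

lemma dfb_bits: "tm S X z \<Longrightarrow> dfb S X (\<lambda>e. z e \<in> bits S)"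
  unfolding bits_def mem_Collect_eq by (intro dfb1 dfb_is_zero dfb_is_one)

lemma dfb_is_succ: "tm S X y \<Longrightarrow> tm S X x \<Longrightarrow> dfb S X (\<lambda>e. is_succ S (y e) (x e))"
  by (rule dfb_cong[where Q="\<lambda>e. is_set S (y e) \<and> (\<forall>z\<in>Univ S. z \<in> elts S (y e) \<longleftrightarrow> z = x e \<or> z \<in> elts S (x e))"],
    intro dfb1; assumption?) (auto simp: is_succ_def elts_def tmU1)

lemma dfb_inductive_in: "tm S X w \<Longrightarrow> dfb S X (\<lambda>e. inductive_in S (w e))"
  unfolding inductive_in_def by (intro dfb1 dfb_is_zero dfb_is_succ)

lemma dfb_nats: "tm S X n \<Longrightarrow> dfb S X (\<lambda>e. n e \<in> nats S)"
  by (rule dfb_cong[where Q="\<lambda>e. \<forall>w\<in>Univ S. inductive_in S w \<longrightarrow> n e \<in> elts S w"],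
    intro dfb1 dfb_inductive_in; assumption?) (auto simp: nats_def tmU1)

lemma dfb_inj_in:
  assumes f: "tm S X f" and K: "\<And>e. range e \<subseteq> Univ S \<Longrightarrow> K e \<subseteq> Univ S"
    and dK: "dfb S X (\<lambda>e. e 0 \<in> K (\<lambda>i. e (Suc i)))" and dL: "dfb S X (\<lambda>e. e 0 \<in> L (\<lambda>i. e (Suc i)))"
  shows "dfb S X (\<lambda>e. inj_in S (f e) (K e) (L e))"
  by (rule dfb_cong[where Q="\<lambda>e. fun_in S (f e) (K e) (L e) \<and>
    (\<forall>a\<in>Univ S. \<forall>b\<in>Univ S. \<forall>c\<in>Univ S. (a, c) \<in> graph S (f e) \<longrightarrow> (b, c) \<in> graph S (f e) \<longrightarrow> a = b)"],
    intro dfb1 dfb_fun_in[OF XU] assms; assumption?)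
   (unfold inj_in_def single_valued_def converse_iff, meson graph_fst graph_snd)

lemma dfb_finite_in:
  assumes K: "\<And>e. range e \<subseteq> Univ S \<Longrightarrow> K e \<subseteq> Univ S"
    and dK: "dfb S X (\<lambda>e. e 0 \<in> K (\<lambda>i. e (Suc i)))"
  shows "dfb S X (\<lambda>e. finite_in S (K e))"
  by (rule dfb_cong[where Q="\<lambda>e. \<exists>n\<in>Univ S. \<exists>f\<in>Univ S. n \<in> nats S \<and> inj_in S f (K e) (elts S n)"],
     intro dfb1 dfb_nats dfb_inj_in dfb_class_shift(2)[OF dK] K)
   (auto simp: finite_in_def dest: natsU)

lemma dfb_countable_in:
  assumes K: "\<And>e. range e \<subseteq> Univ S \<Longrightarrow> K e \<subseteq> Univ S"
    and dK: "dfb S X (\<lambda>e. e 0 \<in> K (\<lambda>i. e (Suc i)))"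
  shows "dfb S X (\<lambda>e. countable_in S (K e))"
  unfolding countable_in_def
  by (intro dfb1 dfb_nats dfb_inj_in dfb_class_shift(1)[OF dK] K) auto

lemma dfb_Domain: "tm S X f \<Longrightarrow> tm S X a \<Longrightarrow> dfb S X (\<lambda>e. a e \<in> Domain (graph S (f e)))"
  by (rule dfb_cong[where Q="\<lambda>e. \<exists>b\<in>Univ S. (a e, b) \<in> graph S (f e)"], intro dfb1; assumption?)
    (meson Domain_iff graph_snd)

lemma dfb_Univ: "tm S X h \<Longrightarrow> dfb S X (\<lambda>e. h e \<in> Univ S)"
  by (rule dfb_cong[OF dfb_True]) (simp add: tmU1)

lemma dfb_QQ: "tm S X h \<Longrightarrow> dfb S X (\<lambda>e. h e \<in> QQ S)"
  by (rule dfb_cong[OF _ QQ_iff],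
    intro dfb1 dfb_Univ dfb_Domain dfb_nats dfb_finite_in dfb_fun_in[OF XU] dfb_bits DomainU; assumption?)

lemma dfb_Q_le: "tm S X h0 \<Longrightarrow> tm S X h1 \<Longrightarrow> dfb S X (\<lambda>e. Q_le S (h0 e) (h1 e))"
  by (rule dfb_cong[where Q="\<lambda>e. \<forall>a\<in>Univ S. \<forall>b\<in>Univ S. (a, b) \<in> graph S (h1 e) \<longrightarrow> (a, b) \<in> graph S (h0 e)"],
    intro dfb1; assumption?) (auto simp: Q_le_def intro: graph_fst graph_snd)

lemma dfb_II: "tm S X h \<Longrightarrow> dfb S X (\<lambda>e. h e \<in> II S)"
  by (rule dfb_cong[where Q="\<lambda>e. h e \<in> QQ S \<and> (\<exists>n\<in>Univ S. \<exists>z\<in>Univ S. is_zero S z \<and> (n, z) \<in> graph S (h e))"],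
    intro dfb1 dfb_QQ dfb_is_zero; assumption?) (unfold II_def mem_Collect_eq, meson graph_fst graph_snd)

lemma dfb_PPn: "tm S X f \<Longrightarrow> tm S X n \<Longrightarrow> dfb S X (\<lambda>e. f e \<in> PPn S (n e))"
  by (rule dfb_cong[OF _ PPn_iff],
    intro dfb1 dfb_Univ dfb_Domain dfb_countable_in dfb_finite_in dfb_fun_in[OF XU] dfb_bits dfb_QQ dfb_II
      dfb_Collect dfb_ball_graph[OF XU] eltsU'; (assumption | rule fiberU1 fiberU2)?)

lemma dfb_PP: "tm S X f \<Longrightarrow> dfb S X (\<lambda>e. f e \<in> PP S)"
  by (rule dfb_cong[where Q="\<lambda>e. \<exists>n\<in>Univ S. n \<in> nats S \<and> f e \<in> PPn S n"],
    intro dfb1 dfb_nats dfb_PPn; assumption?) (auto simp: PP_def dest: natsU)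

lemma dfb_P_le: "tm S X f0 \<Longrightarrow> tm S X f1 \<Longrightarrow> dfb S X (\<lambda>e. P_le S (f0 e) (f1 e))"
  by (rule dfb_cong[where Q="\<lambda>e. \<forall>a\<in>Univ S. \<forall>h0\<in>Univ S. \<forall>h1\<in>Univ S. (a, h0) \<in> graph S (f0 e) \<longrightarrow> (a, h1) \<in> graph S (f1 e) \<longrightarrow> Q_le S h0 h1"],
    intro dfb1 dfb_Q_le; assumption?) (unfold P_le_def, meson graph_fst graph_snd)

lemma dfb_Perms: "tm S X f \<Longrightarrow> dfb S X (\<lambda>e. f e \<in> Perms S)"
  by (rule dfb_cong[OF _ Perms_iff], intro dfb1 dfb_inj_in eltsU'; assumption?)

lemma dfb_acts: "tm S X \<pi> \<Longrightarrow> tm S X x \<Longrightarrow> tm S X y \<Longrightarrow> dfb S X (\<lambda>e. acts S (\<pi> e) (x e) (y e))"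
  by (rule dfb_cong[OF _ acts_iff], intro dfb1 dfb_Domain dfb_ball_graph[OF XU]; assumption?)

lemmas dfb_notions = dfb_elts[OF XU] dfb_Univ dfb_atom[OF XU] dfb_is_set[OF XU] dfb_ball[OF XU] dfb_bex[OF XU]
  dfb_is_upair[OF XU] dfb_is_opair[OF XU] dfb_graph[OF XU] dfb_is_zero dfb_is_one dfb_bits dfb_is_succ
  dfb_inductive_in dfb_nats dfb_Domain dfb_QQ dfb_Q_le dfb_II dfb_PPn dfb_PP dfb_P_le dfb_Perms dfb_acts

end

lemmas dfbs = dfb_notions[OF subset_refl] dfb_base dfb_Collect dfb_triv tm_intros

section \<open>Definability of the forcing relation\<close>

lemma dfb_name_closed:
  assumes XU: "X \<subseteq> Univ S"
    and P: "P \<subseteq> Univ S" "\<And>t. tm S X t \<Longrightarrow> dfb S X (\<lambda>e. t e \<in> P)"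
    and N: "tm S X N"
  shows "dfb S X (\<lambda>e. name_closed S P (N e))"
  unfolding name_closed_def
  by (intro dfb1[OF XU] dfb_bexK[OF XU, of "\<lambda>_. P"] P N)

lemma dfb_triple_in: 
  assumes XU: "X \<subseteq> Univ S"
    and "tm S X R" "tm S X p" "tm S X s" "tm S X t"
  shows "dfb S X (\<lambda>e. triple_in S (R e) (p e) (s e) (t e))"
  by (rule dfb_cong[where Q="\<lambda>e. \<exists>w\<in>Univ S. is_opair S w (s e) (t e) \<and> (p e, w) \<in> graph S (R e)"],
   intro dfb1[OF XU] assms) (auto simp: triple_in_def dest: is_opairD)

lemma dfb_forces_eq_step:
  assumes XU: "X \<subseteq> Univ S"
    and P: "P \<subseteq> Univ S" "\<And>t. tm S X t \<Longrightarrow> dfb S X (\<lambda>e. t e \<in> P)"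
    and le: "\<And>t u. tm S X t \<Longrightarrow> tm S X u \<Longrightarrow> dfb S X (\<lambda>e. le (t e) (u e))"
    and "tm S X R" "tm S X p" "tm S X s" "tm S X t"
  shows "dfb S X (\<lambda>e. forces_eq_step S P le (triple_in S (R e)) (p e) (s e) (t e))"
  unfolding forces_eq_step_def
  by (intro dfb1[OF XU] dfb_bexK[OF XU, of "\<lambda>_. P"] dfb_ballK[OF XU, of "\<lambda>_. P"] P le dfb_ball_graph[OF XU] dfb_bex_graph[OF XU] dfb_triple_in[OF XU] assms)

text \<open>Forced equality is recursive in nature, but the existence of a set carrying a run of the
  recursion is a single formula. The parameter set stays arbitrary: the case of no parameters yields
  invariance under automorphisms.\<close>

lemma dfb_forces_eq:
  assumes XU: "X \<subseteq> Univ S"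
    and P: "P \<subseteq> Univ S" "\<And>t. tm S X t \<Longrightarrow> dfb S X (\<lambda>e. t e \<in> P)"
    and le: "\<And>t u. tm S X t \<Longrightarrow> tm S X u \<Longrightarrow> dfb S X (\<lambda>e. le (t e) (u e))"
    and "tm S X p" "tm S X s" "tm S X t"
  shows "dfb S X (\<lambda>e. forces_eq S P le (p e) (s e) (t e))"
  apply (rule dfb_cong[where Q="\<lambda>e. \<exists>N\<in>Univ S. \<exists>R\<in>Univ S. name_closed S P N \<and> s e \<in> elts S N \<and> t e \<in> elts S N \<and>
        (\<forall>p'\<in>P. \<forall>s'\<in>elts S N. \<forall>t'\<in>elts S N.
           triple_in S R p' s' t' \<longleftrightarrow> forces_eq_step S P le (triple_in S R) p' s' t') \<and>
        triple_in S R (p e) (s e) (t e)"])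
   apply (intro dfb1[OF XU] dfb_ballK[OF XU, of "\<lambda>_. P"] P le dfb_triple_in[OF XU] dfb_forces_eq_step[OF XU] dfb_name_closed[OF XU] assms)
  apply (unfold forces_eq_def)
  apply (auto simp: name_closed_def is_set_def)
  done

end

section \<open>Zermelo set theory in a structure\<close>

text \<open>The common ground of \<open>V\<close> and \<open>B\<close>. These axioms pass to the
  permutation model by direct computation of supports, and forcing over \<open>B\<close> is
  developed from them. Separation is stated for definable HOL predicates instead of
  formulas.\<close>

locale zermelo = str +
  assumes atom_empty: "atom S a \<Longrightarrow> elts S a = {}"
    and ex_zero: "\<exists>z. is_zero S z"
    and extens: "is_set S x \<Longrightarrow> is_set S y \<Longrightarrow> elts S x = elts S y \<Longrightarrow> x = y"
    and pairing: "x \<in> Univ S \<Longrightarrow> y \<in> Univ S \<Longrightarrow> \<exists>z. is_upair S z x y"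
    and union: "is_set S x \<Longrightarrow> \<exists>u. is_set S u \<and> elts S u = (\<Union>y\<in>elts S x. elts S y)"
    and powerset: "is_set S x \<Longrightarrow> \<exists>u. is_set S u \<and> elts S u = {y. is_set S y \<and> elts S y \<subseteq> elts S x}"
    and separation: "dfb S (Univ S) (\<lambda>e. Q (e 0)) \<Longrightarrow> is_set S x \<Longrightarrow>
      \<exists>u. is_set S u \<and> elts S u = {y \<in> elts S x. Q y}"
begin

text \<open>\<open>isC K\<close>: the class \<open>K\<close> is a set of \<open>S\<close>, represented by the element \<open>mk K\<close>.  In the same way
  \<open>isR\<close> and \<open>rl\<close> below treat binary relations as sets of Kuratowski pairs \<open>pr a b\<close>.\<close>

definition isC :: "'a set \<Rightarrow> bool" where
  "isC K \<longleftrightarrow> (\<exists>u. is_set S u \<and> elts S u = K)"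

definition mk :: "'a set \<Rightarrow> 'a" where
  "mk K = (THE u. is_set S u \<and> elts S u = K)"

lemma mk: assumes "isC K" shows "is_set S (mk K)" "elts S (mk K) = K" "mk K \<in> Univ S"
proof -
  have "\<exists>!u. is_set S u \<and> elts S u = K" using assms extens by (auto simp: isC_def)
  then have "is_set S (mk K) \<and> elts S (mk K) = K" unfolding mk_def by (rule theI')
  then show "is_set S (mk K)" "elts S (mk K) = K" "mk K \<in> Univ S" by (auto simp: is_set_def)
qed

lemma mk_eqI: "is_set S u \<Longrightarrow> elts S u = K \<Longrightarrow> u = mk K"
  using mk[of K] extens[of u "mk K"] by (auto simp: isC_def)

lemma mk_inj: "isC K \<Longrightarrow> isC L \<Longrightarrow> mk K = mk L \<longleftrightarrow> K = L"
  using mk(2) by metis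

lemma set_or_atom: "x \<in> Univ S \<Longrightarrow> is_set S x \<or> atom S x"
  by (auto simp: is_set_def)

lemma is_setU: "is_set S x \<Longrightarrow> x \<in> Univ S"
  by (simp add: is_set_def)

lemma isC_sub_Univ: "isC K \<Longrightarrow> K \<subseteq> Univ S"
  using eltsU' by (auto simp: isC_def)

lemma isC_empty: "isC {}"
  using ex_zero by (auto simp: isC_def is_zero_def)

lemma is_set_Atoms: "is_set S (Atoms S)"
proof -
  have "\<not> atom S (Atoms S)" using atom_empty[of "Atoms S"] by (auto simp: atom_def)
  then show ?thesis using AtomsU by (simp add: is_set_def)
qed

lemma isC_elts: "x \<in> Univ S \<Longrightarrow> isC (elts S x)"
  using set_or_atom atom_empty isC_empty by (metis isC_def)

lemma isC_upair: "x \<in> Univ S \<Longrightarrow> y \<in> Univ S \<Longrightarrow> isC {x, y}"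
  using pairing[of x y] by (auto simp: isC_def is_upair_def)

lemma isC_sing: "x \<in> Univ S \<Longrightarrow> isC {x}"
  using isC_upair[of x x] by simp

lemma isC_UN_elts: "isC K \<Longrightarrow> isC (\<Union>y\<in>K. elts S y)"
  using union by (fastforce simp: isC_def)

lemma isC_Un: "isC K \<Longrightarrow> isC L \<Longrightarrow> isC (K \<union> L)"
  using isC_UN_elts[OF isC_upair[OF mk(3) mk(3)], of K L] by (simp add: mk(2))

lemma isC_insert: "x \<in> Univ S \<Longrightarrow> isC K \<Longrightarrow> isC (insert x K)"
  using isC_Un[OF isC_sing] by fastforce

lemma isC_sep: "isC K \<Longrightarrow> dfb S (Univ S) (\<lambda>e. Q (e 0)) \<Longrightarrow> isC {y \<in> K. Q y}"
  using separation[of Q] by (fastforce simp: isC_def)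

lemma isC_subset: "isC K \<Longrightarrow> L \<subseteq> K \<Longrightarrow> dfb S (Univ S) (\<lambda>e. e 0 \<in> L) \<Longrightarrow> isC L"
  using isC_sep[of K "\<lambda>y. y \<in> L"] by (simp add: Collect_conj_eq Int_absorb1 inf.absorb2)

lemma isC_Pow: "isC K \<Longrightarrow> isC {y. is_set S y \<and> elts S y \<subseteq> K}"
  using powerset by (fastforce simp: isC_def)

lemma isC_iff: "isC K \<Longrightarrow> \<exists>k\<in>Univ S. K = elts S k"
  using mk by metis

lemma dfb_isC: "isC K \<Longrightarrow> tm S (Univ S) t \<Longrightarrow> dfb S (Univ S) (\<lambda>e. t e \<in> K)"
proof -
  assume K: "isC K" and t: "tm S (Univ S) t"
  obtain k where k: "k \<in> Univ S" "K = elts S k" using isC_iff[OF K] by blast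
  show ?thesis unfolding k(2) by (intro dfbs t k)
qed

lemma isC_Int: "isC K \<Longrightarrow> isC L \<Longrightarrow> isC (K \<inter> L)"
  by (rule isC_subset[of K]) (auto intro!: dfbs dfb_isC)

lemma isC_Diff: "isC K \<Longrightarrow> isC L \<Longrightarrow> isC (K - L)"
  by (rule isC_subset[of K]) (auto intro!: dfbs dfb_isC)

section \<open>Pairs, relations and functions as sets\<close>

definition pr :: "'a \<Rightarrow> 'a \<Rightarrow> 'a" where
  "pr a b = mk {mk {a}, mk {a, b}}"

lemma is_upair_iff: "is_upair S z a b \<longleftrightarrow> a \<in> Univ S \<and> b \<in> Univ S \<and> z = mk {a, b}"
  using mk[OF isC_upair, of a b] mk_eqI[of z "{a, b}"] is_upairD[of z a b] by (auto simp: is_upair_def)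

lemma is_opair_iff: "is_opair S z a b \<longleftrightarrow> a \<in> Univ S \<and> b \<in> Univ S \<and> z = pr a b"
  using mk(3)[OF isC_upair, of a b] mk(3)[OF isC_upair, of a a]
  by (auto simp: is_opair_def is_upair_iff pr_def)

lemma pr_props:
  assumes "a \<in> Univ S" "b \<in> Univ S"
  shows "pr a b \<in> Univ S" "is_set S (pr a b)" "elts S (pr a b) = {mk {a}, mk {a, b}}"
proof -
  have 1: "isC {mk {a}, mk {a, b}}"
    using assms by (intro isC_upair mk(3) isC_sing)
  from mk[OF 1] show "pr a b \<in> Univ S" "is_set S (pr a b)" "elts S (pr a b) = {mk {a}, mk {a, b}}"
    by (auto simp: pr_def)
qed

lemma pr_inject:
  assumes "a \<in> Univ S" "b \<in> Univ S" "c \<in> Univ S" "d \<in> Univ S"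
  shows "pr a b = pr c d \<longleftrightarrow> a = c \<and> b = d"
proof
  assume "pr a b = pr c d"
  then have "{mk {a}, mk {a, b}} = {mk {c}, mk {c, d}}" using pr_props(3) assms by metis
  then have "(mk {a} = mk {c} \<and> mk {a, b} = mk {c, d}) \<or> (mk {a} = mk {c, d} \<and> mk {a, b} = mk {c})"
    by (auto simp: doubleton_eq_iff)
  then have "({a} = {c} \<and> {a, b} = {c, d}) \<or> ({a} = {c, d} \<and> {a, b} = {c})"
    using assms by (simp add: mk_inj isC_sing isC_upair)
  then show "a = c \<and> b = d" by (auto simp: doubleton_eq_iff)
qed simp

lemma graph_iff: "(a, b) \<in> graph S f \<longleftrightarrow> a \<in> Univ S \<and> b \<in> Univ S \<and> pr a b \<in> elts S f"
  by (auto simp: graph_def is_opair_iff pr_props)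

definition prs :: "('a \<times> 'a) set \<Rightarrow> 'a set" where
  "prs R = {pr a b | a b. (a, b) \<in> R}"

definition isR :: "('a \<times> 'a) set \<Rightarrow> bool" where
  "isR R \<longleftrightarrow> R \<subseteq> Univ S \<times> Univ S \<and> isC (prs R)"

definition rl :: "('a \<times> 'a) set \<Rightarrow> 'a" where
  "rl R = mk (prs R)"

lemma rl: assumes "isR R" shows "is_set S (rl R)" "rl R \<in> Univ S" "elts S (rl R) = prs R" "graph S (rl R) = R"
proof -
  show *: "is_set S (rl R)" "rl R \<in> Univ S" "elts S (rl R) = prs R"
    using mk assms by (auto simp: isR_def rl_def)
  have "(a, b) \<in> graph S (rl R) \<longleftrightarrow> (a, b) \<in> R" for a b
    using assms pr_inject[of a b] unfolding graph_iff * prs_def isR_def by blast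
  then show "graph S (rl R) = R" by auto
qed

text \<open>Pairs with coordinates in \<open>A\<close> and \<open>B\<close> lie in the double power
  set of \<open>A \<union> B\<close>, from which separation cuts out the product.\<close>

lemma isC_prod: 
  assumes "isC A" "isC B" shows "isC (prs (A \<times> B))"
proof -
  let ?P = "\<lambda>K. {y. is_set S y \<and> elts S y \<subseteq> K}"
  have AB: "A \<union> B \<subseteq> Univ S" using isC_sub_Univ assms by blast
  have "isC (?P (?P (A \<union> B)))" by (intro isC_Pow isC_Un assms)
  moreover have "prs (A \<times> B) \<subseteq> ?P (?P (A \<union> B))"
  proof
    fix z assume "z \<in> prs (A \<times> B)"
    then obtain a b where ab: "a \<in> A" "b \<in> B" "z = pr a b" by (auto simp: prs_def)
    then have U: "a \<in> Univ S" "b \<in> Univ S" using AB by auto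
    show "z \<in> ?P (?P (A \<union> B))"
      using ab U by (simp add: pr_props mk[OF isC_sing] mk[OF isC_upair])
  qed
  moreover have "dfb S (Univ S) (\<lambda>e. e 0 \<in> prs (A \<times> B))"
    by (rule dfb_cong[where Q="\<lambda>e. \<exists>a\<in>Univ S. \<exists>b\<in>Univ S. a \<in> A \<and> b \<in> B \<and> is_opair S (e 0) a b"],
      intro dfbs dfb_isC assms) (use AB in \<open>unfold prs_def is_opair_iff mem_Collect_eq, blast\<close>)
  ultimately show ?thesis by (rule isC_subset)
qed

lemma isR_prod: "isC A \<Longrightarrow> isC B \<Longrightarrow> isR (A \<times> B)"
  using isC_prod isC_sub_Univ by (auto simp: isR_def)

text \<open>Separation inside \<open>prs (A \<times> B)\<close>. Most relations below become sets in
  this way.\<close>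

lemma isR_dfb:
  assumes "isC A" "isC B" "R \<subseteq> A \<times> B" "dfb S (Univ S) (\<lambda>e. (e 0, e 1) \<in> R)"
  shows "isR R"
proof -
  have U: "R \<subseteq> Univ S \<times> Univ S" using isC_sub_Univ assms(1-3) by blast
  have d: "dfb S (Univ S) (\<lambda>e. (e 1, e 0) \<in> R)"
    using dfb_reindex[OF assms(4), of "\<lambda>i. if i = 0 then 1 else 0"] by simp
  have "dfb S (Univ S) (\<lambda>e. e 0 \<in> prs R)"
  proof (rule dfb_cong[where Q="\<lambda>e. \<exists>a\<in>Univ S. \<exists>b\<in>Univ S. (a, b) \<in> R \<and> is_opair S (e 0) a b"], intro dfbs)
    show "dfb S (Univ S) (\<lambda>e. (e (Suc 0), e 0) \<in> R)" using d by simp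
  qed (use U in \<open>unfold prs_def is_opair_iff mem_Collect_eq, blast\<close>)
  moreover have "prs R \<subseteq> prs (A \<times> B)" using assms(3) by (auto simp: prs_def)
  ultimately have "isC (prs R)" using isC_subset[OF isC_prod[OF assms(1,2)]] by blast
  then show ?thesis using U by (simp add: isR_def)
qed

lemma isR_iff: "isR R \<Longrightarrow> \<exists>r\<in>Univ S. R = graph S r"
  using rl by metis

lemma dfb_isR: "isR R \<Longrightarrow> tm S (Univ S) t \<Longrightarrow> tm S (Univ S) u \<Longrightarrow> dfb S (Univ S) (\<lambda>e. (t e, u e) \<in> R)"
proof -
  assume K: "isR R" and t: "tm S (Univ S) t" "tm S (Univ S) u"
  obtain k where k: "k \<in> Univ S" "R = graph S k" using isR_iff[OF K] by blast
  show ?thesis unfolding k(2) by (intro dfbs t k)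
qed

lemma isR_U: "isR R \<Longrightarrow> (a, b) \<in> R \<Longrightarrow> a \<in> Univ S \<and> b \<in> Univ S"
  by (auto simp: isR_def)

lemma isC_field:
  assumes "isR R" shows "isC (Domain R)" "isC (Range R)"
proof -
  \<comment> \<open>Both coordinates of a pair are elements of an element of it, so the double union
    contains the whole field of \<open>R\<close>.\<close>
  let ?K = "\<Union>y\<in>(\<Union>y\<in>prs R. elts S y). elts S y"
  have K: "isC ?K" using assms by (intro isC_UN_elts) (simp add: isR_def)
  have *: "a \<in> ?K \<and> b \<in> ?K" if "(a, b) \<in> R" for a b
  proof -
    have U: "a \<in> Univ S" "b \<in> Univ S" using that assms isR_U by auto
    have "pr a b \<in> prs R" using that by (auto simp: prs_def)
    moreover have "mk {a, b} \<in> elts S (pr a b)" using pr_props(3)[OF U] by simp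
    moreover have "a \<in> elts S (mk {a, b})" "b \<in> elts S (mk {a, b})" using mk(2)[OF isC_upair[OF U]] by auto
    ultimately show ?thesis by blast
  qed
  have d: "dfb S (Univ S) (\<lambda>e. \<exists>b\<in>Univ S. (e 0, b) \<in> R)" "dfb S (Univ S) (\<lambda>e. \<exists>b\<in>Univ S. (b, e 0) \<in> R)"
    by (intro dfbs dfb_isR assms)+
  show "isC (Domain R)"
    by (rule isC_subset[OF K], use * in blast, rule dfb_cong[OF d(1)]) (use assms isR_U in blast)
  show "isC (Range R)"
    by (rule isC_subset[OF K], use * in blast, rule dfb_cong[OF d(2)]) (use assms isR_U in blast)
qed

lemma isR_sub: "isR R' \<Longrightarrow> R \<subseteq> R' \<Longrightarrow> dfb S (Univ S) (\<lambda>e. (e 0, e 1) \<in> R) \<Longrightarrow> isR R"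
  by (rule isR_dfb[OF isC_field]) auto

lemma isR_graph: assumes "f \<in> Univ S" shows "isR (graph S f)"
proof -
  have "isC (elts S f)" by (rule isC_elts[OF assms])
  moreover have "prs (graph S f) \<subseteq> elts S f" by (auto simp: prs_def graph_iff)
  moreover have "dfb S (Univ S) (\<lambda>e. e 0 \<in> prs (graph S f))"
    by (rule dfb_cong[where Q="\<lambda>e. \<exists>a\<in>Univ S. \<exists>b\<in>Univ S. (a, b) \<in> graph S f \<and> is_opair S (e 0) a b"],
      intro dfbs assms) (auto simp: prs_def is_opair_iff graph_iff)
  ultimately have "isC (prs (graph S f))" by (rule isC_subset)
  then show ?thesis using graphU by (auto simp: isR_def)
qed

lemma isR_converse: "isR R \<Longrightarrow> isR (R\<inverse>)"
  by (rule isR_dfb[OF isC_field(2) isC_field(1)]) (auto intro!: dfb_isR tm_intros)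

lemma isR_comp: assumes "isR R" "isR R'" shows "isR (R O R')"
proof (rule isR_dfb[OF isC_field(1)[OF assms(1)] isC_field(2)[OF assms(2)]])
  show "dfb S (Univ S) (\<lambda>e. (e 0, e 1) \<in> R O R')"
    by (rule dfb_cong[where Q="\<lambda>e. \<exists>b\<in>Univ S. (e 0, b) \<in> R \<and> (b, e 1) \<in> R'"],
      intro dfbs dfb_isR assms) (use assms isR_U in blast)
qed auto

lemma isR_Un: assumes "isR R" "isR R'" shows "isR (R \<union> R')"
  by (rule isR_dfb[of "Domain R \<union> Domain R'" "Range R \<union> Range R'"])
    (use assms in \<open>auto intro!: isC_Un isC_field dfbs dfb_isR\<close>)

lemma isR_restr: assumes "isR R" "isC A" shows "isR (R \<inter> A \<times> UNIV)"
  by (rule isR_sub[OF assms(1)]) (use assms in \<open>auto intro!: dfbs dfb_isR dfb_isC\<close>)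

lemma isR_Id_on: "isC A \<Longrightarrow> isR (Id_on A)"
  by (rule isR_dfb[of A A],
     (auto)[3], rule dfb_cong[where Q="\<lambda>e. e 0 = e 1 \<and> e 0 \<in> A"], auto intro!: dfbs dfb_isC)

text \<open>A function contains nothing but pairs and is therefore determined by its graph.
  Functions of \<open>S\<close> thus become HOL relations, whose compositions, converses and
  restrictions can be handled by the HOL calculus of relations.\<close>

lemma fun_in_iff: "fun_in S f K L \<longleftrightarrow> (\<exists>R. isR R \<and> f = rl R \<and> single_valued R \<and> Domain R = K \<and> Range R \<subseteq> L)"
proof
  assume f: "fun_in S f K L"
  then have s: "is_set S f" and z: "\<And>z. z \<in> elts S f \<Longrightarrow> \<exists>a b. is_opair S z a b" by (auto simp: fun_in_def)
  have R: "isR (graph S f)" using s by (intro isR_graph is_setU)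
  have "elts S f = prs (graph S f)"
    using z unfolding prs_def graph_iff is_opair_iff by blast
  then have "f = rl (graph S f)" using extens[OF s rl(1)[OF R]] rl(3)[OF R] by simp
  then show "\<exists>R. isR R \<and> f = rl R \<and> single_valued R \<and> Domain R = K \<and> Range R \<subseteq> L"
    using R f by (auto simp: fun_in_def)
next
  assume "\<exists>R. isR R \<and> f = rl R \<and> single_valued R \<and> Domain R = K \<and> Range R \<subseteq> L"
  then obtain R where R: "isR R" "f = rl R" "single_valued R" "Domain R = K" "Range R \<subseteq> L" by blast
  have "\<exists>a b. is_opair S z a b" if "z \<in> elts S f" for z
    using that R isR_U by (fastforce simp: rl prs_def is_opair_iff)
  then show "fun_in S f K L" using R rl[OF R(1)] by (simp add: fun_in_def)
qed

lemma fun_in_rl: "isR R \<Longrightarrow> single_valued R \<Longrightarrow> Domain R = K \<Longrightarrow> Range R \<subseteq> L \<Longrightarrow> fun_in S (rl R) K L"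
  by (auto simp: fun_in_iff)

lemma inj_in_iff: "(\<exists>f\<in>Univ S. inj_in S f K L) \<longleftrightarrow>
   (\<exists>R. isR R \<and> single_valued R \<and> single_valued (R\<inverse>) \<and> Domain R = K \<and> Range R \<subseteq> L)"
  by (auto simp: inj_in_def fun_in_iff rl intro: bexI[OF _ rl(2)])

lemma countable_in_iff: "countable_in S K \<longleftrightarrow>
   (\<exists>R. isR R \<and> single_valued R \<and> single_valued (R\<inverse>) \<and> Domain R = K \<and> Range R \<subseteq> nats S)"
  by (simp add: countable_in_def inj_in_iff)

lemma finite_in_iff: "finite_in S K \<longleftrightarrow>
   (\<exists>n\<in>nats S. \<exists>R. isR R \<and> single_valued R \<and> single_valued (R\<inverse>) \<and> Domain R = K \<and> Range R \<subseteq> elts S n)"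
  by (simp add: finite_in_def inj_in_iff)

lemma countable_isC: "countable_in S K \<Longrightarrow> isC K"
  using isC_field by (auto simp: countable_in_iff)

lemma countable_inj:
  assumes "countable_in S L" "isR R" "single_valued R" "single_valued (R\<inverse>)" "Domain R = K" "Range R \<subseteq> L"
  shows "countable_in S K"
proof -
  obtain Q where Q: "isR Q" "single_valued Q" "single_valued (Q\<inverse>)" "Domain Q = L" "Range Q \<subseteq> nats S"
    using assms(1) by (auto simp: countable_in_iff)
  have D: "Domain (R O Q) = K" "Range (R O Q) \<subseteq> nats S" using assms(5,6) Q(4,5) by blast+
  show ?thesis unfolding countable_in_iff
    by (intro exI[of _ "R O Q"] conjI isR_comp assms Q single_valued_relcomp D)
      (unfold converse_relcomp, intro single_valued_relcomp assms Q)
qed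

lemma finite_inj:
  assumes "finite_in S L" "isR R" "single_valued R" "single_valued (R\<inverse>)" "Domain R = K" "Range R \<subseteq> L"
  shows "finite_in S K"
proof -
  obtain n Q where Q: "n \<in> nats S" "isR Q" "single_valued Q" "single_valued (Q\<inverse>)" "Domain Q = L" "Range Q \<subseteq> elts S n"
    using assms(1) by (auto simp: finite_in_iff)
  have D: "Domain (R O Q) = K" "Range (R O Q) \<subseteq> elts S n" using assms(5,6) Q(5,6) by blast+
  show ?thesis unfolding finite_in_iff
    by (intro bexI[OF _ Q(1)] exI[of _ "R O Q"] conjI isR_comp assms Q single_valued_relcomp D)
      (unfold converse_relcomp, intro single_valued_relcomp assms Q)
qed

lemma sv_Id_on: "single_valued (Id_on A)" "single_valued ((Id_on A)\<inverse>)"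
  by (auto simp: single_valued_def)

lemma countable_subset: "countable_in S L \<Longrightarrow> isC K \<Longrightarrow> K \<subseteq> L \<Longrightarrow> countable_in S K"
  by (rule countable_inj[OF _ isR_Id_on sv_Id_on]) auto

lemma finite_subset: "finite_in S L \<Longrightarrow> isC K \<Longrightarrow> K \<subseteq> L \<Longrightarrow> finite_in S K"
  by (rule finite_inj[OF _ isR_Id_on sv_Id_on]) auto

end

text \<open>Substitution of terms for variables: the formula is applied to fresh variables that are
  required to equal the terms.\<close>

lemma dfb_subst2:
  assumes "dfb S X (\<lambda>e. Q (e 0) (e 1))" "tm S X t" "tm S X u" "X \<subseteq> Univ S" "Atoms S \<in> Univ S"
  shows "dfb S X (\<lambda>e. Q (t e) (u e))"
proof -
  have d: "dfb S X (\<lambda>e. Q (e 1) (e 0))"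
    using dfb_reindex[OF assms(1), of "\<lambda>i. if i = 0 then 1 else 0"] by simp
  have "dfb S X (\<lambda>e. \<exists>x\<in>Univ S. x = t e \<and> (\<exists>y\<in>Univ S. y = u e \<and> Q x y))"
    by (intro dfb_base tm_intros assms) (use d in simp)
  then show ?thesis by (rule dfb_cong) (use tm_Univ[OF assms(2,4,5)] tm_Univ[OF assms(3,4,5)] in auto)
qed

context zermelo
begin

lemmas substU2 = dfb_subst2[OF _ _ _ subset_refl AtomsU]

section \<open>Zero and successor\<close>

definition emp :: 'a where "emp = mk {}"

definition suc :: "'a \<Rightarrow> 'a" where "suc x = mk (insert x (elts S x))"

lemma is_zero_iff: "is_zero S z \<longleftrightarrow> z = emp"
  using mk[OF isC_empty] mk_eqI[of z "{}"] by (auto simp: is_zero_def emp_def)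

lemma emp: "emp \<in> Univ S" "is_set S emp" "elts S emp = {}"
  using mk[OF isC_empty] by (auto simp: emp_def)

lemma suc: assumes "x \<in> Univ S" shows "suc x \<in> Univ S" "is_set S (suc x)" "elts S (suc x) = insert x (elts S x)"
  using mk[OF isC_insert[OF assms isC_elts[OF assms]]] by (auto simp: suc_def)

lemma is_succ_iff: "is_succ S y x \<longleftrightarrow> x \<in> Univ S \<and> y = suc x"
  using suc[of x] mk_eqI[of y "insert x (elts S x)"] eltsU[of x y]
  by (auto simp: is_succ_def suc_def)

lemma inductive_in_iff: "inductive_in S w \<longleftrightarrow> is_set S w \<and> emp \<in> elts S w \<and> (\<forall>x\<in>elts S w. suc x \<in> elts S w)"
  by (auto simp: inductive_in_def is_zero_iff is_succ_iff dest: eltsU)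

lemma emp_nats: "emp \<in> nats S"
  by (auto simp: nats_def emp inductive_in_iff)

lemma suc_nats: "n \<in> nats S \<Longrightarrow> suc n \<in> nats S"
  by (auto simp: nats_def suc inductive_in_iff)

lemma suc_not_emp: "x \<in> Univ S \<Longrightarrow> suc x \<noteq> emp"
  using suc(3) emp(3) by fastforce

end

section \<open>Recursion in models of ZFA\<close>

text \<open>Interpreted by \<open>V\<close> only. Replacement makes recursion possible by collecting
  the values of partial runs into a set.\<close>

locale zfa = zermelo +
  assumes infinity: "\<exists>w. inductive_in S w"
    and regularity: "is_set S x \<Longrightarrow> elts S x \<noteq> {} \<Longrightarrow> \<exists>y\<in>elts S x. elts S y \<inter> elts S x = {}"
    and replacement: "dfb S (Univ S) (\<lambda>e. Q (e 0) (e 1)) \<Longrightarrow> is_set S x \<Longrightarrow>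
       (\<And>y z z'. y \<in> elts S x \<Longrightarrow> z \<in> Univ S \<Longrightarrow> z' \<in> Univ S \<Longrightarrow> Q y z \<Longrightarrow> Q y z' \<Longrightarrow> z = z') \<Longrightarrow>
       \<exists>u. is_set S u \<and> elts S u = {z \<in> Univ S. \<exists>y\<in>elts S x. Q y z}"
begin

lemma isC_repl:
  assumes "dfb S (Univ S) (\<lambda>e. Q (e 0) (e 1))" "isC K"
    "\<And>y z z'. y \<in> K \<Longrightarrow> z \<in> Univ S \<Longrightarrow> z' \<in> Univ S \<Longrightarrow> Q y z \<Longrightarrow> Q y z' \<Longrightarrow> z = z'"
  shows "isC {z \<in> Univ S. \<exists>y\<in>K. Q y z}"
  using replacement[OF assms(1) mk(1)[OF assms(2)]] assms(3) by (simp add: mk(2)[OF assms(2)] isC_def)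

lemma isC_nats: "isC (nats S)"
proof -
  obtain w where w: "inductive_in S w" using infinity by blast
  then have "nats S \<subseteq> elts S w" "w \<in> Univ S" by (auto simp: nats_def inductive_in_def is_set_def)
  then show ?thesis by (intro isC_subset[OF isC_elts] dfbs) 
qed

text \<open>\<open>nats S\<close> is the intersection of all inductive sets of \<open>S\<close>.
  Induction therefore requires the numbers satisfying \<open>Q\<close> to form a set, and
  definability of \<open>Q\<close> ensures this.\<close>

lemma nat_induct_in:
  assumes d: "dfb S (Univ S) (\<lambda>e. Q (e 0))" and "Q emp"
    and s: "\<And>n. n \<in> nats S \<Longrightarrow> Q n \<Longrightarrow> Q (suc n)" and n: "n \<in> nats S"
  shows "Q n"
proof -
  have K: "isC {n \<in> nats S. Q n}" by (intro isC_sep isC_nats d)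
  have "inductive_in S (mk {n \<in> nats S. Q n})"
    unfolding inductive_in_iff mk(2)[OF K] using mk(1)[OF K] assms emp_nats suc_nats by auto
  then have "n \<in> elts S (mk {n \<in> nats S. Q n})"
    using n mk(3)[OF K] by (auto simp: nats_def)
  then show ?thesis unfolding mk(2)[OF K] by simp
qed

text \<open>Regularity for \<open>{x, y}\<close>; the case \<open>x = y\<close> shows that no
  element belongs to itself.\<close>

lemma not_mem_cycle: "x \<in> Univ S \<Longrightarrow> y \<in> Univ S \<Longrightarrow> x \<in> elts S y \<Longrightarrow> y \<in> elts S x \<Longrightarrow> False"
  using regularity[OF mk(1)[OF isC_upair], of x y] by (auto simp: mk(2)[OF isC_upair])

lemma suc_inject: "x \<in> Univ S \<Longrightarrow> y \<in> Univ S \<Longrightarrow> suc x = suc y \<longleftrightarrow> x = y"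
  using not_mem_cycle[of x y] suc(3) by (metis insertE insertI1)

lemma nats_elts: "n \<in> nats S \<Longrightarrow> m \<in> elts S n \<Longrightarrow> m \<in> nats S"
proof -
  assume n: "n \<in> nats S" and m: "m \<in> elts S n"
  have "\<forall>m\<in>elts S n. m \<in> nats S"
    by (rule nat_induct_in[OF _ _ _ n], intro dfbs) (auto simp: emp suc natsU)
  then show ?thesis using m by blast
qed

lemma nats_suc_le: "n \<in> nats S \<Longrightarrow> m \<in> elts S n \<Longrightarrow> suc m = n \<or> suc m \<in> elts S n"
proof -
  assume n: "n \<in> nats S" and m: "m \<in> elts S n"
  have "\<forall>m\<in>elts S n. suc m = n \<or> suc m \<in> elts S n"
  proof (rule nat_induct_in[OF _ _ _ n])
    show "dfb S (Univ S) (\<lambda>e. \<forall>m\<in>elts S (e 0). suc m = e 0 \<or> suc m \<in> elts S (e 0))"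
      by (rule dfb_cong[where Q="\<lambda>e. \<forall>m\<in>elts S (e 0). \<exists>k\<in>Univ S. is_succ S k m \<and> (k = e 0 \<or> k \<in> elts S (e 0))"],
        intro dfbs) (use suc eltsU in \<open>unfold is_succ_iff, blast\<close>)
  qed (auto simp: emp suc natsU)
  then show ?thesis using m by blast
qed

lemma nats_linear: "n \<in> nats S \<Longrightarrow> m \<in> nats S \<Longrightarrow> m \<in> elts S n \<or> m = n \<or> n \<in> elts S m"
proof -
  assume n: "n \<in> nats S" and m: "m \<in> nats S"
  have e: "m \<noteq> emp \<longrightarrow> emp \<in> elts S m" if "m \<in> nats S" for m
    by (rule nat_induct_in[OF _ _ _ that], intro dfbs emp) (auto simp: suc natsU)
  have "\<forall>m\<in>Univ S. m \<in> nats S \<longrightarrow> m \<in> elts S n \<or> m = n \<or> n \<in> elts S m"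
  proof (rule nat_induct_in[OF _ _ _ n])
    show "\<forall>m\<in>Univ S. m \<in> nats S \<longrightarrow> m \<in> elts S emp \<or> m = emp \<or> emp \<in> elts S m" using e by blast
    fix n assume n: "n \<in> nats S" "\<forall>m\<in>Univ S. m \<in> nats S \<longrightarrow> m \<in> elts S n \<or> m = n \<or> n \<in> elts S m"
    then show "\<forall>m\<in>Univ S. m \<in> nats S \<longrightarrow> m \<in> elts S (suc n) \<or> m = suc n \<or> suc n \<in> elts S m"
      using nats_suc_le suc(3)[OF natsU[OF n(1)]] by blast
  qed (intro dfbs)
  then show ?thesis using m natsU by blast
qed

text \<open>\<open>H\<close> is a function outside \<open>S\<close> with definable graph. By
  induction every number has exactly one value in partial runs, and replacement gathers these
  values.\<close>

lemma nat_recursion: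
  assumes H: "\<And>x. x \<in> Univ S \<Longrightarrow> H x \<in> Univ S" and z: "z \<in> Univ S"
    and dH: "dfb S (Univ S) (\<lambda>e. e 0 = H (e 1))"
  obtains R where "isR R" "single_valued R" "Domain R = nats S" "(emp, z) \<in> R"
    "\<And>n y. (n, y) \<in> R \<Longrightarrow> (suc n, H y) \<in> R"
proof -
  define HR where "HR v u \<longleftrightarrow> v = H u" for v u
  \<comment> \<open>Entries are justified backwards only, so a run remains one when a successor
    entry is added. \<open>HR\<close> hides the equation \<open>v = H u\<close>, whose right-hand
    side is not a term.\<close>
  define run where "run h \<longleftrightarrow> (\<forall>(u, v)\<in>graph S h. (u = emp \<and> v = z) \<or>
    (\<exists>u'\<in>Univ S. \<exists>v'\<in>Univ S. (u', v') \<in> graph S h \<and> is_succ S u u' \<and> HR v v'))" for h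
  define A where "A n y \<longleftrightarrow> (\<exists>h\<in>Univ S. (n, y) \<in> graph S h \<and> run h)" for n y
  have dH': "dfb S (Univ S) (\<lambda>e. HR (t e) (u e))" if "tm S (Univ S) t" "tm S (Univ S) u" for t u
    unfolding HR_def by (rule substU2[OF dH that])
  have dA: "dfb S (Univ S) (\<lambda>e. A (t e) (u e))" if "tm S (Univ S) t" "tm S (Univ S) u" for t u
    unfolding A_def run_def
    by (intro dH' dfbs that emp z dfb_ball_graph[OF subset_refl])
  have A0: "A emp z"
  proof -
    have R: "isR {(emp, z)}" using isR_prod[OF isC_sing isC_sing, OF emp(1) z] by simp
    show ?thesis unfolding A_def run_def
      by (rule bexI[OF _ rl(2)[OF R]]) (simp add: rl[OF R])
  qed
  have AU: "n \<in> Univ S \<and> y \<in> Univ S" if "A n y" for n y using that graphU by (auto simp: A_def)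
  have AS: "A (suc n) (H y)" if "A n y" for n y
  proof -
    obtain h where h: "h \<in> Univ S" "(n, y) \<in> graph S h" "run h" using \<open>A n y\<close> by (auto simp: A_def)
    have U: "n \<in> Univ S" "y \<in> Univ S" using AU that by auto
    let ?R = "insert (suc n, H y) (graph S h)"
    have "isR (graph S h \<union> {suc n} \<times> {H y})" by (intro isR_Un isR_prod isR_graph isC_sing suc H U h)
    then have R: "isR ?R" by simp
    show ?thesis unfolding A_def run_def
      by (rule bexI[OF _ rl(2)[OF R]]) (use h U in \<open>auto simp: rl[OF R] run_def HR_def is_succ_iff\<close>)
  qed
  have AE: "(n = emp \<and> y = z) \<or> (\<exists>n' y'. A n' y' \<and> n = suc n' \<and> y = H y')" if "A n y" for n y
  proof -
    obtain h where h: "h \<in> Univ S" "(n, y) \<in> graph S h" "run h" using \<open>A n y\<close> by (auto simp: A_def)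
    then have "(n = emp \<and> y = z) \<or> (\<exists>n'\<in>Univ S. \<exists>y'\<in>Univ S. (n', y') \<in> graph S h \<and> n = suc n' \<and> y = H y')"
      unfolding run_def HR_def is_succ_iff by blast
    then show ?thesis using h unfolding A_def by blast
  qed
  have ex: "\<exists>y\<in>Univ S. A n y" if "n \<in> nats S" for n
    by (rule nat_induct_in[OF _ _ _ that], intro dfbs dA) (use A0 AS AU z in blast)+
  have uniq: "\<forall>y\<in>Univ S. \<forall>y'\<in>Univ S. A n y \<longrightarrow> A n y' \<longrightarrow> y = y'" if "n \<in> nats S" for n
  proof (rule nat_induct_in[OF _ _ _ that])
    show "\<forall>y\<in>Univ S. \<forall>y'\<in>Univ S. A emp y \<longrightarrow> A emp y' \<longrightarrow> y = y'"
      using AE AU suc_not_emp by metis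
    fix n assume n: "n \<in> nats S" "\<forall>y\<in>Univ S. \<forall>y'\<in>Univ S. A n y \<longrightarrow> A n y' \<longrightarrow> y = y'"
    show "\<forall>y\<in>Univ S. \<forall>y'\<in>Univ S. A (suc n) y \<longrightarrow> A (suc n) y' \<longrightarrow> y = y'"
    proof (intro ballI impI)
      fix y y' assume *: "A (suc n) y" "A (suc n) y'"
      have "\<exists>x. A n x \<and> y = H x" if "A (suc n) y" for y
        using AE[OF that] suc_not_emp suc_inject natsU[OF n(1)] AU by metis
      then obtain x x' where "A n x" "y = H x" "A n x'" "y' = H x'" using * by metis
      then show "y = y'" using n(2) AU by blast
    qed
  qed (intro dfbs dA)
  let ?B = "{y \<in> Univ S. \<exists>n\<in>nats S. A n y}"
  have B: "isC ?B" by (rule isC_repl[OF _ isC_nats]) (use uniq in \<open>auto intro!: dA dfbs\<close>)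
  let ?R = "{(n, y). n \<in> nats S \<and> A n y}"
  have R: "isR ?R"
    by (rule isR_dfb[OF isC_nats B]) (use AU in \<open>auto intro!: dfbs dA\<close>)
  show thesis
  proof (rule that[OF R])
    show "single_valued ?R" using uniq AU by (auto simp: single_valued_def)
    show "Domain ?R = nats S" using ex by auto
  qed (use A0 AS emp_nats suc_nats in auto)
qed

text \<open>The union is iterated from \<open>{x}\<close>; \<open>nat_recursion\<close> delivers the
  sequence of stages as a set, so they can be united.\<close>

lemma ex_transitive:
  assumes x: "x \<in> Univ S"
  obtains K where "isC K" "x \<in> K" "\<And>y. y \<in> K \<Longrightarrow> elts S y \<subseteq> K"
proof -
  define H where "H u = mk (\<Union>y\<in>elts S u. elts S y)" for u
  have i: "isC (\<Union>y\<in>elts S u. elts S y)" if "u \<in> Univ S" for u by (intro isC_UN_elts isC_elts that)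
  have dH: "dfb S (Univ S) (\<lambda>e. e 0 = H (e 1))"
  proof (rule dfb_cong[where Q="\<lambda>e. is_set S (e 0) \<and> (\<forall>x\<in>Univ S. x \<in> elts S (e 0) \<longleftrightarrow> (\<exists>y\<in>elts S (e 1). x \<in> elts S y))"], intro dfbs)
    fix e :: "nat \<Rightarrow> 'a" assume e: "range e \<subseteq> Univ S"
    then have "e 1 \<in> Univ S" by auto
    note m = mk[OF i[OF this]]
    show "(e 0 = H (e 1)) = (is_set S (e 0) \<and> (\<forall>x\<in>Univ S. x \<in> elts S (e 0) \<longleftrightarrow> (\<exists>y\<in>elts S (e 1). x \<in> elts S y)))"
    proof -
      have "e 0 = H (e 1) \<longleftrightarrow> is_set S (e 0) \<and> elts S (e 0) = (\<Union>y\<in>elts S (e 1). elts S y)"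
        using m(1,2) mk_eqI unfolding H_def by metis
      moreover have "elts S (e 0) = (\<Union>y\<in>elts S (e 1). elts S y) \<longleftrightarrow>
         (\<forall>x\<in>Univ S. x \<in> elts S (e 0) \<longleftrightarrow> (\<exists>y\<in>elts S (e 1). x \<in> elts S y))"
        by (auto simp: set_eq_iff dest: eltsU)
      ultimately show ?thesis by simp
    qed
  qed
  obtain R where R: "isR R" "single_valued R" "Domain R = nats S" "(emp, mk {x}) \<in> R"
    "\<And>n y. (n, y) \<in> R \<Longrightarrow> (suc n, H y) \<in> R"
    using nat_recursion[OF _ mk(3)[OF isC_sing[OF x]] dH] mk(3)[OF i] H_def by metis
  show thesis
  proof (rule that[of "\<Union>u\<in>Range R. elts S u"])
    show "isC (\<Union>u\<in>Range R. elts S u)" by (intro isC_UN_elts isC_field R)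
    show "x \<in> (\<Union>u\<in>Range R. elts S u)" using R(4) mk(2)[OF isC_sing[OF x]] by blast
    fix y assume "y \<in> (\<Union>u\<in>Range R. elts S u)"
    then obtain n u where "(n, u) \<in> R" "y \<in> elts S u" by auto
    then have "(suc n, H u) \<in> R" "elts S y \<subseteq> elts S (H u)" "u \<in> Univ S"
      using R(5) isR_U[OF R(1)] mk(2)[OF i] unfolding H_def by blast+
    then show "elts S y \<subseteq> (\<Union>u\<in>Range R. elts S u)" by blast
  qed
qed

text \<open>Regularity of a nonstandard model gives induction for definable properties only.\<close>

lemma mem_induct:
  assumes d: "dfb S (Univ S) (\<lambda>e. Q (e 0))"
    and s: "\<And>x. x \<in> Univ S \<Longrightarrow> (\<And>y. y \<in> elts S x \<Longrightarrow> Q y) \<Longrightarrow> Q x" and x: "x \<in> Univ S"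
  shows "Q x"
proof (rule ccontr)
  assume n: "\<not> Q x"
  obtain K where K: "isC K" "x \<in> K" "\<And>y. y \<in> K \<Longrightarrow> elts S y \<subseteq> K" by (rule ex_transitive[OF x]) blast
  have L: "isC {y \<in> K. \<not> Q y}" by (intro isC_sep K dfb_not d)
  obtain y where y: "y \<in> K" "\<not> Q y" "elts S y \<inter> {y \<in> K. \<not> Q y} = {}"
    using regularity[OF mk(1)[OF L]] n K(2) unfolding mk(2)[OF L] by blast
  have "y \<in> Univ S" using y(1) isC_sub_Univ[OF K(1)] by blast
  then show False using s[of y] y K(3)[OF y(1)] by blast
qed

end

section \<open>The action of permutations\<close>

text \<open>The schemes of \<open>ZFA\<close> speak of formulas, the locale of definable predicates.
  What has to be done is to move the interleaved parameters behind the variables of the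
  scheme.\<close>

lemma ZFA_imp_zfa:
  assumes "ZFA V"
  shows "zfa V"
proof -
  have AU: "Atoms V \<in> Univ V" using assms unfolding ZFA_def by (elim conjE)
  have Z1: "\<forall>a. atom V a \<longrightarrow> elts V a = {}" using assms unfolding ZFA_def by (elim conjE)
  have Z2: "\<exists>z. is_zero V z" using assms unfolding ZFA_def by (elim conjE)
  have Z3: "\<forall>x y. is_set V x \<longrightarrow> is_set V y \<longrightarrow> elts V x = elts V y \<longrightarrow> x = y" using assms unfolding ZFA_def by (elim conjE)
  have Z4: "\<forall>x\<in>Univ V. \<forall>y\<in>Univ V. \<exists>z. is_upair V z x y" using assms unfolding ZFA_def by (elim conjE)
  have Z5: "\<forall>x. is_set V x \<longrightarrow> (\<exists>u. is_set V u \<and> elts V u = (\<Union>y\<in>elts V x. elts V y))" using assms unfolding ZFA_def by (elim conjE)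
  have Z6: "\<forall>x. is_set V x \<longrightarrow> (\<exists>u. is_set V u \<and> elts V u = {y. is_set V y \<and> elts V y \<subseteq> elts V x})" using assms unfolding ZFA_def by (elim conjE)
  have Z7: "\<exists>w. inductive_in V w" using assms unfolding ZFA_def by (elim conjE)
  have Z8: "\<forall>x. is_set V x \<longrightarrow> elts V x \<noteq> {} \<longrightarrow> (\<exists>y\<in>elts V x. elts V y \<inter> elts V x = {})" using assms unfolding ZFA_def by (elim conjE)
  have sep: "\<forall>\<phi> e x. range e \<subseteq> Univ V \<longrightarrow> is_set V x \<longrightarrow>
        (\<exists>u. is_set V u \<and> elts V u = {y \<in> elts V x. sat V (case_nat y e) \<phi>})"
    using assms unfolding ZFA_def by (elim conjE)
  have rep: "\<forall>\<phi> e x. range e \<subseteq> Univ V \<longrightarrow> is_set V x \<longrightarrow>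
        (\<forall>y\<in>elts V x. \<forall>z\<in>Univ V. \<forall>z'\<in>Univ V.
           sat V (case_nat y (case_nat z e)) \<phi> \<longrightarrow> sat V (case_nat y (case_nat z' e)) \<phi> \<longrightarrow> z = z') \<longrightarrow>
        (\<exists>u. is_set V u \<and>
           elts V u = {z \<in> Univ V. \<exists>y\<in>elts V x. sat V (case_nat y (case_nat z e)) \<phi>})"
    using assms unfolding ZFA_def by (elim conjE)
  show ?thesis
  proof (unfold_locales; (intro AU Z1[rule_format] Z2 Z3[rule_format] Z4[rule_format] Z5[rule_format]
      Z6[rule_format] Z7 Z8[rule_format]; assumption)?)
    fix Q :: "'a \<Rightarrow> bool" and x
    assume "dfb V (Univ V) (\<lambda>e. Q (e 0))" and x: "is_set V x"
    then obtain \<phi> c where c: "range c \<subseteq> insert (Atoms V) (Univ V)"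
      "\<And>e. range e \<subseteq> Univ V \<Longrightarrow> Q (e 0) = sat V (mix e c) \<phi>" by (auto simp: dfb_def)
    \<comment> \<open>\<open>Q\<close> inspects variable 0 only, so all variables may hold
      \<open>y\<close>. Parameter \<open>j\<close>, at position \<open>2 * j + 1\<close> of the
      interleaved sequence, sits at \<open>Suc j\<close> in \<open>case_nat y c\<close>.\<close>
    define f :: "nat \<Rightarrow> nat" where "f i = (if even i then 0 else Suc (i div 2))" for i
    have m: "mix (\<lambda>_. y) c = (\<lambda>i. case_nat y c (f i))" for y
      by (auto simp: mix_def f_def fun_eq_iff)
    have "Q y = sat V (case_nat y c) (ren f \<phi>)" if "y \<in> elts V x" for y
      using c(2)[of "\<lambda>_. y"] that by (simp add: sat_ren m elts_def image_subset_iff)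
    moreover obtain u where "is_set V u" "elts V u = {y \<in> elts V x. sat V (case_nat y c) (ren f \<phi>)}"
      using sep[rule_format, of c x "ren f \<phi>"] c(1) x AU by (auto simp: insert_absorb)
    ultimately show "\<exists>u. is_set V u \<and> elts V u = {y \<in> elts V x. Q y}" by (intro exI[of _ u]) auto
  next
    fix Q :: "'a \<Rightarrow> 'a \<Rightarrow> bool" and x
    assume "dfb V (Univ V) (\<lambda>e. Q (e 0) (e 1))" and x: "is_set V x"
      and fn: "\<And>y z z'. y \<in> elts V x \<Longrightarrow> z \<in> Univ V \<Longrightarrow> z' \<in> Univ V \<Longrightarrow> Q y z \<Longrightarrow> Q y z' \<Longrightarrow> z = z'"
    then obtain \<phi> c where c: "range c \<subseteq> insert (Atoms V) (Univ V)"
      "\<And>e. range e \<subseteq> Univ V \<Longrightarrow> Q (e 0) (e 1) = sat V (mix e c) \<phi>" by (auto simp: dfb_def)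
    have c1: "range c \<subseteq> Univ V" using c(1) AU by (simp add: insert_absorb)
    \<comment> \<open>As for separation, now with two variables: position 0 holds \<open>y\<close>,
      every other even position holds \<open>z\<close>, and the parameters start at 2.\<close>
    define f :: "nat \<Rightarrow> nat" where "f i = (if i = 0 then 0 else if even i then 1 else i div 2 + 2)" for i
    define E where "E y z i = (if i = 0 then y else z)" for y z :: 'a and i :: nat
    have m: "mix (E y z) c = (\<lambda>i. case_nat y (case_nat z c) (f i))" for y z
      by (auto simp: mix_def f_def E_def fun_eq_iff)
    have Q: "Q y z = sat V (case_nat y (case_nat z c)) (ren f \<phi>)" if "y \<in> elts V x" "z \<in> Univ V" for y z
    proof -
      have "range (E y z) \<subseteq> Univ V" using that by (auto simp: E_def elts_def)
      from c(2)[OF this] show ?thesis by (simp add: sat_ren m E_def)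
    qed
    have "\<exists>u. is_set V u \<and> elts V u = {z \<in> Univ V. \<exists>y\<in>elts V x. sat V (case_nat y (case_nat z c)) (ren f \<phi>)}"
      by (rule rep[rule_format, OF c1 x]) (use Q fn in blast)
    then obtain u where "is_set V u" "elts V u = {z \<in> Univ V. \<exists>y\<in>elts V x. sat V (case_nat y (case_nat z c)) (ren f \<phi>)}"
      by blast
    then show "\<exists>u. is_set V u \<and> elts V u = {z \<in> Univ V. \<exists>y\<in>elts V x. Q y z}"
      using Q by (intro exI[of _ u]) auto
  qed
qed

context zfa
begin

abbreviation Ats where "Ats \<equiv> elts S (Atoms S)"

lemma Perms_props:
  assumes "\<pi> \<in> Perms S"
  shows "\<pi> \<in> Univ S" "single_valued (graph S \<pi>)" "single_valued ((graph S \<pi>)\<inverse>)" "Domain (graph S \<pi>) = Ats"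
    "Range (graph S \<pi>) = Ats" "isR (graph S \<pi>)"
  using assms by (auto simp: Perms_def inj_in_def fun_in_def isR_graph)

lemma rl_Perms:
  "isR R \<Longrightarrow> single_valued R \<Longrightarrow> single_valued (R\<inverse>) \<Longrightarrow> Domain R = Ats \<Longrightarrow> Range R = Ats \<Longrightarrow> rl R \<in> Perms S"
  by (simp add: Perms_def inj_in_def rl fun_in_rl)

lemma acts_U: "acts S \<pi> x y \<Longrightarrow> x \<in> Univ S \<and> y \<in> Univ S"
  unfolding acts_def using graphU by blast

text \<open>Every entry of a run is justified by the same run, so \<open>acts\<close> descends from
  \<open>x\<close> to the elements of \<open>x\<close>.\<close>

lemma acts_unfold:
  assumes "acts S \<pi> x y"
  shows "atom S x \<Longrightarrow> (x, y) \<in> graph S \<pi>"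
    "\<not> atom S x \<Longrightarrow> is_set S y"
    "\<not> atom S x \<Longrightarrow> t \<in> elts S x \<Longrightarrow> \<exists>w\<in>elts S y. acts S \<pi> t w"
    "\<not> atom S x \<Longrightarrow> w \<in> elts S y \<Longrightarrow> \<exists>t\<in>elts S x. acts S \<pi> t w"
proof -
  obtain h where h: "h \<in> Univ S" "(x, y) \<in> graph S h"
    and r: "\<forall>(u, v) \<in> graph S h. if atom S u then (u, v) \<in> graph S \<pi>
           else is_set S v \<and> elts S u \<subseteq> Domain (graph S h) \<and> elts S v = graph S h `` elts S u"
    using assms unfolding acts_def by blast
  have a: "acts S \<pi> u v" if "(u, v) \<in> graph S h" for u v
    unfolding acts_def using h(1) that r by blast
  have rx: "if atom S x then (x, y) \<in> graph S \<pi>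
           else is_set S y \<and> elts S x \<subseteq> Domain (graph S h) \<and> elts S y = graph S h `` elts S x"
    using r h(2) by blast
  show "atom S x \<Longrightarrow> (x, y) \<in> graph S \<pi>" "\<not> atom S x \<Longrightarrow> is_set S y" using rx by auto
  show "\<not> atom S x \<Longrightarrow> t \<in> elts S x \<Longrightarrow> \<exists>w\<in>elts S y. acts S \<pi> t w" using rx a by (auto simp: Image_iff) blast
  show "\<not> atom S x \<Longrightarrow> w \<in> elts S y \<Longrightarrow> \<exists>t\<in>elts S x. acts S \<pi> t w" using rx a by auto
qed

lemma acts_isR:
  assumes "isR R" "(x, y) \<in> R"
    and "\<And>u v. (u, v) \<in> R \<Longrightarrow> if atom S u then (u, v) \<in> graph S \<pi>
           else is_set S v \<and> elts S u \<subseteq> Domain R \<and> elts S v = R `` elts S u"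
  shows "acts S \<pi> x y"
  unfolding acts_def by (rule bexI[OF _ rl(2)[OF assms(1)]], unfold rl(4)[OF assms(1)]) (use assms(2,3) in blast)

lemma acts_unique:
  assumes p: "\<pi> \<in> Perms S" and "acts S \<pi> x y" "acts S \<pi> x y'"
  shows "y = y'"
proof -
  have x: "x \<in> Univ S" and y: "y \<in> Univ S" "y' \<in> Univ S" using assms acts_U by auto
  have "\<forall>y\<in>Univ S. \<forall>y'\<in>Univ S. acts S \<pi> x y \<longrightarrow> acts S \<pi> x y' \<longrightarrow> y = y'"
  proof (rule mem_induct[OF _ _ x])
    show "dfb S (Univ S) (\<lambda>e. \<forall>y\<in>Univ S. \<forall>y'\<in>Univ S. acts S \<pi> (e 0) y \<longrightarrow> acts S \<pi> (e 0) y' \<longrightarrow> y = y')"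
      by (intro dfbs Perms_props p)
  next
    fix x assume x: "x \<in> Univ S"
      and IH: "\<And>t. t \<in> elts S x \<Longrightarrow> \<forall>y\<in>Univ S. \<forall>y'\<in>Univ S. acts S \<pi> t y \<longrightarrow> acts S \<pi> t y' \<longrightarrow> y = y'"
    show "\<forall>y\<in>Univ S. \<forall>y'\<in>Univ S. acts S \<pi> x y \<longrightarrow> acts S \<pi> x y' \<longrightarrow> y = y'"
    proof (intro ballI impI)
      fix y y' assume *: "acts S \<pi> x y" "acts S \<pi> x y'"
      show "y = y'"
      proof (cases "atom S x")
        case True
        then show ?thesis using acts_unfold(1)[OF *(1)] acts_unfold(1)[OF *(2)] Perms_props(2)[OF p]
          by (auto simp: single_valued_def)
      next
        case False
        have 1: "elts S y \<subseteq> elts S y'" if *: "acts S \<pi> x y" "acts S \<pi> x y'" for y y'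
        proof
          fix w assume "w \<in> elts S y"
          then obtain t where t: "t \<in> elts S x" "acts S \<pi> t w" using acts_unfold(4)[OF *(1) False] by blast
          obtain w' where "w' \<in> elts S y'" "acts S \<pi> t w'" using acts_unfold(3)[OF *(2) False t(1)] by blast
          then show "w \<in> elts S y'" using IH[OF t(1)] t(2) acts_U by metis
        qed
        show ?thesis
          by (rule extens[OF acts_unfold(2)[OF *(1) False] acts_unfold(2)[OF *(2) False]])
            (use 1 * in blast)
      qed
    qed
  qed
  then show ?thesis using y assms by blast
qed

lemma acts_ex:
  assumes p: "\<pi> \<in> Perms S" and x: "x \<in> Univ S"
  shows "\<exists>y\<in>Univ S. acts S \<pi> x y"
proof (rule mem_induct[OF _ _ x])
  show "dfb S (Univ S) (\<lambda>e. \<exists>y\<in>Univ S. acts S \<pi> (e 0) y)"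
    by (intro dfbs Perms_props p)
next
  fix x assume x: "x \<in> Univ S" and IH: "\<And>t. t \<in> elts S x \<Longrightarrow> \<exists>y\<in>Univ S. acts S \<pi> t y"
  show "\<exists>y\<in>Univ S. acts S \<pi> x y"
  proof (rule ccontr)
    \<comment> \<open>This assumption has a second use: as \<open>x\<close> has no image, it belongs
      to no \<open>u\<close> that has one. Hence adding the entry for \<open>x\<close> to the run on
      \<open>K\<close> leaves the other entries justified.\<close>
    assume no: "\<not> (\<exists>y\<in>Univ S. acts S \<pi> x y)"
    show False
    proof (cases "atom S x")
      case True
      then obtain y where y: "(x, y) \<in> graph S \<pi>" using Perms_props(4)[OF p] by (auto simp: atom_def)
      have yU: "y \<in> Univ S" using y graphU by blast
      have R: "isR {(x, y)}" using isR_prod[OF isC_sing isC_sing, OF x yU] by simp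
      have "acts S \<pi> x y" unfolding acts_def
        by (rule bexI[OF _ rl(2)[OF R]]) (simp add: rl[OF R] True y)
      then show False using no yU by blast
    next
      case False
      obtain K where K: "isC K" "x \<in> K" "\<And>y. y \<in> K \<Longrightarrow> elts S y \<subseteq> K" by (rule ex_transitive[OF x]) blast
      let ?B = "{w \<in> Univ S. \<exists>t\<in>K. acts S \<pi> t w}"
      have B: "isC ?B" by (rule isC_repl[OF _ K(1)], intro dfbs Perms_props(1)[OF p]) (rule acts_unique[OF p])
      let ?Y = "{w \<in> Univ S. \<exists>t\<in>elts S x. acts S \<pi> t w}"
      have Y: "isC ?Y" by (rule isC_repl[OF _ isC_elts[OF x]], intro dfbs Perms_props(1)[OF p] x) (rule acts_unique[OF p])
      let ?R = "{(u, v). u \<in> K \<and> acts S \<pi> u v}"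
      have R0: "isR ?R"
      proof (rule isR_dfb[OF K(1) B])
        show "dfb S (Univ S) (\<lambda>e. (e 0, e 1) \<in> ?R)" unfolding mem_Collect_eq case_prod_conv
          by (intro dfbs dfb_isC K(1) Perms_props(1)[OF p])
      qed (use acts_U in blast)
      have R: "isR (?R \<union> {x} \<times> {mk ?Y})" (is "isR ?R'") by (intro isR_Un R0 isR_prod isC_sing x mk Y)
      have xx: "x \<notin> elts S x" using not_mem_cycle x by blast
      have h1: "(x, mk ?Y) \<in> ?R'" by blast
      have h2: "if atom S u then (u, v) \<in> graph S \<pi>
           else is_set S v \<and> elts S u \<subseteq> Domain ?R' \<and> elts S v = ?R' `` elts S u" if uv: "(u, v) \<in> ?R'" for u v
      proof -
        have "if atom S u then (u, v) \<in> graph S \<pi>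
           else is_set S v \<and> elts S u \<subseteq> Domain ?R' \<and> elts S v = ?R' `` elts S u"
        proof (cases "(u, v) \<in> ?R")
          case True
          then have a: "acts S \<pi> u v" and uK: "u \<in> K" by auto
          show ?thesis
          proof (cases "atom S u")
            case True
            then show ?thesis using acts_unfold(1)[OF a] by simp
          next
            case nu: False
            have nx: "x \<notin> elts S u" using acts_unfold(3)[OF a nu] no acts_U by blast
            have "elts S u \<subseteq> Domain ?R'" using acts_unfold(3)[OF a nu] K(3)[OF uK] by blast
            moreover have "elts S v = ?R' `` elts S u"
            proof
              show "elts S v \<subseteq> ?R' `` elts S u" using acts_unfold(4)[OF a nu] K(3)[OF uK] by blast
              show "?R' `` elts S u \<subseteq> elts S v"
              proof
                fix w assume "w \<in> ?R' `` elts S u"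
                then obtain t where t: "t \<in> elts S u" "acts S \<pi> t w" using nx by auto
                obtain w' where "w' \<in> elts S v" "acts S \<pi> t w'" using acts_unfold(3)[OF a nu t(1)] by blast
                then show "w \<in> elts S v" using acts_unique[OF p t(2)] by blast
              qed
            qed
            ultimately show ?thesis using nu acts_unfold(2)[OF a nu] by simp
          qed
        next
          case n: False
          then have e: "u = x" "v = mk ?Y" using uv by auto
          have "elts S x \<subseteq> Domain ?R'" using IH K(2,3) by blast
          moreover have "elts S (mk ?Y) = ?R' `` elts S x"
            unfolding mk(2)[OF Y] using xx K(2,3) acts_U by blast
          ultimately show ?thesis unfolding e using False mk(1)[OF Y] by simp
        qed
        then show ?thesis .
      qed
      have "acts S \<pi> x (mk ?Y)" by (rule acts_isR[OF R h1 h2])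
      then show False using no mk(3)[OF Y] by blast
    qed
  qed
qed

definition ap :: "'a \<Rightarrow> 'a \<Rightarrow> 'a" where
  "ap \<pi> x = (THE y. acts S \<pi> x y)"

lemma acts_iff_ap: "\<pi> \<in> Perms S \<Longrightarrow> x \<in> Univ S \<Longrightarrow> acts S \<pi> x y \<longleftrightarrow> y = ap \<pi> x"
  using acts_ex acts_unique the_equality[of "acts S \<pi> x"] unfolding ap_def by metis

lemma ap_U: "\<pi> \<in> Perms S \<Longrightarrow> x \<in> Univ S \<Longrightarrow> ap \<pi> x \<in> Univ S"
  using acts_iff_ap acts_U by blast

lemma atomU: "atom S a \<Longrightarrow> a \<in> Univ S"
  using eltsU by (simp add: atom_def)

lemma ap_atom:
  assumes "\<pi> \<in> Perms S" "atom S a"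
  shows "ap \<pi> a = b \<longleftrightarrow> (a, b) \<in> graph S \<pi>" "atom S (ap \<pi> a)"
proof -
  have 1: "(a, ap \<pi> a) \<in> graph S \<pi>" using acts_iff_ap acts_unfold(1) assms atomU by blast
  then show "ap \<pi> a = b \<longleftrightarrow> (a, b) \<in> graph S \<pi>" using Perms_props(2)[OF assms(1)] by (auto simp: single_valued_def)
  show "atom S (ap \<pi> a)" using 1 Perms_props(5)[OF assms(1)] by (auto simp: atom_def)
qed

lemma ap_set:
  assumes p: "\<pi> \<in> Perms S" and x: "is_set S x"
  shows "is_set S (ap \<pi> x)" "elts S (ap \<pi> x) = ap \<pi> ` elts S x"
proof -
  have xU: "x \<in> Univ S" "\<not> atom S x" using x by (auto simp: is_set_def)
  have a: "acts S \<pi> x (ap \<pi> x)" using acts_iff_ap p xU by blast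
  show "is_set S (ap \<pi> x)" using acts_unfold(2)[OF a] xU by blast
  show "elts S (ap \<pi> x) = ap \<pi> ` elts S x"
  proof
    show "elts S (ap \<pi> x) \<subseteq> ap \<pi> ` elts S x"
      using acts_unfold(4)[OF a xU(2)] acts_iff_ap[OF p] eltsU by blast
    show "ap \<pi> ` elts S x \<subseteq> elts S (ap \<pi> x)"
    proof
      fix w assume "w \<in> ap \<pi> ` elts S x"
      then obtain t where t: "t \<in> elts S x" "w = ap \<pi> t" by blast
      obtain w' where "w' \<in> elts S (ap \<pi> x)" "acts S \<pi> t w'" using acts_unfold(3)[OF a xU(2) t(1)] by blast
      then show "w \<in> elts S (ap \<pi> x)" using acts_iff_ap[OF p eltsU[OF t(1)]] t(2) by simp
    qed
  qed
qed

lemma ap_comp: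
  assumes p: "\<pi> \<in> Perms S" "\<rho> \<in> Perms S" "\<sigma> \<in> Perms S" and g: "graph S \<sigma> = graph S \<pi> O graph S \<rho>" and x: "x \<in> Univ S"
  shows "ap \<sigma> x = ap \<rho> (ap \<pi> x)"
proof -
  \<comment> \<open>\<open>ap\<close> is a description outside the language. The induction is
    carried out for the definable \<open>acts\<close> and translated back; the same device returns
    below. Note that \<open>graph S \<pi> O graph S \<rho>\<close> applies \<open>\<pi>\<close>
    first.\<close>
  have "\<exists>y\<in>Univ S. \<exists>z\<in>Univ S. acts S \<pi> x y \<and> acts S \<rho> y z \<and> acts S \<sigma> x z"
  proof (rule mem_induct[OF _ _ x])
    show "dfb S (Univ S) (\<lambda>e. \<exists>y\<in>Univ S. \<exists>z\<in>Univ S. acts S \<pi> (e 0) y \<and> acts S \<rho> y z \<and> acts S \<sigma> (e 0) z)"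
      by (intro dfbs Perms_props p)
    fix x assume x: "x \<in> Univ S"
      and "\<And>t. t \<in> elts S x \<Longrightarrow> \<exists>y\<in>Univ S. \<exists>z\<in>Univ S. acts S \<pi> t y \<and> acts S \<rho> y z \<and> acts S \<sigma> t z"
    then have IH: "ap \<sigma> t = ap \<rho> (ap \<pi> t)" if "t \<in> elts S x" for t
      using that acts_iff_ap p eltsU by metis
    have "ap \<sigma> x = ap \<rho> (ap \<pi> x)"
    proof (cases "atom S x")
      case True
      have "(x, ap \<pi> x) \<in> graph S \<pi>" "(ap \<pi> x, ap \<rho> (ap \<pi> x)) \<in> graph S \<rho>"
        using ap_atom p True by blast+
      then show ?thesis using ap_atom(1)[OF p(3) True] g by blast
    next
      case False
      then have s: "is_set S x" using x by (simp add: is_set_def)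
      show ?thesis
        by (rule extens) (use IH in \<open>simp_all add: ap_set p s image_image\<close>)
    qed
    then show "\<exists>y\<in>Univ S. \<exists>z\<in>Univ S. acts S \<pi> x y \<and> acts S \<rho> y z \<and> acts S \<sigma> x z"
      using acts_iff_ap ap_U p x by metis
  qed
  then show ?thesis using acts_iff_ap p x by metis
qed

lemma ap_id:
  assumes p: "\<pi> \<in> Perms S" and g: "graph S \<pi> = Id_on Ats" and x: "x \<in> Univ S"
  shows "ap \<pi> x = x"
proof -
  have "acts S \<pi> x x"
  proof (rule mem_induct[OF _ _ x])
    show "dfb S (Univ S) (\<lambda>e. acts S \<pi> (e 0) (e 0))" by (intro dfbs Perms_props p)
    fix x assume x: "x \<in> Univ S" and "\<And>t. t \<in> elts S x \<Longrightarrow> acts S \<pi> t t"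
    then have IH: "ap \<pi> t = t" if "t \<in> elts S x" for t using that acts_iff_ap[OF p] eltsU by metis
    have "ap \<pi> x = x"
    proof (cases "atom S x")
      case True
      then show ?thesis using ap_atom(1)[OF p True] g by (auto simp: atom_def)
    next
      case False
      then have s: "is_set S x" using x by (simp add: is_set_def)
      show ?thesis by (rule extens) (use IH in \<open>simp_all add: ap_set p s\<close>)
    qed
    then show "acts S \<pi> x x" using acts_iff_ap[OF p x] by simp
  qed
  then show ?thesis using acts_iff_ap[OF p x] by simp
qed

definition inv_perm :: "'a \<Rightarrow> 'a" where
  "inv_perm \<pi> = rl ((graph S \<pi>)\<inverse>)"

lemma inv_perm: assumes "\<pi> \<in> Perms S" shows "inv_perm \<pi> \<in> Perms S" "graph S (inv_perm \<pi>) = (graph S \<pi>)\<inverse>"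
  using Perms_props[OF assms] rl_Perms[of "(graph S \<pi>)\<inverse>"] rl(4)[OF isR_converse, of "graph S \<pi>"]
  by (auto simp: inv_perm_def isR_converse)

lemma isC_Ats: "isC Ats"
  by (rule isC_elts[OF AtomsU])

lemma relcomp_converse_single_valued: "single_valued (R\<inverse>) \<Longrightarrow> R O R\<inverse> = Id_on (Domain R)"
  by (auto simp: single_valued_def Id_on_def)

lemma ap_inv:
  assumes p: "\<pi> \<in> Perms S" and q: "\<rho> \<in> Perms S" and g: "graph S \<rho> = (graph S \<pi>)\<inverse>" and x: "x \<in> Univ S"
  shows "ap \<rho> (ap \<pi> x) = x"
proof -
  have R: "isR (Id_on Ats)" by (intro isR_Id_on isC_Ats)
  have i: "rl (Id_on Ats) \<in> Perms S" by (rule rl_Perms[OF R sv_Id_on]) auto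
  have "Id_on Ats = graph S \<pi> O graph S \<rho>"
    using relcomp_converse_single_valued[OF Perms_props(3)[OF p]] g Perms_props(4)[OF p] by simp
  then have "ap (rl (Id_on Ats)) x = ap \<rho> (ap \<pi> x)"
    using ap_comp[OF p q i _ x] rl(4)[OF R] by simp
  then show ?thesis using ap_id[OF i rl(4)[OF R] x] by simp
qed

lemma ap_inverse: 
  assumes p: "\<pi> \<in> Perms S" and x: "x \<in> Univ S"
  shows "ap (inv_perm \<pi>) (ap \<pi> x) = x" "ap \<pi> (ap (inv_perm \<pi>) x) = x"
  using ap_inv[OF p inv_perm[OF p] x] ap_inv[OF inv_perm(1)[OF p] p _ x] inv_perm(2)[OF p] by auto

lemma ap_inj: "\<pi> \<in> Perms S \<Longrightarrow> x \<in> Univ S \<Longrightarrow> y \<in> Univ S \<Longrightarrow> ap \<pi> x = ap \<pi> y \<longleftrightarrow> x = y"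
  using ap_inverse(1) by metis

lemma ap_mem: "\<pi> \<in> Perms S \<Longrightarrow> x \<in> Univ S \<Longrightarrow> y \<in> Univ S \<Longrightarrow> ap \<pi> y \<in> elts S (ap \<pi> x) \<longleftrightarrow> y \<in> elts S x"
proof -
  assume p: "\<pi> \<in> Perms S" and x: "x \<in> Univ S" and y: "y \<in> Univ S"
  show ?thesis
  proof (cases "atom S x")
    case True
    then show ?thesis using atom_empty ap_atom(2)[OF p True] by simp
  next
    case False
    then have "is_set S x" using x by (simp add: is_set_def)
    then show ?thesis unfolding ap_set(2)[OF p \<open>is_set S x\<close>] image_iff using ap_inj[OF p y] eltsU by blast
  qed
qed

lemma ap_Atoms: "\<pi> \<in> Perms S \<Longrightarrow> ap \<pi> (Atoms S) = Atoms S"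
proof -
  assume p: "\<pi> \<in> Perms S"
  have "ap \<pi> ` Ats = Ats"
  proof
    show "ap \<pi> ` Ats \<subseteq> Ats" using ap_atom(2)[OF p] by (auto simp: atom_def)
    show "Ats \<subseteq> ap \<pi> ` Ats"
    proof
      fix b assume b: "b \<in> Ats"
      then have "ap (inv_perm \<pi>) b \<in> Ats" using ap_atom(2)[OF inv_perm(1)[OF p]] by (auto simp: atom_def)
      then show "b \<in> ap \<pi> ` Ats" using ap_inverse(2)[OF p eltsU[OF b]] by (metis imageI)
    qed
  qed
  then show ?thesis
    by (intro extens ap_set p is_set_Atoms) (simp add: ap_set p is_set_Atoms)
qed

lemma ap_mk: 
  assumes p: "\<pi> \<in> Perms S" and K: "isC K"
  shows "isC (ap \<pi> ` K)" "ap \<pi> (mk K) = mk (ap \<pi> ` K)"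
proof -
  note * = ap_set[OF p mk(1)[OF K], unfolded mk(2)[OF K]]
  show "isC (ap \<pi> ` K)" using * unfolding isC_def by blast
  show "ap \<pi> (mk K) = mk (ap \<pi> ` K)" by (rule mk_eqI[OF *])
qed

lemma ap_pr: "\<pi> \<in> Perms S \<Longrightarrow> a \<in> Univ S \<Longrightarrow> b \<in> Univ S \<Longrightarrow> ap \<pi> (pr a b) = pr (ap \<pi> a) (ap \<pi> b)"
  unfolding pr_def by (simp add: ap_mk isC_upair isC_sing mk)

lemma ap_graph: "\<pi> \<in> Perms S \<Longrightarrow> f \<in> Univ S \<Longrightarrow> a \<in> Univ S \<Longrightarrow> b \<in> Univ S \<Longrightarrow>
   (ap \<pi> a, ap \<pi> b) \<in> graph S (ap \<pi> f) \<longleftrightarrow> (a, b) \<in> graph S f"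
  by (simp add: graph_iff ap_U ap_pr[symmetric] ap_mem pr_props)

section \<open>Pointwise stabilizers and supports\<close>

definition fixp :: "'a set \<Rightarrow> 'a set" where
  "fixp C = {\<pi> \<in> Perms S. \<forall>c\<in>C. ap \<pi> c = c}"

lemma fix_grp_eq: "C \<subseteq> Ats \<Longrightarrow> fix_grp S C = fixp C"
  using ap_atom(1) unfolding fix_grp_def fixp_def atom_def by blast

definition supp :: "'a set \<Rightarrow> 'a \<Rightarrow> bool" where
  "supp C x \<longleftrightarrow> C \<subseteq> Ats \<and> countable_in S C \<and> (\<forall>\<pi>\<in>fixp C. ap \<pi> x = x)"

text \<open>\<open>sym_grp S x\<close> is a subgroup for every \<open>x\<close>, so lying in the
  filter reduces to the existence of a countable support.\<close>

lemma symmetric_iff: assumes x: "x \<in> Univ S" shows "symmetric S x \<longleftrightarrow> (\<exists>C. supp C x)"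
proof -
  have s: "sym_grp S x = {\<pi> \<in> Perms S. ap \<pi> x = x}"
    using acts_iff_ap[OF _ x] by (auto simp: sym_grp_def)
  have "perm_subgroup S (sym_grp S x)" unfolding perm_subgroup_def s
  proof (intro conjI ballI impI)
    fix \<iota> assume "\<iota> \<in> Perms S" "graph S \<iota> = Id_on Ats"
    then show "\<iota> \<in> {\<pi> \<in> Perms S. ap \<pi> x = x}" using ap_id x by simp
  next
    fix \<pi> \<rho> \<sigma> assume "\<pi> \<in> {\<pi> \<in> Perms S. ap \<pi> x = x}" "\<rho> \<in> {\<pi> \<in> Perms S. ap \<pi> x = x}"
      "\<sigma> \<in> Perms S" "graph S \<sigma> = graph S \<rho> O graph S \<pi>"
    then show "\<sigma> \<in> {\<pi> \<in> Perms S. ap \<pi> x = x}" using ap_comp[of \<rho> \<pi> \<sigma> x] x by simp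
  next
    fix \<pi> \<sigma> assume "\<pi> \<in> {\<pi> \<in> Perms S. ap \<pi> x = x}" "\<sigma> \<in> Perms S" "graph S \<sigma> = (graph S \<pi>)\<inverse>"
    then show "\<sigma> \<in> {\<pi> \<in> Perms S. ap \<pi> x = x}" using ap_inv[of \<pi> \<sigma> x] x by auto
  qed auto
  then have "symmetric S x \<longleftrightarrow> (\<exists>C. is_set S C \<and> elts S C \<subseteq> Ats \<and> countable_in S (elts S C) \<and>
          fix_grp S (elts S C) \<subseteq> sym_grp S x)"
    by (simp add: symmetric_def F_filter_def)
  also have "\<dots> \<longleftrightarrow> (\<exists>C. supp C x)"
  proof
    assume "\<exists>C. is_set S C \<and> elts S C \<subseteq> Ats \<and> countable_in S (elts S C) \<and> fix_grp S (elts S C) \<subseteq> sym_grp S x"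
    then show "\<exists>C. supp C x" unfolding supp_def s using fix_grp_eq by blast
  next
    assume "\<exists>C. supp C x"
    then obtain C where C: "C \<subseteq> Ats" "countable_in S C" "\<forall>\<pi>\<in>fixp C. ap \<pi> x = x" by (auto simp: supp_def)
    note m = mk[OF countable_isC[OF C(2)]]
    show "\<exists>C. is_set S C \<and> elts S C \<subseteq> Ats \<and> countable_in S (elts S C) \<and> fix_grp S (elts S C) \<subseteq> sym_grp S x"
      by (rule exI[of _ "mk C"]) (use C m in \<open>auto simp: fix_grp_eq s fixp_def\<close>)
  qed
  finally show ?thesis .
qed

end

section \<open>Countable sets and choice\<close>

lemma single_valued_Un:
  "single_valued R \<Longrightarrow> single_valued Q \<Longrightarrow> Domain R \<inter> Domain Q = {} \<Longrightarrow> single_valued (R \<union> Q)"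
  unfolding single_valued_def by blast

context zfa
begin

lemma nat_cases: "n \<in> nats S \<Longrightarrow> n = emp \<or> (\<exists>k\<in>nats S. n = suc k)"
proof -
  assume n: "n \<in> nats S"
  have "n = emp \<or> (\<exists>k\<in>Univ S. k \<in> nats S \<and> is_succ S n k)"
    by (rule nat_induct_in[OF _ _ _ n], intro dfbs emp) (auto simp: is_succ_iff natsU)
  then show ?thesis by (auto simp: is_succ_iff)
qed

text \<open>Recursion with the double successor gives \<open>n \<mapsto> 2n\<close>. The last
  property says that the successor of a value is never a value, so even and odd numbers provide two
  embeddings of \<open>\<omega>\<close> into itself with disjoint ranges.\<close>

lemma ex_doubling:
  obtains R where "isR R" "single_valued R" "single_valued (R\<inverse>)" "Domain R = nats S" "Range R \<subseteq> nats S"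
    "\<And>n m n'. (n, m) \<in> R \<Longrightarrow> (n', suc m) \<notin> R"
proof -
  have d: "dfb S (Univ S) (\<lambda>e. e 0 = suc (suc (e 1)))"
    by (rule dfb_cong[where Q="\<lambda>e. \<exists>k\<in>Univ S. is_succ S k (e 1) \<and> is_succ S (e 0) k"], intro dfbs)
      (auto simp: is_succ_iff suc image_subset_iff)
  have HU: "suc (suc x) \<in> Univ S" if "x \<in> Univ S" for x by (intro suc(1) that)
  obtain R where R: "isR R" "single_valued R" "Domain R = nats S" "(emp, emp) \<in> R"
    "\<And>n y. (n, y) \<in> R \<Longrightarrow> (suc n, suc (suc y)) \<in> R"
    using nat_recursion[OF HU emp(1) d] by blast
  have U: "n \<in> nats S" "m \<in> Univ S" if "(n, m) \<in> R" for n m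
    using that R(3) isR_U[OF R(1)] by blast+
  have R0: "m = emp" if "(emp, m) \<in> R" for m using that R(2,4) by (auto simp: single_valued_def)
  have RS: "\<exists>m'. (k, m') \<in> R \<and> m = suc (suc m')" if s: "(suc k, m) \<in> R" "k \<in> nats S" for k m
  proof -
    obtain m' where m': "(k, m') \<in> R" using s(2) unfolding R(3)[symmetric] by blast
    show ?thesis using m' single_valuedD[OF R(2) s(1) R(5)[OF m']] by blast
  qed
  have RE: "(n = emp \<and> m = emp) \<or> (\<exists>k m'. (k, m') \<in> R \<and> n = suc k \<and> m = suc (suc m'))" if "(n, m) \<in> R" for n m
    using nat_cases[OF U(1)[OF that]] R0 RS that by metis
  let ?J = "\<lambda>n. \<forall>m\<in>Univ S. \<forall>n'\<in>Univ S. (n, m) \<in> R \<longrightarrow> (n', m) \<in> R \<longrightarrow> n = n'"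
  have inj: "?J n" if "n \<in> nats S" for n
  proof (rule nat_induct_in[OF _ _ _ that])
    show "?J emp"
      using RE R0 suc_not_emp U suc by metis
    fix n assume n: "n \<in> nats S" and IH: "?J n"
    show "?J (suc n)"
    proof (intro ballI impI)
      fix m n' assume *: "(suc n, m) \<in> R" "(n', m) \<in> R"
      obtain m' where m': "(n, m') \<in> R" "m = suc (suc m')" using RS[OF *(1) n] by blast
      then have "m \<noteq> emp" using suc_not_emp suc U by metis
      then obtain k m'' where k: "(k, m'') \<in> R" "n' = suc k" "m = suc (suc m'')" using RE[OF *(2)] by blast
      then have "m' = m''" using m' suc_inject suc U by metis
      then show "suc n = n'" using IH m' k U natsU by metis
    qed
  qed (intro dfbs dfb_isR R)
  let ?D = "\<lambda>n. \<forall>m\<in>Univ S. \<forall>n'\<in>Univ S. \<forall>m'\<in>Univ S. (n, m) \<in> R \<longrightarrow> is_succ S m' m \<longrightarrow> (n', m') \<notin> R"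
  have par: "?D n" if "n \<in> nats S" for n
  proof (rule nat_induct_in[OF _ _ _ that])
    show "?D emp"
    proof (intro ballI impI notI)
      fix m n' m' assume *: "(emp, m) \<in> R" "is_succ S m' m" "(n', m') \<in> R"
      then have m: "m' = suc emp" using R0 by (auto simp: is_succ_iff)
      then have "m' \<noteq> emp" using suc_not_emp emp by metis
      then obtain k m'' where "(k, m'') \<in> R" "m' = suc (suc m'')" using RE[OF *(3)] by blast
      then show False using m suc_inject suc_not_emp suc emp(1) U by metis
    qed
    fix n assume n: "n \<in> nats S"
      and IH: "?D n"
    show "?D (suc n)"
    proof (intro ballI impI notI)
      fix m n' m' assume *: "(suc n, m) \<in> R" "is_succ S m' m" "(n', m') \<in> R"
      obtain m1 where m1: "(n, m1) \<in> R" "m = suc (suc m1)" using RS[OF *(1) n] by blast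
      have m1U: "m1 \<in> Univ S" using U m1 by blast
      have m': "m' = suc (suc (suc m1))" using * m1 by (simp add: is_succ_iff)
      then have "m' \<noteq> emp" using suc_not_emp suc m1U by metis
      then obtain k m2 where k: "(k, m2) \<in> R" "m' = suc (suc m2)" using RE[OF *(3)] by blast
      then have m2: "m2 = suc m1" using m' suc_inject suc m1U U by metis
      show False using IH m1(1) k(1) m2 m1U suc U natsU by (metis is_succ_iff)
    qed
  qed (intro dfbs dfb_isR R)
  have ran: "\<forall>m\<in>Univ S. (n, m) \<in> R \<longrightarrow> m \<in> nats S" if "n \<in> nats S" for n
    by (rule nat_induct_in[OF _ _ _ that], intro dfbs dfb_isR R) (use R0 RS emp_nats suc_nats U in blast)+
  show thesis
  proof (rule that[OF R(1,2) _ R(3)])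
    show "single_valued (R\<inverse>)" unfolding single_valued_def using inj U natsU by blast
    show "Range R \<subseteq> nats S" using ran U by blast
    fix n m n' assume "(n, m) \<in> R"
    then show "(n', suc m) \<notin> R" using par U suc natsU by (metis is_succ_iff)
  qed
qed

text \<open>\<open>C\<close> is sent to the even numbers and \<open>D - C\<close> to the odd
  ones.\<close>

lemma countable_Un:
  assumes "countable_in S C" "countable_in S D"
  shows "countable_in S (C \<union> D)"
proof -
  obtain R where R: "isR R" "single_valued R" "single_valued (R\<inverse>)" "Domain R = nats S" "Range R \<subseteq> nats S"
    "\<And>n m n'. (n, m) \<in> R \<Longrightarrow> (n', suc m) \<notin> R" using ex_doubling by blast
  obtain P where P: "isR P" "single_valued P" "single_valued (P\<inverse>)" "Domain P = C" "Range P \<subseteq> nats S"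
    using assms(1) by (auto simp: countable_in_iff)
  obtain Q where Q: "isR Q" "single_valued Q" "single_valued (Q\<inverse>)" "Domain Q = D" "Range Q \<subseteq> nats S"
    using assms(2) by (auto simp: countable_in_iff)
  define Sc where "Sc = {(m, m'). m \<in> nats S \<and> m' \<in> nats S \<and> is_succ S m' m}"
  have Sc: "isR Sc"
  proof (rule isR_dfb[OF isC_nats isC_nats])
    show "dfb S (Univ S) (\<lambda>e. (e 0, e 1) \<in> Sc)" unfolding Sc_def mem_Collect_eq case_prod_conv
      by (intro dfbs)
  qed (auto simp: Sc_def)
  have Sc2: "single_valued Sc" "single_valued (Sc\<inverse>)" "Domain Sc = nats S" "Range Sc \<subseteq> nats S"
    using suc_inject suc_nats natsU by (fastforce simp: Sc_def is_succ_iff single_valued_def)+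
  let ?Q = "Q \<inter> (D - C) \<times> UNIV"
  have Q': "isR ?Q" "single_valued ?Q" "single_valued (?Q\<inverse>)" "Domain ?Q = D - C" "Range ?Q \<subseteq> nats S"
    using Q isR_restr[OF Q(1) isC_Diff[OF countable_isC[OF assms(2)] countable_isC[OF assms(1)]]]
    by (auto simp: single_valued_def)
  let ?F = "(P O R) \<union> (?Q O R O Sc)"
  have 0: "isR ?F" by (intro isR_Un isR_comp P R Q' Sc)
  have 1: "single_valued (P O R)" "single_valued (?Q O R O Sc)"
    by (intro single_valued_relcomp P R Q' Sc2)+
  have 2: "single_valued ((P O R)\<inverse>)" "single_valued ((?Q O R O Sc)\<inverse>)"
    unfolding converse_relcomp O_assoc[symmetric] by (intro single_valued_relcomp P R Q' Sc2)+
  have 3: "Domain (P O R) = C" "Range (P O R) \<subseteq> nats S"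
    using P(4,5) R(4,5) by blast+
  have 4: "Domain (?Q O R O Sc) = D - C" "Range (?Q O R O Sc) \<subseteq> nats S"
    using Q'(4,5) R(4,5) Sc2(3,4) by blast+
  have 5: "Range (P O R) \<inter> Range (?Q O R O Sc) = {}"
  proof (rule ccontr)
    assume "Range (P O R) \<inter> Range (?Q O R O Sc) \<noteq> {}"
    then obtain n m n' m' where "(n, m) \<in> R" "(n', m') \<in> R" "(m', m) \<in> Sc" by blast
    then show False using R(6) by (auto simp: Sc_def is_succ_iff)
  qed
  have "single_valued ?F" by (rule single_valued_Un[OF 1]) (unfold 3 4, blast)
  moreover have "single_valued (?F\<inverse>)" unfolding converse_Un
    by (rule single_valued_Un[OF 2]) (unfold Domain_converse, rule 5)
  moreover have "Domain ?F = C \<union> D" unfolding Domain_Un_eq 3(1) 4(1) by blast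
  moreover have "Range ?F \<subseteq> nats S" unfolding Range_Un_eq using 3(2) 4(2) by (rule Un_least)
  ultimately show ?thesis unfolding countable_in_iff using 0 by blast
qed

lemma countable_sing: assumes "a \<in> Univ S" shows "countable_in S {a}"
proof -
  have "isR ({a} \<times> {emp})" by (intro isR_prod isC_sing assms emp)
  then show ?thesis unfolding countable_in_iff using emp_nats
    by (intro exI[of _ "{a} \<times> {emp}"]) (auto simp: single_valued_def)
qed

lemma finite_sing: assumes "a \<in> Univ S" shows "finite_in S {a}"
proof -
  have "isR ({a} \<times> {emp})" by (intro isR_prod isC_sing assms emp)
  then show ?thesis unfolding finite_in_iff using emp_nats suc(3)[OF emp(1)] suc_nats
    by (intro bexI[of _ "suc emp"] exI[of _ "{a} \<times> {emp}"]) (auto simp: single_valued_def)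
qed

lemma finite_countable: "finite_in S K \<Longrightarrow> countable_in S K"
  unfolding finite_in_iff countable_in_iff using nats_elts by blast

lemma countable_empty: "countable_in S {}"
  using countable_subset[OF countable_sing[OF emp(1)] isC_empty] by simp

text \<open>\<open>AC\<close> selects from disjoint families, so each nonempty \<open>Y\<close> is
  replaced by its tagged copy \<open>{Y} \<times> Y\<close>. The selector \<open>c\<close> is read
  as a relation. As it may contain other pairs, uniqueness is claimed only among the elements of
  \<open>Y\<close>.\<close>

lemma choice:
  assumes "AC S" and A: "isC A"
  obtains c where "c \<in> Univ S" "\<And>Y. is_set S Y \<Longrightarrow> elts S Y \<subseteq> A \<Longrightarrow> elts S Y \<noteq> {} \<Longrightarrow>
     \<exists>!a. a \<in> elts S Y \<and> (Y, a) \<in> graph S c"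
proof -
  define PA where "PA = {Y. is_set S Y \<and> elts S Y \<subseteq> A}"
  have PA: "isC PA" unfolding PA_def by (rule isC_Pow[OF A])
  define T where "T Y y \<longleftrightarrow> elts S Y \<noteq> {} \<and> is_set S y \<and> elts S y = prs ({Y} \<times> elts S Y)" for Y y
  have Tiff: "T Y y \<longleftrightarrow> (\<exists>x\<in>elts S Y. True) \<and> is_set S y \<and> (\<forall>z\<in>Univ S. z \<in> elts S y \<longleftrightarrow> (\<exists>a\<in>elts S Y. is_opair S z Y a))"
    if "Y \<in> Univ S" for Y y
  proof -
    have "elts S y = prs ({Y} \<times> elts S Y) \<longleftrightarrow> (\<forall>z\<in>Univ S. z \<in> elts S y \<longleftrightarrow> (\<exists>a\<in>elts S Y. is_opair S z Y a))"
      unfolding set_eq_iff prs_def is_opair_iff using that eltsU pr_props(1) by blast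
    then show ?thesis unfolding T_def by blast
  qed
  have dT: "dfb S (Univ S) (\<lambda>e. T (e 0) (e 1))"
    by (rule dfb_cong[OF _ Tiff], intro dfbs) auto
  let ?F = "{y \<in> Univ S. \<exists>Y\<in>PA. T Y y}"
  have F: "isC ?F"
    by (rule isC_repl[OF dT PA]) (auto simp: T_def intro: extens)
  have Y: "isC (prs ({Y} \<times> elts S Y))" if "Y \<in> Univ S" for Y by (intro isC_prod isC_sing isC_elts that)
  have e: "elts S (mk ?F) = ?F" by (rule mk(2)[OF F])
  have "\<exists>c. is_set S c \<and> (\<forall>y\<in>?F. \<exists>!z. z \<in> elts S c \<inter> elts S y)"
  proof -
    have 1: "\<forall>y\<in>elts S (mk ?F). elts S y \<noteq> {}" unfolding e by (auto simp: T_def prs_def)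
    have 2: "\<forall>y\<in>elts S (mk ?F). \<forall>y'\<in>elts S (mk ?F). y \<noteq> y' \<longrightarrow> elts S y \<inter> elts S y' = {}" unfolding e
    proof (intro ballI impI)
      fix y y' assume "y \<in> ?F" "y' \<in> ?F" "y \<noteq> y'"
      then obtain Y Y' where *: "T Y y" "T Y' y'" "Y \<in> PA" "Y' \<in> PA" by blast
      then have U: "Y \<in> Univ S" "Y' \<in> Univ S" by (auto simp: PA_def is_set_def)
      have ne: "Y \<noteq> Y'" using * \<open>y \<noteq> y'\<close> by (auto simp: T_def intro: extens)
      show "elts S y \<inter> elts S y' = {}"
      proof (rule ccontr)
        assume "elts S y \<inter> elts S y' \<noteq> {}"
        then obtain a a' where "a \<in> elts S Y" "a' \<in> elts S Y'" "pr Y a = pr Y' a'"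
          using * by (auto simp: T_def prs_def)
        then show False using ne pr_inject U eltsU by metis
      qed
    qed
    show ?thesis using assms(1)[unfolded AC_def, rule_format, OF mk(1)[OF F]] 1 2 unfolding e by blast
  qed
  then obtain c where c: "is_set S c" "\<forall>y\<in>?F. \<exists>!z. z \<in> elts S c \<inter> elts S y" by blast
  show thesis
  proof (rule that[OF is_setU[OF c(1)]])
    fix Y assume Ys: "is_set S Y" "elts S Y \<subseteq> A" "elts S Y \<noteq> {}"
    have YU: "Y \<in> Univ S" using Ys is_setU by blast
    note m = mk[OF Y[OF YU]]
    have "T Y (mk (prs ({Y} \<times> elts S Y)))" unfolding T_def using Ys m by blast
    then have "mk (prs ({Y} \<times> elts S Y)) \<in> ?F"
      using Ys m(3) unfolding PA_def by blast
    from bspec[OF c(2) this] have "\<exists>!z. z \<in> elts S c \<inter> prs ({Y} \<times> elts S Y)" unfolding m(2) .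
    then obtain z where z: "z \<in> elts S c" "z \<in> prs ({Y} \<times> elts S Y)"
      and uz: "\<And>z'. z' \<in> elts S c \<Longrightarrow> z' \<in> prs ({Y} \<times> elts S Y) \<Longrightarrow> z' = z" by blast
    obtain a where a: "a \<in> elts S Y" "z = pr Y a" using z(2) by (auto simp: prs_def)
    show "\<exists>!a. a \<in> elts S Y \<and> (Y, a) \<in> graph S c"
    proof (rule ex1I[of _ a])
      show "a \<in> elts S Y \<and> (Y, a) \<in> graph S c" using a z YU eltsU by (auto simp: graph_iff)
      fix a' assume a': "a' \<in> elts S Y \<and> (Y, a') \<in> graph S c"
      then have "pr Y a' = z" by (intro uz) (auto simp: graph_iff prs_def)
      then show "a' = a" using a a' pr_inject YU eltsU by metis
    qed
  qed
qed

text \<open>The injection is \<open>n \<mapsto> g (Y\<^sub>n)\<close> where \<open>Y\<^sub>0 = A - X\<close>, \<open>Y\<^sub>n\<^sub>+\<^sub>1 = Y\<^sub>n - {g (Y\<^sub>n)}\<close> and \<open>g\<close> is a choice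
  function; all \<open>Y\<^sub>n\<close> are uncountable, hence nonempty.\<close>

lemma uncountable_injection:
  assumes "AC S" and A: "isC A" and nc: "\<not> countable_in S A" and X: "countable_in S X"
  obtains E where "isR E" "single_valued E" "single_valued (E\<inverse>)" "Domain E = nats S" "Range E \<subseteq> A - X"
proof -
  obtain c where c: "c \<in> Univ S" "\<And>Y. is_set S Y \<Longrightarrow> elts S Y \<subseteq> A \<Longrightarrow> elts S Y \<noteq> {} \<Longrightarrow>
     \<exists>!a. a \<in> elts S Y \<and> (Y, a) \<in> graph S c" by (rule choice[OF assms(1) A]) (rule that)
  have AX: "isC (A - X)" by (intro isC_Diff A countable_isC X)
  have ncAX: "\<not> countable_in S (A - X)"
    using countable_Un[OF X] countable_subset[OF _ A] nc by (metis Un_Diff_cancel Un_upper2)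
  define H where "H Y = mk {a \<in> elts S Y. (Y, a) \<notin> graph S c}" for Y
  have HC: "isC {a \<in> elts S Y. (Y, a) \<notin> graph S c}" if "Y \<in> Univ S" for Y
    by (intro isC_sep isC_elts that dfbs c)
  note Hm = mk[OF HC, folded H_def]
  have dH: "dfb S (Univ S) (\<lambda>e. e 0 = H (e 1))"
  proof (rule dfb_cong[where Q="\<lambda>e. is_set S (e 0) \<and> (\<forall>x\<in>Univ S. x \<in> elts S (e 0) \<longleftrightarrow> x \<in> elts S (e 1) \<and> (e 1, x) \<notin> graph S c)"])
    show "dfb S (Univ S) (\<lambda>e. is_set S (e 0) \<and> (\<forall>x\<in>Univ S. x \<in> elts S (e 0) \<longleftrightarrow> x \<in> elts S (e 1) \<and> (e 1, x) \<notin> graph S c))"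
      by (intro dfbs c)
    fix e :: "nat \<Rightarrow> 'a" assume e: "range e \<subseteq> Univ S"
    then have "e 1 \<in> Univ S" by auto
    note m = Hm[OF this]
    have "e 0 = H (e 1) \<longleftrightarrow> is_set S (e 0) \<and> elts S (e 0) = {a \<in> elts S (e 1). (e 1, a) \<notin> graph S c}"
    proof
      assume "is_set S (e 0) \<and> elts S (e 0) = {a \<in> elts S (e 1). (e 1, a) \<notin> graph S c}"
      then show "e 0 = H (e 1)" unfolding H_def by (intro mk_eqI) simp_all
    qed (simp only: m simp_thms)
    moreover have "elts S (e 0) = {a \<in> elts S (e 1). (e 1, a) \<notin> graph S c} \<longleftrightarrow>
       (\<forall>x\<in>Univ S. x \<in> elts S (e 0) \<longleftrightarrow> x \<in> elts S (e 1) \<and> (e 1, x) \<notin> graph S c)"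
      by (auto simp: set_eq_iff dest: eltsU)
    ultimately show "(e 0 = H (e 1)) = (is_set S (e 0) \<and> (\<forall>x\<in>Univ S. x \<in> elts S (e 0) \<longleftrightarrow> x \<in> elts S (e 1) \<and> (e 1, x) \<notin> graph S c))"
      by simp
  qed
  obtain R where R: "isR R" "single_valued R" "Domain R = nats S" "(emp, mk (A - X)) \<in> R"
    "\<And>n y. (n, y) \<in> R \<Longrightarrow> (suc n, H y) \<in> R"
    using nat_recursion[OF Hm(3) mk(3)[OF AX] dH] by blast
  have U: "n \<in> nats S" "m \<in> Univ S" if "(n, m) \<in> R" for n m
    using that R(3) isR_U[OF R(1)] by blast+
  have R0: "Y = mk (A - X)" if "(emp, Y) \<in> R" for Y using that R(2,4) by (auto simp: single_valued_def)
  have RS: "\<exists>Y'. (k, Y') \<in> R \<and> Y = H Y'" if s: "(suc k, Y) \<in> R" "k \<in> nats S" for k Y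
  proof -
    obtain Y' where Y': "(k, Y') \<in> R" using s(2) unfolding R(3)[symmetric] by blast
    show ?thesis using Y' single_valuedD[OF R(2) s(1) R(5)[OF Y']] by blast
  qed
  let ?I = "\<lambda>Y. is_set S Y \<and> (\<forall>a\<in>elts S Y. a \<in> A - X) \<and> \<not> countable_in S (elts S Y)"
  have inv: "\<forall>Y\<in>Univ S. (n, Y) \<in> R \<longrightarrow> ?I Y"
    if "n \<in> nats S" for n
  proof (rule nat_induct_in[OF _ _ _ that])
    show "dfb S (Univ S) (\<lambda>e. \<forall>Y\<in>Univ S. (e 0, Y) \<in> R \<longrightarrow> ?I Y)"
      by (intro dfbs dfb_isR R dfb_isC AX dfb_countable_in[OF subset_refl] eltsU')
    show "\<forall>Y\<in>Univ S. (emp, Y) \<in> R \<longrightarrow> ?I Y"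
      using R0 mk[OF AX] ncAX by auto
    fix n assume n: "n \<in> nats S" and IH: "\<forall>Y\<in>Univ S. (n, Y) \<in> R \<longrightarrow> ?I Y"
    show "\<forall>Y\<in>Univ S. (suc n, Y) \<in> R \<longrightarrow> ?I Y"
    proof (intro ballI impI)
      fix Y assume "Y \<in> Univ S" "(suc n, Y) \<in> R"
      then obtain Z where Z: "(n, Z) \<in> R" "Y = H Z" using RS n by blast
      have ZU: "Z \<in> Univ S" using U Z by blast
      have Zp: "is_set S Z" "\<forall>a\<in>elts S Z. a \<in> A - X" "\<not> countable_in S (elts S Z)" using IH Z ZU by auto
      then have "elts S Z \<noteq> {}" "elts S Z \<subseteq> A" using countable_empty by auto
      then obtain a where a: "a \<in> elts S Z" "(Z, a) \<in> graph S c" "\<And>b. b \<in> elts S Z \<Longrightarrow> (Z, b) \<in> graph S c \<Longrightarrow> b = a"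
        using c(2)[OF Zp(1)] by metis
      have eY: "elts S Y = {a \<in> elts S Z. (Z, a) \<notin> graph S c}" using Hm(2)[OF ZU] Z by simp
      have "elts S Z \<subseteq> {a} \<union> elts S Y" using a eY by blast
      then have "\<not> countable_in S (elts S Y)"
        using Zp(3) countable_subset[OF countable_Un[OF countable_sing] isC_elts[OF ZU]] a(1) eltsU by blast
      then show "?I Y"
        using Hm(1)[OF ZU] Z(2) eY Zp(2) by auto
    qed
  qed
  \<comment> \<open>A chosen element is missing from all later stages; together with linearity of
    the natural numbers this gives injectivity.\<close>
  have dec: "\<forall>n\<in>elts S m. \<forall>Y\<in>Univ S. \<forall>Y'\<in>Univ S. \<forall>a\<in>Univ S. (n, Y) \<in> R \<longrightarrow> (m, Y') \<in> R \<longrightarrow> a \<in> elts S Y' \<longrightarrow>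
     a \<in> elts S Y \<and> (Y, a) \<notin> graph S c" if "m \<in> nats S" for m
  proof (rule nat_induct_in[OF _ _ _ that])
    fix m assume m: "m \<in> nats S" and IH: "\<forall>n\<in>elts S m. \<forall>Y\<in>Univ S. \<forall>Y'\<in>Univ S. \<forall>a\<in>Univ S. (n, Y) \<in> R \<longrightarrow> (m, Y') \<in> R \<longrightarrow> a \<in> elts S Y' \<longrightarrow>
     a \<in> elts S Y \<and> (Y, a) \<notin> graph S c"
    show "\<forall>n\<in>elts S (suc m). \<forall>Y\<in>Univ S. \<forall>Y'\<in>Univ S. \<forall>a\<in>Univ S. (n, Y) \<in> R \<longrightarrow> (suc m, Y') \<in> R \<longrightarrow> a \<in> elts S Y' \<longrightarrow>
     a \<in> elts S Y \<and> (Y, a) \<notin> graph S c"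
    proof (intro ballI impI)
      fix n Y Y' a assume *: "n \<in> elts S (suc m)" "Y \<in> Univ S" "(n, Y) \<in> R" "(suc m, Y') \<in> R" "a \<in> elts S Y'" "a \<in> Univ S"
      obtain Z where Z: "(m, Z) \<in> R" "Y' = H Z" using RS[OF *(4) m] by blast
      have ZU: "Z \<in> Univ S" using U Z by blast
      have aZ: "a \<in> elts S Z" "(Z, a) \<notin> graph S c" using *(5) Hm(2)[OF ZU] Z(2) by auto
      show "a \<in> elts S Y \<and> (Y, a) \<notin> graph S c"
      proof (cases "n = m")
        case True
        then have "Y = Z" using R(2) *(3) Z(1) by (auto simp: single_valued_def)
        then show ?thesis using aZ by simp
      next
        case False
        then have "n \<in> elts S m" using *(1) suc(3) natsU m by auto
        then show ?thesis using IH *(2,3,6) Z(1) ZU aZ(1) by blast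
      qed
    qed
  qed (simp_all add: emp, intro dfbs dfb_isR R c)
  let ?E = "{(n, a). \<exists>Y\<in>Univ S. (n, Y) \<in> R \<and> (Y, a) \<in> graph S c \<and> a \<in> elts S Y}"
  have EA: "a \<in> A - X \<and> n \<in> nats S" if "(n, a) \<in> ?E" for n a using that inv U by blast
  have uniq: "a = b" if "is_set S Y" "elts S Y \<subseteq> A" "a \<in> elts S Y" "b \<in> elts S Y" "(Y, a) \<in> graph S c" "(Y, b) \<in> graph S c" for Y a b
    using c(2)[OF that(1,2)] that(3-) by blast
  show thesis
  proof (rule that)
    show "isR ?E"
    proof (rule isR_dfb[OF isC_nats AX])
      show "dfb S (Univ S) (\<lambda>e. (e 0, e 1) \<in> ?E)" unfolding mem_Collect_eq case_prod_conv
        by (intro dfbs dfb_isR R c)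
    qed (use EA in blast)
    show "single_valued ?E"
    proof (rule single_valuedI)
      fix n a b assume "(n, a) \<in> ?E" "(n, b) \<in> ?E"
      then obtain Y Y' where Y: "(n, Y) \<in> R" "(Y, a) \<in> graph S c" "a \<in> elts S Y"
        "(n, Y') \<in> R" "(Y', b) \<in> graph S c" "b \<in> elts S Y'" by blast
      then have "Y' = Y" using R(2) by (auto simp: single_valued_def)
      moreover have "is_set S Y" "elts S Y \<subseteq> A" using inv Y(1) U by blast+
      ultimately show "a = b" using uniq Y by blast
    qed
    show "single_valued (?E\<inverse>)"
    proof (rule single_valuedI)
      fix a n m assume "(a, n) \<in> ?E\<inverse>" "(a, m) \<in> ?E\<inverse>"
      then obtain Y Y' where Y: "(n, Y) \<in> R" "(Y, a) \<in> graph S c" "a \<in> elts S Y" "Y \<in> Univ S"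
        "(m, Y') \<in> R" "(Y', a) \<in> graph S c" "a \<in> elts S Y'" "Y' \<in> Univ S" by blast
      have n: "n \<in> nats S" "m \<in> nats S" using U Y by blast+
      have aU: "a \<in> Univ S" using Y eltsU by blast
      have "n \<notin> elts S m" using dec[OF n(2)] Y aU by blast
      moreover have "m \<notin> elts S n" using dec[OF n(1)] Y aU by blast
      ultimately show "n = m" using nats_linear n by blast
    qed
    show "Domain ?E = nats S"
    proof
      show "nats S \<subseteq> Domain ?E"
      proof
        fix n assume n: "n \<in> nats S"
        then obtain Y where Y: "(n, Y) \<in> R" using R(3) by blast
        then have "is_set S Y" "elts S Y \<subseteq> A" "elts S Y \<noteq> {}" "Y \<in> Univ S" using inv[OF n] U countable_empty by force+
        then show "n \<in> Domain ?E" using c(2) Y by blast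
      qed
    qed (use EA in blast)
    show "Range ?E \<subseteq> A - X" using EA by blast
  qed
qed

end

section \<open>The permutation model\<close>

text \<open>Variables at odd positions become parameters. Through this, a statement about
  \<open>B\<close> with parameters from \<open>B\<close> turns into one definable in
  \<open>V\<close>.\<close>

lemma dfb_param:
  assumes "dfb S X Q" "range c \<subseteq> insert (Atoms S) X" "X \<subseteq> Univ S" "Atoms S \<in> Univ S"
  shows "dfb S X (\<lambda>e. Q (mix e c))"
proof -
  obtain \<phi> d where d: "range d \<subseteq> insert (Atoms S) X"
      "\<And>e. range e \<subseteq> Univ S \<Longrightarrow> Q e = sat S (mix e d) \<phi>"
    using assms(1) by (auto simp: dfb_def)
  \<comment> \<open>On the odd positions the two sequences are interleaved again: \<open>c j\<close>
    ends at \<open>4 * j + 1\<close> and \<open>d j\<close> at \<open>4 * j + 3\<close>.\<close>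
  define f where "f i = (if even i then (if even (i div 2) then 2 * (i div 2 div 2) else 4 * (i div 2 div 2) + 1)
    else 4 * (i div 2) + 3)" for i :: nat
  have f: "mix (mix e c) d i = mix e (mix c d) (f i)" for e i
  proof -
    have "\<exists>j. i = 4 * j \<or> i = 4 * j + 1 \<or> i = 4 * j + 2 \<or> i = 4 * j + 3" by presburger
    then obtain j where "i = 4 * j \<or> i = 4 * j + 1 \<or> i = 4 * j + 2 \<or> i = 4 * j + 3" by blast
    moreover have "(4 * j + 1) div 2 = 2 * j" "(4 * j + 2) div 2 = 2 * j + 1" "(4 * j + 3) div 2 = 2 * j + 1"
      "(8 * j + 3) div 2 = 2 * (2 * j) + 1" "(7 + 8 * j) div 2 = 2 * (2 * j + 1) + 1" "(2 * j + 1) div 2 = j" by presburger+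
    ultimately show ?thesis by (elim disjE) (simp_all add: mix_def f_def)
  qed
  have U: "range c \<subseteq> Univ S" using assms(2-4) by auto
  show ?thesis unfolding dfb_def
  proof (intro exI[of _ "ren f \<phi>"] exI[of _ "mix c d"] conjI allI impI)
    show "range (mix c d) \<subseteq> insert (Atoms S) X" using assms(2) d(1) by (auto simp: mix_def)
    fix e :: "nat \<Rightarrow> 'a" assume e: "range e \<subseteq> Univ S"
    have "range (mix e c) \<subseteq> Univ S" using e U by (auto simp: mix_def)
    from d(2)[OF this] show "Q (mix e c) = sat S (mix e (mix c d)) (ren f \<phi>)"
      by (simp add: sat_ren f[symmetric])
  qed
qed

text \<open>The parameter sequence is external to \<open>S\<close> and may have infinite range, so a
  common countable support of its entries is not at hand. Finitely many supports can be united one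
  by one.\<close>

lemma dfb_finite_params:
  assumes "dfb S X Q"
  obtains F where "finite F" "F \<subseteq> X" "dfb S F Q"
proof -
  obtain \<phi> c where c: "range c \<subseteq> insert (Atoms S) X"
      "\<And>e. range e \<subseteq> Univ S \<Longrightarrow> Q e = sat S (mix e c) \<phi>"
    using assms by (auto simp: dfb_def)
  obtain k where k: "\<forall>e e'. (\<forall>i<k. e i = e' i) \<longrightarrow> sat S e \<phi> = sat S e' \<phi>"
    using sat_finite_support[of S \<phi>] by blast
  define c' where "c' i = (if i < k then c i else Atoms S)" for i
  have e: "sat S (mix e c') \<phi> = sat S (mix e c) \<phi>" for e
    by (rule k[rule_format]) (auto simp: mix_def c'_def)
  have "range c' \<subseteq> insert (Atoms S) (c ` {..<k} \<inter> X)" using c(1) by (auto simp: c'_def)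
  then have "dfb S (c ` {..<k} \<inter> X) Q" unfolding dfb_def using c(2) e by blast
  then show thesis by (rule that[rotated -1]) auto
qed

lemma sat_automorphism:
  assumes f: "bij_betw f (Univ S) (Univ S)" "\<And>x y. x \<in> Univ S \<Longrightarrow> y \<in> Univ S \<Longrightarrow> In S (f x) (f y) = In S x y"
    and "range e \<subseteq> Univ S"
  shows "sat S (\<lambda>i. f (e i)) \<phi> = sat S e \<phi>"
  using assms(3)
proof (induction \<phi> arbitrary: e)
  case (FMem i j)
  then show ?case using f(2) by (auto simp: image_subset_iff)
next
  case (FEq i j)
  then show ?case using f(1) by (auto simp: bij_betw_def inj_on_def image_subset_iff)
next
  case (FEx \<phi>)
  have c: "(case_nat (f x) (\<lambda>i. f (e i))) = (\<lambda>i. f (case_nat x e i))" for x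
    by (auto split: nat.split)
  have IH: "sat S (case_nat (f x) (\<lambda>i. f (e i))) \<phi> = sat S (case_nat x e) \<phi>" if "x \<in> Univ S" for x
    unfolding c by (rule FEx.IH) (use FEx.prems that in \<open>auto split: nat.split intro: subsetD[OF FEx.prems rangeI]\<close>)
  have "(\<exists>x\<in>Univ S. sat S (case_nat x (\<lambda>i. f (e i))) \<phi>) = (\<exists>x\<in>f ` Univ S. sat S (case_nat x (\<lambda>i. f (e i))) \<phi>)"
    using f(1) by (simp add: bij_betw_def)
  then show ?case using IH by simp
qed auto

section \<open>Hereditarily symmetric elements\<close>

locale perm_mod = zfa V for V :: "'a str"
begin

abbreviation B where "B \<equiv> perm_model V"

lemma B_simps: "Atoms B = Atoms V" "In B = In V"
  by (simp_all add: perm_model_def)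

lemma comp_perm:
  assumes "\<pi> \<in> Perms V" "\<rho> \<in> Perms V"
  obtains \<sigma> where "\<sigma> \<in> Perms V" "\<And>x. x \<in> Univ V \<Longrightarrow> ap \<sigma> x = ap \<rho> (ap \<pi> x)"
proof -
  note p = Perms_props[OF assms(1)] and r = Perms_props[OF assms(2)]
  let ?R = "graph V \<pi> O graph V \<rho>"
  have R: "isR ?R" by (intro isR_comp p r)
  have "single_valued (?R\<inverse>)" unfolding converse_relcomp by (intro single_valued_relcomp p r)
  moreover have "Domain ?R = Ats" "Range ?R = Ats" using p(4,5) r(4,5) by blast+
  ultimately have s: "rl ?R \<in> Perms V" using single_valued_relcomp[OF p(2) r(2)] R by (intro rl_Perms)
  show thesis by (rule that[OF s]) (rule ap_comp[OF assms s rl(4)[OF R]])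
qed

lemma fixp_inv:
  assumes p: "\<pi> \<in> fixp C" and C: "C \<subseteq> Univ V"
  shows "inv_perm \<pi> \<in> fixp C"
proof -
  have pP: "\<pi> \<in> Perms V" and f: "\<And>c. c \<in> C \<Longrightarrow> ap \<pi> c = c" using p by (auto simp: fixp_def)
  have "ap (inv_perm \<pi>) c = c" if "c \<in> C" for c
    using ap_inverse(1)[OF pP subsetD[OF C that]] f[OF that] by simp
  then show ?thesis using inv_perm(1)[OF pP] by (simp add: fixp_def)
qed

lemma fixp_mono: "C \<subseteq> D \<Longrightarrow> fixp D \<subseteq> fixp C"
  by (auto simp: fixp_def)

lemma fixpD: "\<pi> \<in> fixp C \<Longrightarrow> \<pi> \<in> Perms V"
  by (simp add: fixp_def)

lemma supp_mono: "supp C x \<Longrightarrow> C \<subseteq> D \<Longrightarrow> D \<subseteq> Ats \<Longrightarrow> countable_in V D \<Longrightarrow> supp D x"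
  using fixp_mono[of C D] unfolding supp_def by blast

lemma AtsU: "Ats \<subseteq> Univ V"
  using eltsU by blast

lemma supp_image:
  assumes s: "supp C x" and p: "\<pi> \<in> Perms V" and x: "x \<in> Univ V"
  shows "supp (ap \<pi> ` C) (ap \<pi> x)"
proof -
  have C: "C \<subseteq> Ats" "countable_in V C" using s by (auto simp: supp_def)
  have CU: "C \<subseteq> Univ V" using C AtsU by blast
  note pp = Perms_props[OF p]
  have 1: "ap \<pi> ` C \<subseteq> Ats" using C ap_atom(2)[OF p] by (auto simp: atom_def)
  have c: "isC (ap \<pi> ` C)" by (rule ap_mk(1)[OF p countable_isC[OF C(2)]])
  let ?R = "(graph V \<pi>)\<inverse> \<inter> (ap \<pi> ` C) \<times> UNIV"
  have g: "(a, b) \<in> graph V \<pi> \<longleftrightarrow> a \<in> Ats \<and> b = ap \<pi> a" for a b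
    using ap_atom(1)[OF p, of a b] pp(4) unfolding atom_def by blast
  have 2: "countable_in V (ap \<pi> ` C)"
  proof (rule countable_inj[OF C(2)])
    show "isR ?R" by (intro isR_restr isR_converse pp c)
    show "single_valued ?R" "single_valued (?R\<inverse>)"
      using pp(2,3) unfolding single_valued_def by blast+
    show "Domain ?R = ap \<pi> ` C" using g C(1) by auto
    show "Range ?R \<subseteq> C" using g C(1) ap_inj[OF p] AtsU by auto (metis subsetD)
  qed
  have "ap \<rho> (ap \<pi> x) = ap \<pi> x" if r: "\<rho> \<in> fixp (ap \<pi> ` C)" for \<rho>
  proof -
    have rP: "\<rho> \<in> Perms V" using fixpD[OF r] .
    obtain \<sigma> where \<sigma>: "\<sigma> \<in> Perms V" "\<And>x. x \<in> Univ V \<Longrightarrow> ap \<sigma> x = ap \<rho> (ap \<pi> x)" using comp_perm[OF p rP] by metis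
    obtain \<tau> where \<tau>: "\<tau> \<in> Perms V" "\<And>x. x \<in> Univ V \<Longrightarrow> ap \<tau> x = ap (inv_perm \<pi>) (ap \<sigma> x)"
      using comp_perm[OF \<sigma>(1) inv_perm(1)[OF p]] by metis
    have "\<tau> \<in> fixp C" using r \<tau> \<sigma>(2) CU ap_inverse(1)[OF p] unfolding fixp_def by auto
    then have "ap \<tau> x = x" using s by (auto simp: supp_def)
    then have "ap (inv_perm \<pi>) (ap \<rho> (ap \<pi> x)) = x" using \<tau>(2) \<sigma>(2) x by simp
    then show ?thesis using ap_inverse(2)[OF p] ap_U rP p x by metis
  qed
  then show ?thesis using 1 2 by (simp add: supp_def)
qed

lemma BU: "x \<in> Univ B \<Longrightarrow> x \<in> Univ V"
  by (simp add: perm_model_def)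

text \<open>The filter is a collection of classes of permutations. Passing to supports, which are
  sets of \<open>V\<close>, makes symmetry definable, and with it the class
  \<open>B\<close>.\<close>

lemma dfb_symmetric: "tm V (Univ V) t \<Longrightarrow> dfb V (Univ V) (\<lambda>e. symmetric V (t e))"
proof -
  assume t: "tm V (Univ V) t"
  have e: "symmetric V x \<longleftrightarrow> (\<exists>C\<in>Univ V. (\<forall>c\<in>elts V C. c \<in> Ats) \<and> countable_in V (elts V C) \<and>
     (\<forall>\<pi>\<in>Univ V. \<pi> \<in> Perms V \<longrightarrow> (\<forall>c\<in>elts V C. acts V \<pi> c c) \<longrightarrow> acts V \<pi> x x))" (is "_ \<longleftrightarrow> ?r") if x: "x \<in> Univ V" for x
  proof -
    have q: "(\<forall>\<pi>\<in>Univ V. \<pi> \<in> Perms V \<longrightarrow> (\<forall>c\<in>elts V C. acts V \<pi> c c) \<longrightarrow> acts V \<pi> x x) \<longleftrightarrow>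
       (\<forall>\<pi>\<in>fixp (elts V C). ap \<pi> x = x)" for C
      using acts_iff_ap[OF _ x] acts_iff_ap[OF _ eltsU] Perms_props(1) unfolding fixp_def by force
    show ?thesis unfolding symmetric_iff[OF x] q
    proof
      assume "\<exists>C. supp C x"
      then obtain C where C: "C \<subseteq> Ats" "countable_in V C" "\<forall>\<pi>\<in>fixp C. ap \<pi> x = x" by (auto simp: supp_def)
      show "\<exists>C\<in>Univ V. (\<forall>c\<in>elts V C. c \<in> Ats) \<and> countable_in V (elts V C) \<and> (\<forall>\<pi>\<in>fixp (elts V C). ap \<pi> x = x)"
        by (rule bexI[OF _ mk(3)[OF countable_isC[OF C(2)]]]) (use C in \<open>auto simp: mk(2)[OF countable_isC[OF C(2)]]\<close>)
    qed (auto simp: supp_def)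
  qed
  show ?thesis
    by (rule dfb_cong[OF _ e[OF tm_Univ[OF t subset_refl AtomsU]]],
      intro dfbs dfb_countable_in[OF subset_refl] eltsU' t)
qed

lemma dfb_B: "tm V (Univ V) t \<Longrightarrow> dfb V (Univ V) (\<lambda>e. t e \<in> Univ B)"
proof -
  assume t: "tm V (Univ V) t"
  have e: "x \<in> Univ B \<longleftrightarrow> (\<forall>y\<in>Univ V. (\<forall>T\<in>Univ V. is_set V T \<and> x \<in> elts V T \<and>
      (\<forall>u\<in>elts V T. \<forall>w\<in>elts V u. w \<in> elts V T) \<longrightarrow> y \<in> elts V T) \<longrightarrow> symmetric V y)" if "x \<in> Univ V" for x
    using that by (auto simp: perm_model_def trcl_sing_def subset_iff Ball_def is_set_def)
  show ?thesis
    by (rule dfb_cong[OF _ e[OF tm_Univ[OF t subset_refl AtomsU]]], intro dfbs dfb_symmetric t)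
qed

lemma B_trans: "x \<in> Univ B \<Longrightarrow> y \<in> elts V x \<Longrightarrow> y \<in> Univ B"
  unfolding perm_model_def trcl_sing_def by (auto dest: eltsU)

lemma B_sym: "x \<in> Univ B \<Longrightarrow> \<exists>C. supp C x"
proof -
  assume x: "x \<in> Univ B"
  then have "x \<in> trcl_sing V x" by (auto simp: trcl_sing_def perm_model_def)
  then show ?thesis using x symmetric_iff[OF BU[OF x]] by (auto simp: perm_model_def)
qed

text \<open>\<open>trcl_sing\<close> is an intersection of transitive sets. A transitive set
  containing \<open>x\<close> remains transitive when cut down to \<open>x\<close> and the members
  of \<open>B\<close>, because \<open>B\<close> is transitive and contains all elements of
  \<open>x\<close>.\<close>

lemma B_intro:
  assumes x: "x \<in> Univ V" and s: "supp C x" and e: "elts V x \<subseteq> Univ B"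
  shows "x \<in> Univ B"
proof -
  obtain K where K: "isC K" "x \<in> K" "\<And>y. y \<in> K \<Longrightarrow> elts V y \<subseteq> K" by (rule ex_transitive[OF x]) blast
  have T: "isC {y \<in> K. y = x \<or> y \<in> Univ B}" by (intro isC_sep K dfbs dfb_B x)
  let ?T = "mk {y \<in> K. y = x \<or> y \<in> Univ B}"
  have "trcl_sing V x \<subseteq> elts V ?T"
  proof -
    have "is_set V ?T \<and> x \<in> elts V ?T \<and> (\<forall>u\<in>elts V ?T. elts V u \<subseteq> elts V ?T)"
      unfolding mk(2)[OF T] using mk(1)[OF T] K(2,3) e B_trans by blast
    then show ?thesis by (auto simp: trcl_sing_def)
  qed
  then have "trcl_sing V x \<subseteq> insert x (Univ B)" unfolding mk(2)[OF T] by blast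
  moreover have "symmetric V y" if "y \<in> Univ B" for y using B_sym[OF that] symmetric_iff[OF BU[OF that]] by blast
  moreover have "symmetric V x" using s symmetric_iff[OF x] by blast
  ultimately show ?thesis using x by (auto simp: perm_model_def)
qed

lemma ap_B: 
  assumes p: "\<pi> \<in> Perms V" and x: "x \<in> Univ B" shows "ap \<pi> x \<in> Univ B"
proof -
  have "x \<in> Univ B \<longrightarrow> (\<exists>y\<in>Univ V. acts V \<pi> x y \<and> y \<in> Univ B)"
  proof (rule mem_induct[OF _ _ BU[OF x]])
    show "dfb V (Univ V) (\<lambda>e. e 0 \<in> Univ B \<longrightarrow> (\<exists>y\<in>Univ V. acts V \<pi> (e 0) y \<and> y \<in> Univ B))"
      by (intro dfbs dfb_B Perms_props p)
    fix x assume xU: "x \<in> Univ V" and IH0: "\<And>y. y \<in> elts V x \<Longrightarrow> y \<in> Univ B \<longrightarrow> (\<exists>z\<in>Univ V. acts V \<pi> y z \<and> z \<in> Univ B)"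
    have IH: "ap \<pi> y \<in> Univ B" if "y \<in> elts V x" "y \<in> Univ B" for y
      using IH0[OF that(1)] that(2) acts_iff_ap[OF p eltsU[OF that(1)]] by auto
    have "ap \<pi> x \<in> Univ B" if xB: "x \<in> Univ B"
    proof -
      obtain C where "supp C x" using B_sym[OF xB] by blast
      then have "supp (ap \<pi> ` C) (ap \<pi> x)" by (intro supp_image p xU)
      moreover have "elts V (ap \<pi> x) \<subseteq> Univ B"
      proof (cases "atom V x")
        case True
        then show ?thesis using atom_empty[OF ap_atom(2)[OF p True]] by simp
      next
        case False
        then have "is_set V x" using xU by (simp add: is_set_def)
        then show ?thesis using ap_set(2)[OF p] IH B_trans[OF xB] by auto
      qed
      ultimately show ?thesis using B_intro ap_U p xU by blast
    qed
    then show "x \<in> Univ B \<longrightarrow> (\<exists>y\<in>Univ V. acts V \<pi> x y \<and> y \<in> Univ B)"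
      using acts_iff_ap[OF p xU] ap_U[OF p xU] by blast
  qed
  then obtain y where "acts V \<pi> x y" "y \<in> Univ B" using x by blast
  then show ?thesis using acts_iff_ap[OF p BU[OF x]] by simp
qed

lemma B_mk:
  assumes K: "isC K" "K \<subseteq> Univ B" and C: "C \<subseteq> Ats" "countable_in V C"
    and inv: "\<And>\<pi> y. \<pi> \<in> fixp C \<Longrightarrow> y \<in> K \<Longrightarrow> ap \<pi> y \<in> K"
  shows "mk K \<in> Univ B" "supp C (mk K)"
proof -
  have CU: "C \<subseteq> Univ V" using C AtsU by blast
  have "ap \<pi> (mk K) = mk K" if p: "\<pi> \<in> fixp C" for \<pi>
  proof -
    \<comment> \<open>Invariance under the inverse permutation turns the assumed inclusion into an
      equality.\<close>
    have "K \<subseteq> ap \<pi> ` K"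
    proof
      fix y assume y: "y \<in> K"
      then have "ap (inv_perm \<pi>) y \<in> K" using inv fixp_inv[OF p CU] by blast
      then show "y \<in> ap \<pi> ` K" using ap_inverse(2)[OF fixpD[OF p], of y] y K(2) BU by (metis imageI subsetD)
    qed
    then have "ap \<pi> ` K = K" using inv[OF p] by blast
    then show ?thesis using ap_mk(2)[OF fixpD[OF p] K(1)] by simp
  qed
  then show s: "supp C (mk K)" using C by (simp add: supp_def)
  show "mk K \<in> Univ B" by (rule B_intro[OF mk(3)[OF K(1)] s]) (simp add: mk(2)[OF K(1)] K(2))
qed

lemma elts_B: "elts B x = elts V x \<inter> Univ B"
  by (auto simp: elts_def B_simps perm_model_def)

lemma elts_B_eq: "x \<in> Univ B \<Longrightarrow> elts B x = elts V x"
  using B_trans elts_B by blast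

lemma atom_inB: "atom V a \<Longrightarrow> a \<in> Univ B"
proof (rule B_intro)
  assume a: "atom V a"
  then show "a \<in> Univ V" using atomU by blast
  then show "supp {a} a" using a countable_sing by (auto simp: supp_def fixp_def atom_def)
  show "elts V a \<subseteq> Univ B" using atom_empty[OF a] by simp
qed

lemma Atoms_inB: "Atoms V \<in> Univ B"
  using atom_inB countable_empty ap_Atoms AtomsU
  by (intro B_intro[where C="{}"]) (auto simp: supp_def fixp_def atom_def)

lemma elts_B_Atoms: "elts B (Atoms V) = Ats"
  using elts_B_eq Atoms_inB by blast

lemma atom_B: "atom B x \<longleftrightarrow> atom V x"
  by (simp add: atom_def B_simps elts_B_Atoms)

lemma is_set_B: "is_set B x \<longleftrightarrow> x \<in> Univ B \<and> is_set V x"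
  using BU by (auto simp: is_set_def atom_B)

lemma bij_ap: assumes p: "\<pi> \<in> Perms V" shows "bij_betw (ap \<pi>) (Univ B) (Univ B)"
proof (rule bij_betw_byWitness[where f'="ap (inv_perm \<pi>)"])
  show "ap \<pi> ` Univ B \<subseteq> Univ B" using ap_B[OF p] by blast
  show "ap (inv_perm \<pi>) ` Univ B \<subseteq> Univ B" using ap_B[OF inv_perm(1)[OF p]] by blast
qed (use ap_inverse[OF p] BU in auto)

lemma In_ap: "\<pi> \<in> Perms V \<Longrightarrow> x \<in> Univ B \<Longrightarrow> y \<in> Univ B \<Longrightarrow> In B (ap \<pi> x) (ap \<pi> y) = In B x y"
  using ap_mem[of \<pi> y x] ap_U[of \<pi> x] BU by (simp add: elts_def B_simps)

text \<open>Relativization of quantifiers to the definable class \<open>B\<close>.\<close>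

lemma dfb_sat_B: "dfb V (Univ V) (\<lambda>e. sat B e \<phi>)"
proof (induction \<phi>)
  case (FEx \<phi>)
  have c: "case_nat (e 0) (\<lambda>i. e (Suc i)) = e" for e :: "nat \<Rightarrow> 'a"
    by (auto simp: fun_eq_iff split: nat.split)
  have "dfb V (Univ V) (\<lambda>e. \<exists>x\<in>Univ V. x \<in> Univ B \<and> sat B (case_nat x e) \<phi>)"
    by (intro dfb_ex dfb_conj dfb_B tm_intros) (simp add: c FEx)
  then show ?case by (rule dfb_cong) (use BU in auto)
qed (auto simp: B_simps intro!: dfb_mem dfb_eq dfb_not dfb_conj tm_intros)

lemma dfb_B_V:
  assumes "dfb B (Univ B) Q"
  obtains Q' where "dfb V (Univ V) Q'" "\<And>e. range e \<subseteq> Univ B \<Longrightarrow> Q e = Q' e"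
proof -
  obtain \<phi> c where c: "range c \<subseteq> insert (Atoms B) (Univ B)"
      "\<And>e. range e \<subseteq> Univ B \<Longrightarrow> Q e = sat B (mix e c) \<phi>"
    using assms by (auto simp: dfb_def)
  have "range c \<subseteq> insert (Atoms V) (Univ V)" using c(1) BU by (auto simp: B_simps)
  from dfb_param[OF dfb_sat_B this subset_refl AtomsU] show thesis using c(2) that by blast
qed

text \<open>A permutation induces an automorphism of the structure \<open>B\<close>. For the forcing
  relation, which is definable from no parameters, this is the symmetry lemma of forcing.\<close>

lemma dfb_invariant:
  assumes "dfb B X Q" and X: "X \<subseteq> Univ B" and p: "\<pi> \<in> Perms V" "\<And>x. x \<in> X \<Longrightarrow> ap \<pi> x = x" and e: "range e \<subseteq> Univ B"
  shows "Q (\<lambda>i. ap \<pi> (e i)) = Q e"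
proof -
  obtain \<phi> c where c: "range c \<subseteq> insert (Atoms B) X"
      "\<And>e. range e \<subseteq> Univ B \<Longrightarrow> Q e = sat B (mix e c) \<phi>"
    using assms(1) by (auto simp: dfb_def)
  have cf: "ap \<pi> (c i) = c i" for i
  proof -
    have "c i = Atoms V \<or> c i \<in> X" using c(1) by (auto simp: B_simps)
    then show ?thesis using p ap_Atoms[OF p(1)] by metis
  qed
  have m: "mix (\<lambda>i. ap \<pi> (e i)) c = (\<lambda>i. ap \<pi> (mix e c i))" using cf by (auto simp: mix_def)
  have "range c \<subseteq> Univ B" using c(1) X Atoms_inB by (auto simp: B_simps)
  then have U: "range (mix e c) \<subseteq> Univ B" using e by (auto simp: mix_def)
  have "range (\<lambda>i. ap \<pi> (e i)) \<subseteq> Univ B" using e ap_B[OF p(1)] by auto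
  then have "Q (\<lambda>i. ap \<pi> (e i)) = sat B (\<lambda>i. ap \<pi> (mix e c i)) \<phi>" using c(2) m by simp
  also have "\<dots> = sat B (mix e c) \<phi>" by (rule sat_automorphism[OF bij_ap[OF p(1)] In_ap[OF p(1)] U])
  finally show ?thesis using c(2)[OF e] by simp
qed

section \<open>Zermelo set theory in the permutation model\<close>

lemma supp_finite:
  assumes "finite F" "F \<subseteq> Univ B"
  obtains C where "C \<subseteq> Ats" "countable_in V C" "\<And>x. x \<in> F \<Longrightarrow> supp C x"
proof -
  have "\<exists>C. C \<subseteq> Ats \<and> countable_in V C \<and> (\<forall>x\<in>F. supp C x)" using assms
  proof (induction F)
    case empty
    then show ?case using countable_empty by auto
  next
    case (insert x F)
    then obtain C where C: "C \<subseteq> Ats" "countable_in V C" "\<forall>x\<in>F. supp C x" by auto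
    obtain D where D: "supp D x" using B_sym insert by blast
    then have D': "D \<subseteq> Ats" "countable_in V D" by (auto simp: supp_def)
    have U: "C \<union> D \<subseteq> Ats" "countable_in V (C \<union> D)" using C D' countable_Un by auto
    then show ?case using supp_mono[OF D, of "C \<union> D"] supp_mono[of C _ "C \<union> D"] C(3)
      by (intro exI[of _ "C \<union> D"]) auto
  qed
  then show thesis using that by blast
qed

text \<open>Separation in \<open>V\<close> applies to the relativized formula. The supports of
  \<open>x\<close> and of the finitely many parameters together support the resulting set.\<close>

lemma B_separation:
  assumes d: "dfb B (Univ B) (\<lambda>e. Q (e 0))" and x: "x \<in> Univ B"
  shows "isC {y \<in> elts V x. Q y}" "mk {y \<in> elts V x. Q y} \<in> Univ B"
proof -
  obtain Q' where Q': "dfb V (Univ V) Q'" "\<And>e. range e \<subseteq> Univ B \<Longrightarrow> Q (e 0) = Q' e" by (rule dfb_B_V[OF d]) blast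
  have q: "Q y = Q' (\<lambda>_. y)" if "y \<in> Univ B" for y using Q'(2)[of "\<lambda>_. y"] that by auto
  have "dfb V (Univ V) (\<lambda>e. Q' (\<lambda>_. e 0))" using dfb_reindex[OF Q'(1), of "\<lambda>_. 0"] .
  then have "isC {y \<in> elts V x. Q' (\<lambda>_. y)}" by (intro isC_sep isC_elts BU x)
  moreover have "{y \<in> elts V x. Q' (\<lambda>_. y)} = {y \<in> elts V x. Q y}" using q B_trans[OF x] by auto
  ultimately show i: "isC {y \<in> elts V x. Q y}" by simp
  obtain F where F: "finite F" "F \<subseteq> Univ B" "dfb B F (\<lambda>e. Q (e 0))" by (rule dfb_finite_params[OF d])
  obtain C where C: "C \<subseteq> Ats" "countable_in V C" "\<And>y. y \<in> insert x F \<Longrightarrow> supp C y"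
    using supp_finite[of "insert x F"] F x by auto
  have px: "ap \<pi> y = y" if "\<pi> \<in> fixp C" "y \<in> insert x F" for \<pi> y using C(3) that by (auto simp: supp_def)
  show "mk {y \<in> elts V x. Q y} \<in> Univ B"
  proof (rule B_mk[OF i _ C(1,2)])
    show "{y \<in> elts V x. Q y} \<subseteq> Univ B" using B_trans[OF x] by auto
    fix \<pi> y assume p: "\<pi> \<in> fixp C" and y: "y \<in> {y \<in> elts V x. Q y}"
    have yB: "y \<in> Univ B" using y B_trans[OF x] by blast
    have "ap \<pi> y \<in> elts V (ap \<pi> x)" using ap_mem[OF fixpD[OF p] BU[OF x] BU[OF yB]] y by blast
    moreover have "Q (ap \<pi> y) = Q y"
      using dfb_invariant[OF F(3,2) fixpD[OF p], of "\<lambda>_. y"] px[OF p] yB by auto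
    ultimately show "ap \<pi> y \<in> {y \<in> elts V x. Q y}" using px[OF p, of x] y by simp
  qed
qed

lemma B_set: "isC K \<Longrightarrow> mk K \<in> Univ B \<Longrightarrow> is_set B (mk K) \<and> elts B (mk K) = K"
  using mk elts_B_eq by (simp add: is_set_B)

lemma emp_inB: "emp \<in> Univ B"
  unfolding emp_def by (rule B_mk[OF isC_empty _ _ countable_empty]) auto

lemma zermelo_B: "zermelo B"
proof unfold_locales
  show "Atoms B \<in> Univ B" using Atoms_inB by (simp add: B_simps)
  show "elts B a = {}" if "atom B a" for a using that atom_empty by (simp add: atom_B elts_B)
  show "\<exists>z. is_zero B z" using B_set[OF isC_empty] emp_inB by (auto simp: is_zero_def emp_def)
  show "x = y" if "is_set B x" "is_set B y" "elts B x = elts B y" for x y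
    using that extens elts_B_eq by (metis is_set_B)
  show "\<exists>z. is_upair B z x y" if xy: "x \<in> Univ B" "y \<in> Univ B" for x y
  proof -
    obtain C where C: "C \<subseteq> Ats" "countable_in V C" "\<And>z. z \<in> {x, y} \<Longrightarrow> supp C z"
      using supp_finite[of "{x, y}"] xy by auto
    have i: "isC {x, y}" using xy BU by (intro isC_upair)
    have "mk {x, y} \<in> Univ B"
      by (rule B_mk[OF i _ C(1,2)]) (use xy C(3) in \<open>auto simp: supp_def\<close>)
    then show ?thesis using B_set[OF i] by (auto simp: is_upair_def)
  qed
  show "\<exists>u. is_set B u \<and> elts B u = (\<Union>y\<in>elts B x. elts B y)" if x: "is_set B x" for x
  proof -
    have xB: "x \<in> Univ B" "is_set V x" using x by (auto simp: is_set_B)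
    have e: "(\<Union>y\<in>elts B x. elts B y) = (\<Union>y\<in>elts V x. elts V y)" (is "_ = ?K")
      using elts_B_eq B_trans xB(1) by auto
    have i: "isC ?K" by (intro isC_UN_elts isC_elts BU xB)
    obtain C where C: "supp C x" using B_sym xB by blast
    then have C': "C \<subseteq> Ats" "countable_in V C" by (auto simp: supp_def)
    have "mk ?K \<in> Univ B"
    proof (rule B_mk[OF i _ C'])
      show "?K \<subseteq> Univ B" using B_trans xB by blast
      fix \<pi> z assume p: "\<pi> \<in> fixp C" and "z \<in> ?K"
      then obtain y where y: "y \<in> elts V x" "z \<in> elts V y" by blast
      have "ap \<pi> y \<in> elts V (ap \<pi> x)" using y ap_mem[OF fixpD[OF p]] eltsU BU xB by blast
      moreover have "ap \<pi> z \<in> elts V (ap \<pi> y)" using y ap_mem[OF fixpD[OF p]] eltsU by blast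
      moreover have "ap \<pi> x = x" using C p by (auto simp: supp_def)
      ultimately show "ap \<pi> z \<in> ?K" by auto
    qed
    then show ?thesis unfolding e using B_set[OF i] by blast
  qed
  show "\<exists>u. is_set B u \<and> elts B u = {y. is_set B y \<and> elts B y \<subseteq> elts B x}" if x: "is_set B x" for x
  proof -
    have xB: "x \<in> Univ B" "is_set V x" using x by (auto simp: is_set_B)
    \<comment> \<open>The power set in \<open>B\<close> is that of \<open>V\<close> cut down to the
      definable class \<open>B\<close>.\<close>
    let ?K = "{y \<in> {y. is_set V y \<and> elts V y \<subseteq> elts V x}. y \<in> Univ B}"
    have e: "{y. is_set B y \<and> elts B y \<subseteq> elts B x} = ?K"
      using elts_B_eq xB by (auto simp: is_set_B)
    have i: "isC ?K" by (intro isC_sep isC_Pow isC_elts BU xB dfb_B tm_intros)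
    obtain C where C: "supp C x" using B_sym xB by blast
    then have C': "C \<subseteq> Ats" "countable_in V C" by (auto simp: supp_def)
    have "mk ?K \<in> Univ B"
    proof (rule B_mk[OF i _ C'])
      show "?K \<subseteq> Univ B" by blast
      fix \<pi> y assume p: "\<pi> \<in> fixp C" and y: "y \<in> ?K"
      have pP: "\<pi> \<in> Perms V" by (rule fixpD[OF p])
      have "ap \<pi> x = x" using C p by (auto simp: supp_def)
      then have "ap \<pi> ` elts V x = elts V x" using ap_set(2)[OF pP xB(2)] by simp
      moreover have "ap \<pi> ` elts V y \<subseteq> ap \<pi> ` elts V x" using y by (intro image_mono) simp
      ultimately show "ap \<pi> y \<in> ?K" using y ap_set[OF pP, of y] ap_B[OF pP] by simp
    qed
    then show ?thesis unfolding e using B_set[OF i] by blast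
  qed
  fix Q x assume d: "dfb B (Univ B) (\<lambda>e. Q (e 0))" and x: "is_set B x"
  then have xB: "x \<in> Univ B" by (auto simp: is_set_B)
  show "\<exists>u. is_set B u \<and> elts B u = {y \<in> elts B x. Q y}"
    using B_set[OF B_separation[OF d xB]] elts_B_eq[OF xB] by auto
qed

sublocale B: zermelo B
  by (rule zermelo_B)

end

section \<open>Forcing\<close>

text \<open>Conditions form a set, while \<open>le\<close> is a definable relation. Definability is
  assumed over every parameter set: over \<open>Univ S\<close> for separation, over
  \<open>{}\<close> for invariance under automorphisms.\<close>

locale forcing = zermelo S for S :: "'a str" +
  fixes P :: "'a set" and le :: "'a \<Rightarrow> 'a \<Rightarrow> bool" and G :: "'a set"
  assumes PC: "isC P"
    and dP: "\<And>X t. X \<subseteq> Univ S \<Longrightarrow> tm S X t \<Longrightarrow> dfb S X (\<lambda>e. t e \<in> P)"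
    and dle: "\<And>X t u. X \<subseteq> Univ S \<Longrightarrow> tm S X t \<Longrightarrow> tm S X u \<Longrightarrow> dfb S X (\<lambda>e. le (t e) (u e))"
    and le_refl: "\<And>p. p \<in> P \<Longrightarrow> le p p"
    and le_trans: "\<And>p q r. p \<in> P \<Longrightarrow> q \<in> P \<Longrightarrow> r \<in> P \<Longrightarrow> le p q \<Longrightarrow> le q r \<Longrightarrow> le p r"
    and G: "generic_filter S P le G"
begin

lemma PU: "P \<subseteq> Univ S"
  by (rule isC_sub_Univ[OF PC])

lemmas dPU = dP[OF subset_refl]
lemmas dleU = dle[OF subset_refl]
lemmas dfeU = dfb_forces_eq[OF subset_refl PU dPU dleU]
lemmas dstepU = dfb_forces_eq_step[OF subset_refl PU dPU dleU]
lemmas dbexP = dfb_bexK[OF subset_refl, of "\<lambda>_. P", OF PU]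
lemmas dballP = dfb_ballK[OF subset_refl, of "\<lambda>_. P", OF PU]
lemmas dgrU = dfb_ball_graph[OF subset_refl] dfb_bex_graph[OF subset_refl]

definition nc :: "'a set \<Rightarrow> bool" where
  "nc N \<longleftrightarrow> isC N \<and> (\<forall>x\<in>N. is_set S x \<longrightarrow> (\<forall>z\<in>elts S x. \<exists>\<sigma>\<in>N. \<exists>p\<in>P. z = pr \<sigma> p))"

lemma nc_U: "nc N \<Longrightarrow> N \<subseteq> Univ S"
  using isC_sub_Univ by (simp add: nc_def)

lemma name_closed_iff: "name_closed S P n \<longleftrightarrow> is_set S n \<and> nc (elts S n)"
proof -
  have "is_opair S z \<sigma> p \<longleftrightarrow> z = pr \<sigma> p" if "\<sigma> \<in> elts S n" "p \<in> P" for z \<sigma> p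
    using that eltsU PU by (auto simp: is_opair_iff)
  then have "(\<exists>\<sigma>\<in>elts S n. \<exists>p\<in>P. is_opair S z \<sigma> p) \<longleftrightarrow> (\<exists>\<sigma>\<in>elts S n. \<exists>p\<in>P. z = pr \<sigma> p)" for z by blast
  then show ?thesis using isC_elts is_setU by (auto simp: name_closed_def nc_def)
qed

lemma nc_mk: "nc N \<Longrightarrow> name_closed S P (mk N) \<and> elts S (mk N) = N"
  using mk by (simp add: name_closed_iff nc_def)

lemma names_iff: "\<tau> \<in> names S P \<longleftrightarrow> (\<exists>N. nc N \<and> \<tau> \<in> N)"
  unfolding names_def mem_Collect_eq using nc_mk name_closed_iff by metis

lemma nc_graph:
  assumes "nc N" "x \<in> N" "(\<sigma>, p) \<in> graph S x"
  shows "\<sigma> \<in> N" "p \<in> P"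
proof -
  have g: "\<sigma> \<in> Univ S" "p \<in> Univ S" "pr \<sigma> p \<in> elts S x" using assms(3) by (auto simp: graph_iff)
  then have "is_set S x" using atom_empty set_or_atom nc_U[OF assms(1)] assms(2) by blast
  then obtain \<sigma>' p' where *: "\<sigma>' \<in> N" "p' \<in> P" "pr \<sigma> p = pr \<sigma>' p'" using assms(1,2) g(3) unfolding nc_def by blast
  then have "\<sigma> = \<sigma>' \<and> p = p'" using pr_inject[OF g(1,2)] nc_U[OF assms(1)] PU by blast
  then show "\<sigma> \<in> N" "p \<in> P" using * by auto
qed

lemma nc_Un: "nc N \<Longrightarrow> nc M \<Longrightarrow> nc (N \<union> M)"
  unfolding nc_def using isC_Un by blast

lemma names2:
  assumes "\<sigma> \<in> names S P" "\<tau> \<in> names S P"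
  obtains N where "nc N" "\<sigma> \<in> N" "\<tau> \<in> N"
  using assms nc_Un unfolding names_iff by blast

lemma names_U: "\<tau> \<in> names S P \<Longrightarrow> \<tau> \<in> Univ S"
  using nc_U by (auto simp: names_iff)

lemma names_graph:
  assumes "\<tau> \<in> names S P" "(\<sigma>, p) \<in> graph S \<tau>"
  shows "\<sigma> \<in> names S P" "p \<in> P"
  using assms nc_graph unfolding names_iff by blast+

abbreviation stp where "stp \<equiv> forces_eq_step S P le"

lemma stp_unfold: "stp R p \<sigma> \<tau> \<longleftrightarrow> (if atom S \<sigma> \<or> atom S \<tau> then \<sigma> = \<tau>
      else
        (\<forall>\<sigma>' s. (\<sigma>', s) \<in> graph S \<sigma> \<longrightarrow> (\<forall>q\<in>P. le q p \<longrightarrow> le q s \<longrightarrow>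
           (\<exists>r\<in>P. le r q \<and> (\<exists>\<tau>' u. (\<tau>', u) \<in> graph S \<tau> \<and> le r u \<and> R r \<sigma>' \<tau>')))) \<and>
        (\<forall>\<tau>' u. (\<tau>', u) \<in> graph S \<tau> \<longrightarrow> (\<forall>q\<in>P. le q p \<longrightarrow> le q u \<longrightarrow>
           (\<exists>r\<in>P. le r q \<and> (\<exists>\<sigma>' s. (\<sigma>', s) \<in> graph S \<sigma> \<and> le r s \<and> R r \<sigma>' \<tau>')))))"
  unfolding forces_eq_step_def Ball_def Bex_def split_paired_All split_paired_Ex prod.case by (rule refl)

lemma stp_D:
  assumes "stp R p \<sigma> \<tau>" "\<not> atom S \<sigma>" "\<not> atom S \<tau>"
  shows "(\<sigma>', s) \<in> graph S \<sigma> \<Longrightarrow> q \<in> P \<Longrightarrow> le q p \<Longrightarrow> le q s \<Longrightarrow>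
     \<exists>r\<in>P. le r q \<and> (\<exists>\<tau>' u. (\<tau>', u) \<in> graph S \<tau> \<and> le r u \<and> R r \<sigma>' \<tau>')"
    "(\<tau>', u) \<in> graph S \<tau> \<Longrightarrow> q \<in> P \<Longrightarrow> le q p \<Longrightarrow> le q u \<Longrightarrow>
     \<exists>r\<in>P. le r q \<and> (\<exists>\<sigma>' s. (\<sigma>', s) \<in> graph S \<sigma> \<and> le r s \<and> R r \<sigma>' \<tau>')"
proof -
  have n: "\<not> (atom S \<sigma> \<or> atom S \<tau>)" using assms by blast
  note u = assms(1)[unfolded stp_unfold if_not_P[OF n]]
  show "(\<sigma>', s) \<in> graph S \<sigma> \<Longrightarrow> q \<in> P \<Longrightarrow> le q p \<Longrightarrow> le q s \<Longrightarrow>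
     \<exists>r\<in>P. le r q \<and> (\<exists>\<tau>' u. (\<tau>', u) \<in> graph S \<tau> \<and> le r u \<and> R r \<sigma>' \<tau>')"
    using conjunct1[OF u] by blast
  show "(\<tau>', u) \<in> graph S \<tau> \<Longrightarrow> q \<in> P \<Longrightarrow> le q p \<Longrightarrow> le q u \<Longrightarrow>
     \<exists>r\<in>P. le r q \<and> (\<exists>\<sigma>' s. (\<sigma>', s) \<in> graph S \<sigma> \<and> le r s \<and> R r \<sigma>' \<tau>')"
    using conjunct2[OF u] by blast
qed

lemma stp_atom: "stp R p \<sigma> \<tau> \<Longrightarrow> atom S \<sigma> \<or> atom S \<tau> \<Longrightarrow> \<sigma> = \<tau>"
  unfolding stp_unfold by (simp split: if_splits)

lemma stp_I:
  assumes "atom S \<sigma> \<or> atom S \<tau> \<Longrightarrow> \<sigma> = \<tau>"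
    and "\<And>\<sigma>' s q. \<not> atom S \<sigma> \<Longrightarrow> \<not> atom S \<tau> \<Longrightarrow> (\<sigma>', s) \<in> graph S \<sigma> \<Longrightarrow> q \<in> P \<Longrightarrow> le q p \<Longrightarrow> le q s \<Longrightarrow>
     \<exists>r\<in>P. le r q \<and> (\<exists>\<tau>' u. (\<tau>', u) \<in> graph S \<tau> \<and> le r u \<and> R r \<sigma>' \<tau>')"
    and "\<And>\<tau>' u q. \<not> atom S \<sigma> \<Longrightarrow> \<not> atom S \<tau> \<Longrightarrow> (\<tau>', u) \<in> graph S \<tau> \<Longrightarrow> q \<in> P \<Longrightarrow> le q p \<Longrightarrow> le q u \<Longrightarrow>
     \<exists>r\<in>P. le r q \<and> (\<exists>\<sigma>' s. (\<sigma>', s) \<in> graph S \<sigma> \<and> le r s \<and> R r \<sigma>' \<tau>')"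
  shows "stp R p \<sigma> \<tau>"
proof (cases "atom S \<sigma> \<or> atom S \<tau>")
  case True
  then show ?thesis using assms(1) unfolding stp_unfold by simp
next
  case False
  then have n: "\<not> atom S \<sigma>" "\<not> atom S \<tau>" by auto
  show ?thesis unfolding stp_unfold if_not_P[OF False]
    by (intro conjI allI impI ballI assms(2)[OF n] assms(3)[OF n]; assumption)
qed

text \<open>The hypothesis concerns only entries of the two graphs, so the relations need only be
  compared on names below \<open>\<sigma>\<close> and \<open>\<tau>\<close>.\<close>

lemma stp_mono:
  assumes s: "stp R p \<sigma> \<tau>"
    and m: "\<And>r \<sigma>' s \<tau>' u. (\<sigma>', s) \<in> graph S \<sigma> \<Longrightarrow> (\<tau>', u) \<in> graph S \<tau> \<Longrightarrow> r \<in> P \<Longrightarrow> R r \<sigma>' \<tau>' \<Longrightarrow> R' r \<sigma>' \<tau>'"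
  shows "stp R' p \<sigma> \<tau>"
proof (rule stp_I)
  show "atom S \<sigma> \<or> atom S \<tau> \<Longrightarrow> \<sigma> = \<tau>" by (rule stp_atom[OF s])
  show "\<exists>r\<in>P. le r q \<and> (\<exists>\<tau>' u. (\<tau>', u) \<in> graph S \<tau> \<and> le r u \<and> R' r \<sigma>' \<tau>')"
    if na: "\<not> atom S \<sigma>" "\<not> atom S \<tau>" and g: "(\<sigma>', w) \<in> graph S \<sigma>" "q \<in> P" "le q p" "le q w" for \<sigma>' w q
    using stp_D(1)[OF s na g] m[OF g(1)] by blast
  show "\<exists>r\<in>P. le r q \<and> (\<exists>\<sigma>' s. (\<sigma>', s) \<in> graph S \<sigma> \<and> le r s \<and> R' r \<sigma>' \<tau>')"
    if na: "\<not> atom S \<sigma>" "\<not> atom S \<tau>" and g: "(\<tau>', w) \<in> graph S \<tau>" "q \<in> P" "le q p" "le q w" for \<tau>' w q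
    using stp_D(2)[OF s na g] m[OF _ g(1)] by blast
qed

section \<open>Forced equality as a greatest fixed point\<close>

definition isT :: "('a \<Rightarrow> 'a \<Rightarrow> 'a \<Rightarrow> bool) \<Rightarrow> bool" where
  "isT T \<longleftrightarrow> (\<exists>R\<in>Univ S. triple_in S R = T)"

lemma triple_in_iff: "triple_in S R p \<sigma> \<tau> \<longleftrightarrow> \<sigma> \<in> Univ S \<and> \<tau> \<in> Univ S \<and> (p, pr \<sigma> \<tau>) \<in> graph S R"
  by (auto simp: triple_in_def is_opair_iff)

lemma isT_dfb:
  assumes N: "isC N" and T: "\<And>p \<sigma> \<tau>. T p \<sigma> \<tau> \<Longrightarrow> p \<in> P \<and> \<sigma> \<in> N \<and> \<tau> \<in> N"
    and d: "dfb S (Univ S) (\<lambda>e. T (e 0) (e 1) (e 2))"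
  shows "isT T"
proof -
  have NU: "N \<subseteq> Univ S" by (rule isC_sub_Univ[OF N])
  let ?R = "{(p, w). \<exists>\<sigma>\<in>Univ S. \<exists>\<tau>\<in>Univ S. is_opair S w \<sigma> \<tau> \<and> T p \<sigma> \<tau>}"
  have "isR ?R"
  proof (rule isR_dfb[OF PC isC_prod[OF N N]])
    show "?R \<subseteq> P \<times> prs (N \<times> N)" using T unfolding prs_def is_opair_iff by blast
    have "dfb S (Univ S) (\<lambda>e. T (e 2) (e 1) (e 0))"
      using dfb_reindex[OF d, of "\<lambda>i. if i = 0 then 2 else if i = 1 then 1 else 0"] by simp
    then show "dfb S (Univ S) (\<lambda>e. (e 0, e 1) \<in> ?R)" unfolding mem_Collect_eq case_prod_conv
      by (intro dfbs) (simp add: numeral_2_eq_2)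
  qed
  note R = rl[OF this]
  have "triple_in S (rl ?R) p \<sigma> \<tau> = T p \<sigma> \<tau>" for p \<sigma> \<tau>
  proof
    assume "triple_in S (rl ?R) p \<sigma> \<tau>"
    then obtain \<sigma>' \<tau>' where "\<sigma> \<in> Univ S" "\<tau> \<in> Univ S" "\<sigma>' \<in> Univ S" "\<tau>' \<in> Univ S" "pr \<sigma> \<tau> = pr \<sigma>' \<tau>'" "T p \<sigma>' \<tau>'"
      unfolding triple_in_iff R(4) by (auto simp: is_opair_iff)
    then show "T p \<sigma> \<tau>" using pr_inject by blast
  next
    assume t: "T p \<sigma> \<tau>"
    then have U: "\<sigma> \<in> Univ S" "\<tau> \<in> Univ S" using T NU by blast+
    then have "is_opair S (pr \<sigma> \<tau>) \<sigma> \<tau>" by (simp add: is_opair_iff)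
    then have "(p, pr \<sigma> \<tau>) \<in> ?R" using t U by blast
    then show "triple_in S (rl ?R) p \<sigma> \<tau>" unfolding triple_in_iff R(4) using U by blast
  qed
  then show ?thesis unfolding isT_def using R(2) by blast
qed

text \<open>No recursion is needed to obtain the forcing relation: \<open>forces_eq_step\<close> is monotone, and the
  union \<open>FN N\<close> of all post-fixed points that are sets is the greatest fixed point (Knaster-Tarski).
  Hence \<open>forces_eq\<close> is the greatest bisimulation, and its properties are proved by coinduction.\<close>

definition post :: "'a set \<Rightarrow> ('a \<Rightarrow> 'a \<Rightarrow> 'a \<Rightarrow> bool) \<Rightarrow> bool" where
  "post N T \<longleftrightarrow> isT T \<and> (\<forall>p \<sigma> \<tau>. T p \<sigma> \<tau> \<longrightarrow> p \<in> P \<and> \<sigma> \<in> N \<and> \<tau> \<in> N \<and> stp T p \<sigma> \<tau>)"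

definition FN :: "'a set \<Rightarrow> 'a \<Rightarrow> 'a \<Rightarrow> 'a \<Rightarrow> bool" where
  "FN N p \<sigma> \<tau> \<longleftrightarrow> (\<exists>T. post N T \<and> T p \<sigma> \<tau>)"

lemma isT_FN:
  assumes N: "nc N" shows "isT (FN N)"
proof -
  have NC: "isC N" using N by (simp add: nc_def)
  obtain n where n: "n \<in> Univ S" "N = elts S n" using isC_iff[OF NC] by blast
  have e: "FN N p \<sigma> \<tau> \<longleftrightarrow> (\<exists>R\<in>Univ S. (\<forall>p\<in>Univ S. \<forall>\<sigma>\<in>Univ S. \<forall>\<tau>\<in>Univ S. triple_in S R p \<sigma> \<tau> \<longrightarrow>
     p \<in> P \<and> \<sigma> \<in> elts S n \<and> \<tau> \<in> elts S n \<and> stp (triple_in S R) p \<sigma> \<tau>) \<and> triple_in S R p \<sigma> \<tau>)" for p \<sigma> \<tau>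
  proof -
    have "triple_in S R p \<sigma> \<tau> \<Longrightarrow> p \<in> Univ S \<and> \<sigma> \<in> Univ S \<and> \<tau> \<in> Univ S" for R p \<sigma> \<tau>
      using graph_fst by (auto simp: triple_in_iff)
    then have *: "(\<forall>p \<sigma> \<tau>. triple_in S R p \<sigma> \<tau> \<longrightarrow> p \<in> P \<and> \<sigma> \<in> N \<and> \<tau> \<in> N \<and> stp (triple_in S R) p \<sigma> \<tau>) \<longleftrightarrow>
      (\<forall>p\<in>Univ S. \<forall>\<sigma>\<in>Univ S. \<forall>\<tau>\<in>Univ S. triple_in S R p \<sigma> \<tau> \<longrightarrow>
     p \<in> P \<and> \<sigma> \<in> elts S n \<and> \<tau> \<in> elts S n \<and> stp (triple_in S R) p \<sigma> \<tau>)" for R unfolding n(2) by blast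
    show ?thesis unfolding FN_def post_def isT_def *[symmetric] by blast
  qed
  have d: "dfb S (Univ S) (\<lambda>e. FN N (e 0) (e 1) (e 2))"
    by (rule dfb_cong[OF _ e], intro dfbs dPU dfb_triple_in[OF subset_refl] dstepU n)
  show ?thesis by (rule isT_dfb[OF NC _ d]) (auto simp: FN_def post_def)
qed

lemma FN_fix:
  assumes N: "nc N"
  shows "FN N p \<sigma> \<tau> \<longleftrightarrow> p \<in> P \<and> \<sigma> \<in> N \<and> \<tau> \<in> N \<and> stp (FN N) p \<sigma> \<tau>"
proof
  assume "FN N p \<sigma> \<tau>"
  then obtain T where T: "post N T" "T p \<sigma> \<tau>" by (auto simp: FN_def)
  then have "p \<in> P \<and> \<sigma> \<in> N \<and> \<tau> \<in> N \<and> stp T p \<sigma> \<tau>" unfolding post_def by blast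
  moreover have "stp T p \<sigma> \<tau> \<Longrightarrow> stp (FN N) p \<sigma> \<tau>" by (erule stp_mono) (use T in \<open>auto simp: FN_def\<close>)
  ultimately show "p \<in> P \<and> \<sigma> \<in> N \<and> \<tau> \<in> N \<and> stp (FN N) p \<sigma> \<tau>" by blast
next
  assume a: "p \<in> P \<and> \<sigma> \<in> N \<and> \<tau> \<in> N \<and> stp (FN N) p \<sigma> \<tau>"
  have NC: "isC N" using N by (simp add: nc_def)
  obtain R where R: "R \<in> Univ S" "triple_in S R = FN N" using isT_FN[OF N] unfolding isT_def by blast
  \<comment> \<open>\<open>T\<close> is the step operator applied to \<open>FN N\<close>. It
    contains \<open>FN N\<close>, hence by monotonicity is a post-fixed point itself.\<close>
  define T where "T p \<sigma> \<tau> \<longleftrightarrow> p \<in> P \<and> \<sigma> \<in> N \<and> \<tau> \<in> N \<and> stp (triple_in S R) p \<sigma> \<tau>" for p \<sigma> \<tau>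
  have iT: "isT T"
  proof (rule isT_dfb[OF NC])
    show "dfb S (Univ S) (\<lambda>e. T (e 0) (e 1) (e 2))" unfolding T_def
      by (intro dfbs dPU dfb_isC[OF NC] dstepU R)
  qed (auto simp: T_def)
  have FT: "T p \<sigma> \<tau>" if F: "FN N p \<sigma> \<tau>" for p \<sigma> \<tau>
  proof -
    obtain T' where T': "post N T'" "T' p \<sigma> \<tau>" using F by (auto simp: FN_def)
    then have "p \<in> P \<and> \<sigma> \<in> N \<and> \<tau> \<in> N \<and> stp T' p \<sigma> \<tau>" unfolding post_def by blast
    moreover have "stp T' p \<sigma> \<tau> \<Longrightarrow> stp (FN N) p \<sigma> \<tau>" by (erule stp_mono) (use T' in \<open>auto simp: FN_def\<close>)
    ultimately show ?thesis unfolding T_def R(2) by blast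
  qed
  have "stp T p \<sigma> \<tau>" if "T p \<sigma> \<tau>" for p \<sigma> \<tau>
    using that unfolding T_def[of p \<sigma> \<tau>] R(2) by (elim conjE) (erule stp_mono, rule FT)
  then have "post N T" unfolding post_def using iT by (auto simp: T_def)
  moreover have "T p \<sigma> \<tau>" unfolding T_def R(2) using a .
  ultimately show "FN N p \<sigma> \<tau>" unfolding FN_def by blast
qed

lemma isT_restrict:
  assumes "isT T" "isC N" shows "isT (\<lambda>p \<sigma> \<tau>. p \<in> P \<and> \<sigma> \<in> N \<and> \<tau> \<in> N \<and> T p \<sigma> \<tau>)"
proof -
  obtain R where R: "R \<in> Univ S" "T = triple_in S R" using assms(1) unfolding isT_def by blast
  show ?thesis unfolding R(2)
    by (rule isT_dfb[OF assms(2)], simp, intro dfbs dPU dfb_isC[OF assms(2)] dfb_triple_in[OF subset_refl] R)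
qed

text \<open>The step inspects only entries of graphs of names, and these remain in the closed set
  \<open>N\<close>. So a post-fixed point living on another set can be cut down to
  \<open>N\<close>.\<close>

lemma FN_restrict:
  assumes N: "nc N" and T: "isT T" and "T p \<sigma> \<tau>" "p \<in> P" "\<sigma> \<in> N" "\<tau> \<in> N"
    and s: "\<And>p \<sigma> \<tau>. T p \<sigma> \<tau> \<Longrightarrow> p \<in> P \<Longrightarrow> \<sigma> \<in> N \<Longrightarrow> \<tau> \<in> N \<Longrightarrow> stp T p \<sigma> \<tau>"
  shows "FN N p \<sigma> \<tau>"
proof -
  have NC: "isC N" using N by (simp add: nc_def)
  let ?T = "\<lambda>p \<sigma> \<tau>. p \<in> P \<and> \<sigma> \<in> N \<and> \<tau> \<in> N \<and> T p \<sigma> \<tau>"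
  have "stp ?T p \<sigma> \<tau>" if "?T p \<sigma> \<tau>" for p \<sigma> \<tau>
    by (rule stp_mono[OF s]) (use that nc_graph[OF N] in blast)+
  then have "post N ?T" using isT_restrict[OF T NC] unfolding post_def by blast
  then show ?thesis unfolding FN_def using assms by blast
qed

text \<open>A run is a fixed point on its own set of names, hence after restriction lies below the
  greatest one on \<open>N\<close>; conversely the greatest fixed point is a run. Thus
  \<open>forces_eq\<close> can be evaluated on any closed set containing both names.\<close>

lemma forces_eq_FN:
  assumes N: "nc N" and p: "p \<in> P" "\<sigma> \<in> N" "\<tau> \<in> N"
  shows "forces_eq S P le p \<sigma> \<tau> \<longleftrightarrow> FN N p \<sigma> \<tau>"
proof
  assume "forces_eq S P le p \<sigma> \<tau>"
  then obtain n R where R: "R \<in> Univ S" "name_closed S P n" "\<sigma> \<in> elts S n" "\<tau> \<in> elts S n" "triple_in S R p \<sigma> \<tau>"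
    and run: "\<forall>p'\<in>P. \<forall>\<sigma>'\<in>elts S n. \<forall>\<tau>'\<in>elts S n.
           triple_in S R p' \<sigma>' \<tau>' \<longleftrightarrow> stp (triple_in S R) p' \<sigma>' \<tau>'" unfolding forces_eq_def by blast
  have n: "nc (elts S n)" using R(2) name_closed_iff by blast
  have "isT (triple_in S R)" using R(1) unfolding isT_def by blast
  then have "FN (elts S n) p \<sigma> \<tau>" using run by (intro FN_restrict[where T="triple_in S R", OF n _ R(5) p(1) R(3,4)]) auto
  then obtain T where T: "post (elts S n) T" "T p \<sigma> \<tau>" by (auto simp: FN_def)
  then show "FN N p \<sigma> \<tau>" by (intro FN_restrict[where T=T, OF N _ T(2) p]) (auto simp: post_def)
next
  assume F: "FN N p \<sigma> \<tau>"
  obtain R where R: "R \<in> Univ S" "triple_in S R = FN N" using isT_FN[OF N] unfolding isT_def by blast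
  show "forces_eq S P le p \<sigma> \<tau>" unfolding forces_eq_def
    by (rule exI[of _ "mk N"], rule bexI[OF _ R(1)]) (use nc_mk[OF N] R(2) FN_fix[OF N] F p in auto)
qed

abbreviation F where "F \<equiv> forces_eq S P le"

lemma F_unfold:
  assumes "p \<in> P" "\<sigma> \<in> names S P" "\<tau> \<in> names S P"
  shows "F p \<sigma> \<tau> \<longleftrightarrow> stp F p \<sigma> \<tau>"
proof -
  obtain N where N: "nc N" "\<sigma> \<in> N" "\<tau> \<in> N" by (rule names2[OF assms(2,3)])
  have "stp (FN N) p \<sigma> \<tau> \<longleftrightarrow> stp F p \<sigma> \<tau>"
    by (rule iffI; erule stp_mono) (use forces_eq_FN[OF N(1)] nc_graph[OF N(1)] N in blast)+
  then show ?thesis using forces_eq_FN[OF N(1) assms(1) N(2,3)] FN_fix[OF N(1)] assms(1) N by blast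
qed

lemma F_coinduct:
  assumes N: "nc N" and d: "dfb S (Univ S) (\<lambda>e. T (e 0) (e 1) (e 2))"
    and T: "\<And>p \<sigma> \<tau>. T p \<sigma> \<tau> \<Longrightarrow> p \<in> P \<and> \<sigma> \<in> N \<and> \<tau> \<in> N" "\<And>p \<sigma> \<tau>. T p \<sigma> \<tau> \<Longrightarrow> stp T p \<sigma> \<tau>"
    and "T p \<sigma> \<tau>"
  shows "F p \<sigma> \<tau>"
proof -
  have NC: "isC N" using N by (simp add: nc_def)
  have "isT T" by (rule isT_dfb[OF NC T(1) d])
  then have "FN N p \<sigma> \<tau>" by (rule FN_restrict[where T=T, OF N _ assms(5)]) (use T assms(5) in blast)+
  then show ?thesis using forces_eq_FN[OF N] T(1)[OF assms(5)] by blast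
qed

lemma F_refl:
  assumes "p \<in> P" "\<sigma> \<in> names S P" shows "F p \<sigma> \<sigma>"
proof -
  obtain N where N: "nc N" "\<sigma> \<in> N" using assms(2) names_iff by blast
  have NC: "isC N" using N by (simp add: nc_def)
  let ?T = "\<lambda>p \<sigma> \<tau>. p \<in> P \<and> \<sigma> \<in> N \<and> \<tau> \<in> N \<and> \<sigma> = \<tau>"
  show ?thesis
  proof (rule F_coinduct[OF N(1), where T="?T"])
    show "dfb S (Univ S) (\<lambda>e. ?T (e 0) (e 1) (e 2))" by (intro dfbs dPU dfb_isC[OF NC])
    show "stp ?T p \<sigma> \<tau>" if "?T p \<sigma> \<tau>" for p \<sigma> \<tau>
      by (rule stp_I) (use that nc_graph[OF N(1)] le_refl in blast)+
  qed (use N assms in auto)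
qed

lemma F_sym:
  assumes "p \<in> P" "\<sigma> \<in> names S P" "\<tau> \<in> names S P" "F p \<sigma> \<tau>" shows "F p \<tau> \<sigma>"
proof -
  obtain N where N: "nc N" "\<sigma> \<in> N" "\<tau> \<in> N" by (rule names2[OF assms(2,3)])
  have NC: "isC N" using N by (simp add: nc_def)
  have Nn: "x \<in> names S P" if "x \<in> N" for x using N(1) that names_iff by blast
  let ?T = "\<lambda>p \<sigma> \<tau>. p \<in> P \<and> \<sigma> \<in> N \<and> \<tau> \<in> N \<and> F p \<tau> \<sigma>"
  show ?thesis
  proof (rule F_coinduct[OF N(1), where T="?T"])
    show "dfb S (Univ S) (\<lambda>e. ?T (e 0) (e 1) (e 2))" by (intro dfbs dPU dfb_isC[OF NC] dfeU)
    show "stp ?T p \<sigma> \<tau>" if t: "?T p \<sigma> \<tau>" for p \<sigma> \<tau>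
    proof -
      have "stp F p \<tau> \<sigma>" using F_unfold t Nn by blast
      then have "stp (\<lambda>p \<sigma> \<tau>. F p \<tau> \<sigma>) p \<sigma> \<tau>"
      proof (intro stp_I)
        assume s: "stp F p \<tau> \<sigma>"
        show "atom S \<sigma> \<or> atom S \<tau> \<Longrightarrow> \<sigma> = \<tau>" using stp_atom[OF s] by blast
        show "\<exists>r\<in>P. le r q \<and> (\<exists>\<tau>' u. (\<tau>', u) \<in> graph S \<tau> \<and> le r u \<and> F r \<tau>' \<sigma>')"
          if na: "\<not> atom S \<sigma>" "\<not> atom S \<tau>" and g: "(\<sigma>', w) \<in> graph S \<sigma>" "q \<in> P" "le q p" "le q w" for \<sigma>' w q
          by (rule stp_D(2)[OF s na(2,1) g])
        show "\<exists>r\<in>P. le r q \<and> (\<exists>\<sigma>' s. (\<sigma>', s) \<in> graph S \<sigma> \<and> le r s \<and> F r \<tau>' \<sigma>')"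
          if na: "\<not> atom S \<sigma>" "\<not> atom S \<tau>" and g: "(\<tau>', w) \<in> graph S \<tau>" "q \<in> P" "le q p" "le q w" for \<tau>' w q
          by (rule stp_D(1)[OF s na(2,1) g])
      qed
      then show ?thesis by (rule stp_mono) (use nc_graph[OF N(1)] t in blast)
    qed
  qed (use N assms in auto)
qed

lemma F_mono:
  assumes "p \<in> P" "q \<in> P" "le q p" "\<sigma> \<in> names S P" "\<tau> \<in> names S P" "F p \<sigma> \<tau>" shows "F q \<sigma> \<tau>"
proof -
  have "stp F p \<sigma> \<tau>" using F_unfold assms by blast
  then have "stp F q \<sigma> \<tau>"
  proof (intro stp_I)
    assume s: "stp F p \<sigma> \<tau>"
    have t: "le q' p" if "q' \<in> P" "le q' q" for q' using le_trans[OF that(1) assms(2,1) that(2) assms(3)] .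
    show "atom S \<sigma> \<or> atom S \<tau> \<Longrightarrow> \<sigma> = \<tau>" by (rule stp_atom[OF s])
    show "\<exists>r\<in>P. le r q' \<and> (\<exists>\<tau>' u. (\<tau>', u) \<in> graph S \<tau> \<and> le r u \<and> F r \<sigma>' \<tau>')"
      if na: "\<not> atom S \<sigma>" "\<not> atom S \<tau>" and g: "(\<sigma>', w) \<in> graph S \<sigma>" "q' \<in> P" "le q' q" "le q' w" for \<sigma>' w q'
      by (rule stp_D(1)[OF s na g(1,2) t[OF g(2,3)] g(4)])
    show "\<exists>r\<in>P. le r q' \<and> (\<exists>\<sigma>' s. (\<sigma>', s) \<in> graph S \<sigma> \<and> le r s \<and> F r \<sigma>' \<tau>')"
      if na: "\<not> atom S \<sigma>" "\<not> atom S \<tau>" and g: "(\<tau>', w) \<in> graph S \<tau>" "q' \<in> P" "le q' q" "le q' w" for \<tau>' w q'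
      by (rule stp_D(2)[OF s na g(1,2) t[OF g(2,3)] g(4)])
  qed
  then show ?thesis using F_unfold assms by blast
qed

text \<open>The composition of \<open>F\<close> with itself is a bisimulation: a condition is
  extended twice, and \<open>F_mono\<close> carries the first equality to the final
  extension.\<close>

lemma F_trans:
  assumes "p \<in> P" "\<sigma> \<in> names S P" "\<tau> \<in> names S P" "\<rho> \<in> names S P" "F p \<sigma> \<tau>" "F p \<tau> \<rho>" shows "F p \<sigma> \<rho>"
proof -
  obtain M where M: "nc M" "\<sigma> \<in> M" "\<tau> \<in> M" by (rule names2[OF assms(2,3)])
  obtain M' where M': "nc M'" "\<rho> \<in> M'" using assms(4) names_iff by blast
  define N where "N = M \<union> M'"
  have N: "nc N" "\<sigma> \<in> N" "\<tau> \<in> N" "\<rho> \<in> N" using nc_Un M M' by (auto simp: N_def)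
  have NC: "isC N" using N by (simp add: nc_def)
  have Nn: "x \<in> names S P" if "x \<in> N" for x using N(1) that names_iff by blast
  let ?T = "\<lambda>p \<sigma> \<rho>. p \<in> P \<and> \<sigma> \<in> N \<and> \<rho> \<in> N \<and> (\<exists>\<tau>\<in>Univ S. \<tau> \<in> N \<and> F p \<sigma> \<tau> \<and> F p \<tau> \<rho>)"
  show ?thesis
  proof (rule F_coinduct[OF N(1), where T="?T"])
    show "dfb S (Univ S) (\<lambda>e. ?T (e 0) (e 1) (e 2))" by (intro dfbs dPU dfb_isC[OF NC] dfeU)
    show "stp ?T p \<sigma> \<rho>" if t: "?T p \<sigma> \<rho>" for p \<sigma> \<rho>
    proof -
      obtain \<tau> where \<tau>: "\<tau> \<in> N" "F p \<sigma> \<tau>" "F p \<tau> \<rho>" using t by blast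
      have pP: "p \<in> P" and nN: "\<sigma> \<in> N" "\<rho> \<in> N" using t by auto
      have s: "stp F p \<sigma> \<tau>" "stp F p \<tau> \<rho>" using F_unfold pP nN \<tau> Nn by blast+
      show ?thesis
      proof (cases "atom S \<sigma> \<or> atom S \<rho>")
        case True
        then have "\<sigma> = \<rho>" using stp_atom[OF s(1)] stp_atom[OF s(2)] by blast
        then show ?thesis using True by (intro stp_I) auto
      next
        case False
        have nt: "\<not> atom S \<tau>" using stp_atom[OF s(1)] False by blast
        have 1: "\<exists>r\<in>P. le r q \<and> (\<exists>\<rho>' u. (\<rho>', u) \<in> graph S \<rho> \<and> le r u \<and> ?T r \<sigma>' \<rho>')"
          if g: "(\<sigma>', w) \<in> graph S \<sigma>" "q \<in> P" "le q p" "le q w" for \<sigma>' w q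
        proof -
          obtain r \<tau>' u where r: "r \<in> P" "le r q" "(\<tau>', u) \<in> graph S \<tau>" "le r u" "F r \<sigma>' \<tau>'"
            using stp_D(1)[OF s(1) _ nt g] False by blast
          have "le r p" using le_trans[OF r(1) g(2) pP r(2) g(3)] .
          then obtain r' \<rho>' v where r': "r' \<in> P" "le r' r" "(\<rho>', v) \<in> graph S \<rho>" "le r' v" "F r' \<tau>' \<rho>'"
            using stp_D(1)[OF s(2) nt _ r(3,1) _ r(4)] False by blast
          have n: "\<sigma>' \<in> N" "\<tau>' \<in> N" "\<rho>' \<in> N" using nc_graph[OF N(1)] g(1) r(3) r'(3) \<tau>(1) nN by blast+
          have "F r' \<sigma>' \<tau>'" by (rule F_mono[OF r(1) r'(1,2) Nn[OF n(1)] Nn[OF n(2)] r(5)])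
          then have "?T r' \<sigma>' \<rho>'" using r' n nc_U[OF N(1)] by blast
          moreover have "le r' q" using le_trans[OF r'(1) r(1) g(2) r'(2) r(2)] .
          ultimately show ?thesis using r' by blast
        qed
        have 2: "\<exists>r\<in>P. le r q \<and> (\<exists>\<sigma>' s. (\<sigma>', s) \<in> graph S \<sigma> \<and> le r s \<and> ?T r \<sigma>' \<rho>')"
          if g: "(\<rho>', w) \<in> graph S \<rho>" "q \<in> P" "le q p" "le q w" for \<rho>' w q
        proof -
          obtain r \<tau>' u where r: "r \<in> P" "le r q" "(\<tau>', u) \<in> graph S \<tau>" "le r u" "F r \<tau>' \<rho>'"
            using stp_D(2)[OF s(2) nt _ g] False by blast
          have "le r p" using le_trans[OF r(1) g(2) pP r(2) g(3)] .
          then obtain r' \<sigma>' v where r': "r' \<in> P" "le r' r" "(\<sigma>', v) \<in> graph S \<sigma>" "le r' v" "F r' \<sigma>' \<tau>'"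
            using stp_D(2)[OF s(1) _ nt r(3,1) _ r(4)] False by blast
          have n: "\<sigma>' \<in> N" "\<tau>' \<in> N" "\<rho>' \<in> N" using nc_graph[OF N(1)] g(1) r(3) r'(3) \<tau>(1) nN by blast+
          have "F r' \<tau>' \<rho>'" by (rule F_mono[OF r(1) r'(1,2) Nn[OF n(2)] Nn[OF n(3)] r(5)])
          then have "?T r' \<sigma>' \<rho>'" using r' n nc_U[OF N(1)] by blast
          moreover have "le r' q" using le_trans[OF r'(1) r(1) g(2) r'(2) r(2)] .
          ultimately show ?thesis using r' by blast
        qed
        show ?thesis using False by (intro stp_I 1 2; blast)
      qed
    qed
    show "?T p \<sigma> \<rho>" using assms N nc_U[OF N(1)] by blast
  qed blast
qed

section \<open>Generic filters, values of names and extensionality\<close>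

lemma G_props:
  shows "G \<subseteq> P" "G \<noteq> {}" "\<And>p q. p \<in> G \<Longrightarrow> q \<in> P \<Longrightarrow> le p q \<Longrightarrow> q \<in> G"
    "\<And>p q. p \<in> G \<Longrightarrow> q \<in> G \<Longrightarrow> \<exists>r\<in>G. le r p \<and> le r q"
  using G unfolding generic_filter_def by blast+

lemma G_dense:
  assumes d: "dfb S (Univ S) (\<lambda>e. D (e 0))" and D: "\<And>p. p \<in> P \<Longrightarrow> \<exists>q\<in>P. D q \<and> le q p"
  shows "\<exists>g\<in>G. D g"
proof -
  have i: "isC {q \<in> P. D q}" by (rule isC_sep[OF PC d])
  have "dense_in S P le (mk {q \<in> P. D q})" unfolding dense_in_def mk(2)[OF i] using mk(1)[OF i] D by blast
  then have "G \<inter> {q \<in> P. D q} \<noteq> {}" using G mk(2)[OF i] unfolding generic_filter_def by metis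
  then show ?thesis by blast
qed

text \<open>Adding the conditions incompatible with \<open>p0\<close> makes the set dense
  everywhere. None of these lies in \<open>G\<close>, because \<open>G\<close> is directed and
  contains \<open>p0\<close>.\<close>

lemma G_dense_below:
  assumes d: "dfb S (Univ S) (\<lambda>e. D (e 0))" and p0: "p0 \<in> G"
    and D: "\<And>p. p \<in> P \<Longrightarrow> le p p0 \<Longrightarrow> \<exists>q\<in>P. D q \<and> le q p"
  shows "\<exists>g\<in>G. D g"
proof -
  have p0P: "p0 \<in> P" using p0 G_props(1) by blast
  have "\<exists>g\<in>G. D g \<or> \<not> (\<exists>r\<in>P. le r g \<and> le r p0)"
  proof (rule G_dense)
    show "dfb S (Univ S) (\<lambda>e. D (e 0) \<or> \<not> (\<exists>r\<in>P. le r (e 0) \<and> le r p0))"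
      by (intro dfb_disj[OF d] dfbs dbexP dPU dleU) (use p0P PU in blast)
    fix p assume p: "p \<in> P"
    show "\<exists>q\<in>P. (D q \<or> \<not> (\<exists>r\<in>P. le r q \<and> le r p0)) \<and> le q p"
    proof (cases "\<exists>r\<in>P. le r p \<and> le r p0")
      case True
      then obtain r where r: "r \<in> P" "le r p" "le r p0" by blast
      obtain q where "q \<in> P" "D q" "le q r" using D[OF r(1,3)] by blast
      then show ?thesis using le_trans[of q r p] r p by blast
    qed (use p le_refl in blast)
  qed
  then show ?thesis using G_props(1,4) p0 by blast
qed

abbreviation vl where "vl \<equiv> val S P le G"
abbreviation E where "E \<equiv> generic_ext S P le G"

lemma vl_eq:
  assumes "\<sigma> \<in> names S P" "\<tau> \<in> names S P"
  shows "vl \<sigma> = vl \<tau> \<longleftrightarrow> (\<exists>p\<in>G. F p \<sigma> \<tau>)"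
proof
  assume "vl \<sigma> = vl \<tau>"
  moreover have "\<sigma> \<in> vl \<sigma>" using assms F_refl G_props(1,2) unfolding val_def by blast
  ultimately show "\<exists>p\<in>G. F p \<sigma> \<tau>" by (auto simp: val_def)
next
  have *: "vl \<sigma> \<subseteq> vl \<tau>" if n: "\<sigma> \<in> names S P" "\<tau> \<in> names S P" and p: "p \<in> G" "F p \<sigma> \<tau>" for p \<sigma> \<tau>
  proof
    fix x assume "x \<in> vl \<sigma>"
    then obtain q where x: "x \<in> names S P" and q: "q \<in> G" "F q x \<sigma>" by (auto simp: val_def)
    obtain r where r: "r \<in> G" "le r p" "le r q" using G_props(4)[OF p(1) q(1)] by blast
    have P: "p \<in> P" "q \<in> P" "r \<in> P" using p q r G_props(1) by auto
    have "F r x \<sigma>" "F r \<sigma> \<tau>" using F_mono[OF P(2,3) r(3) x n(1) q(2)] F_mono[OF P(1,3) r(2) n p(2)] by auto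
    then have "F r x \<tau>" using F_trans[OF P(3) x n] by blast
    then show "x \<in> vl \<tau>" using x r by (auto simp: val_def)
  qed
  assume "\<exists>p\<in>G. F p \<sigma> \<tau>"
  then obtain p where p: "p \<in> G" "F p \<sigma> \<tau>" by blast
  moreover have "F p \<tau> \<sigma>" using F_sym assms p G_props(1) by blast
  ultimately show "vl \<sigma> = vl \<tau>" using * assms by blast
qed

lemma UnivE: "Univ E = vl ` names S P"
  by (simp add: generic_ext_def)

text \<open>By definition, membership in a value may be witnessed through any name of that value. A
  condition forcing the two names equal transfers the witness to \<open>\<tau>\<close>: below it and
  \<open>p'\<close>, conditions identifying the witness with a member of \<open>\<tau>\<close> are
  dense.\<close>

lemma eltsE:
  assumes \<tau>: "\<tau> \<in> names S P"
  shows "elts E (vl \<tau>) = {vl \<sigma> | \<sigma> p. (\<sigma>, p) \<in> graph S \<tau> \<and> p \<in> G}"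
proof (intro equalityI subsetI)
  fix X assume "X \<in> {vl \<sigma> | \<sigma> p. (\<sigma>, p) \<in> graph S \<tau> \<and> p \<in> G}"
  then obtain \<sigma> p where X: "X = vl \<sigma>" "(\<sigma>, p) \<in> graph S \<tau>" "p \<in> G" by blast
  moreover have "\<sigma> \<in> names S P" using names_graph[OF \<tau> X(2)] by blast
  ultimately show "X \<in> elts E (vl \<tau>)" using \<tau> unfolding elts_def generic_ext_def by auto
next
  fix X assume "X \<in> elts E (vl \<tau>)"
  then obtain \<tau>' \<sigma>' p' where *: "\<tau>' \<in> names S P" "vl \<tau> = vl \<tau>'" "(\<sigma>', p') \<in> graph S \<tau>'" "p' \<in> G" "X = vl \<sigma>'"
    unfolding elts_def generic_ext_def by auto
  obtain q where q: "q \<in> G" "F q \<tau> \<tau>'" using *(2) vl_eq[OF \<tau> *(1)] by blast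
  have qP: "q \<in> P" using q G_props(1) by blast
  have s: "stp F q \<tau> \<tau>'" using F_unfold[OF qP \<tau> *(1)] q by blast
  show "X \<in> {vl \<sigma> | \<sigma> p. (\<sigma>, p) \<in> graph S \<tau> \<and> p \<in> G}"
  proof (cases "atom S \<tau> \<or> atom S \<tau>'")
    case True
    then show ?thesis using stp_atom[OF s] * by blast
  next
    case False
    obtain r0 where r0: "r0 \<in> G" "le r0 q" "le r0 p'" using G_props(4)[OF q(1) *(4)] by blast
    have P: "r0 \<in> P" "p' \<in> P" using r0 *(4) G_props(1) by auto
    have U: "\<tau> \<in> Univ S" "\<sigma>' \<in> Univ S" using names_U names_graph \<tau> * by blast+
    have "\<exists>g\<in>G. \<exists>(\<sigma>, u)\<in>graph S \<tau>. le g u \<and> F g \<sigma> \<sigma>'"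
    proof (rule G_dense_below[OF _ r0(1)])
      show "dfb S (Univ S) (\<lambda>e. \<exists>(\<sigma>, u)\<in>graph S \<tau>. le (e 0) u \<and> F (e 0) \<sigma> \<sigma>')"
        by (intro dfbs dgrU dleU dfeU U)
      fix p assume p: "p \<in> P" "le p r0"
      have "le p q" "le p p'" using le_trans[OF p(1) P(1) qP p(2) r0(2)] le_trans[OF p(1) P p(2) r0(3)] by auto
      then obtain r \<sigma> u where "r \<in> P" "le r p" "(\<sigma>, u) \<in> graph S \<tau>" "le r u" "F r \<sigma> \<sigma>'"
        using stp_D(2)[OF s _ _ *(3) p(1)] False by blast
      then show "\<exists>q\<in>P. (\<exists>(\<sigma>, u)\<in>graph S \<tau>. le q u \<and> F q \<sigma> \<sigma>') \<and> le q p" by blast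
    qed
    then obtain g \<sigma> u where g: "g \<in> G" "(\<sigma>, u) \<in> graph S \<tau>" "le g u" "F g \<sigma> \<sigma>'" by blast
    have "u \<in> G" using G_props(3)[OF g(1) _ g(3)] names_graph[OF \<tau> g(2)] by blast
    moreover have "vl \<sigma> = vl \<sigma>'" using vl_eq names_graph g \<tau> * by blast
    ultimately show ?thesis using g * by auto
  qed
qed

text \<open>If a condition does not force equality, some stronger condition guarantees a member of
  one value and prevents every further extension from identifying it with a member of the other.
  This is what \<open>D\<close> expresses; such a condition in \<open>G\<close> would separate the
  two values.\<close>

lemma vl_ext:
  assumes n: "\<sigma> \<in> names S P" "\<tau> \<in> names S P" and na: "\<not> atom S \<sigma>" "\<not> atom S \<tau>"
    and e: "elts E (vl \<sigma>) = elts E (vl \<tau>)"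
  shows "vl \<sigma> = vl \<tau>"
proof -
  define D where "D x y p \<longleftrightarrow> (\<exists>(\<sigma>', s)\<in>graph S x. le p s \<and>
     (\<forall>r\<in>P. le r p \<longrightarrow> (\<forall>(\<tau>', u)\<in>graph S y. le r u \<longrightarrow> \<not> F r \<sigma>' \<tau>')))" for x y p
  have U: "\<sigma> \<in> Univ S" "\<tau> \<in> Univ S" using n names_U by auto
  have "\<exists>g\<in>G. F g \<sigma> \<tau> \<or> D \<sigma> \<tau> g \<or> D \<tau> \<sigma> g"
  proof (rule G_dense)
    show "dfb S (Univ S) (\<lambda>e. F (e 0) \<sigma> \<tau> \<or> D \<sigma> \<tau> (e 0) \<or> D \<tau> \<sigma> (e 0))"
      unfolding D_def by (intro dfbs dgrU dleU dfeU U dballP dPU)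
    fix p assume p: "p \<in> P"
    show "\<exists>q\<in>P. (F q \<sigma> \<tau> \<or> D \<sigma> \<tau> q \<or> D \<tau> \<sigma> q) \<and> le q p"
    proof (rule ccontr)
      assume no: "\<not> ?thesis"
      have f: "\<exists>r\<in>P. le r q \<and> (\<exists>\<tau>' u. (\<tau>', u) \<in> graph S y \<and> le r u \<and> F r \<sigma>' \<tau>')"
        if "(x, y) = (\<sigma>, \<tau>) \<or> (x, y) = (\<tau>, \<sigma>)" "(\<sigma>', s) \<in> graph S x" "q \<in> P" "le q p" "le q s" for x y \<sigma>' s q
      proof (rule ccontr)
        assume "\<not> ?thesis"
        then have "D x y q" unfolding D_def using that by blast
        then show False using no that by blast
      qed
      have "stp F p \<sigma> \<tau>"
      proof (rule stp_I)
        show "atom S \<sigma> \<or> atom S \<tau> \<Longrightarrow> \<sigma> = \<tau>" using na by blast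
        fix \<sigma>' s q assume "(\<sigma>', s) \<in> graph S \<sigma>" "q \<in> P" "le q p" "le q s"
        then show "\<exists>r\<in>P. le r q \<and> (\<exists>\<tau>' u. (\<tau>', u) \<in> graph S \<tau> \<and> le r u \<and> F r \<sigma>' \<tau>')" using f by blast
      next
        fix \<tau>' u q assume *: "(\<tau>', u) \<in> graph S \<tau>" "q \<in> P" "le q p" "le q u"
        then obtain r \<sigma>' s where r: "r \<in> P" "le r q" "(\<sigma>', s) \<in> graph S \<sigma>" "le r s" "F r \<tau>' \<sigma>'" using f by blast
        then have "F r \<sigma>' \<tau>'" using F_sym names_graph n * by blast
        then show "\<exists>r\<in>P. le r q \<and> (\<exists>\<sigma>' s. (\<sigma>', s) \<in> graph S \<sigma> \<and> le r s \<and> F r \<sigma>' \<tau>')" using r by blast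
      qed
      then show False using no F_unfold[OF p n] le_refl[OF p] p by blast
    qed
  qed
  then obtain g where g: "g \<in> G" "F g \<sigma> \<tau> \<or> D \<sigma> \<tau> g \<or> D \<tau> \<sigma> g" by blast
  have nD: "\<not> D x y g" if xy: "x \<in> names S P" "y \<in> names S P" "elts E (vl x) = elts E (vl y)" for x y
  proof
    assume "D x y g"
    then obtain \<sigma>' s where s: "(\<sigma>', s) \<in> graph S x" "le g s"
      "\<And>r \<tau>' u. r \<in> P \<Longrightarrow> le r g \<Longrightarrow> (\<tau>', u) \<in> graph S y \<Longrightarrow> le r u \<Longrightarrow> \<not> F r \<sigma>' \<tau>'" unfolding D_def by blast
    have "s \<in> G" using G_props(3)[OF g(1) names_graph(2)[OF xy(1) s(1)] s(2)] .
    then have "vl \<sigma>' \<in> elts E (vl y)" using xy s(1) eltsE[OF xy(1)] by blast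
    then obtain \<tau>' u where t: "vl \<sigma>' = vl \<tau>'" "(\<tau>', u) \<in> graph S y" "u \<in> G" using eltsE[OF xy(2)] by blast
    have nn: "\<sigma>' \<in> names S P" "\<tau>' \<in> names S P" using names_graph s t xy by blast+
    obtain q where q: "q \<in> G" "F q \<sigma>' \<tau>'" using t(1) vl_eq[OF nn] by blast
    obtain r1 where r1: "r1 \<in> G" "le r1 q" "le r1 u" using G_props(4)[OF q(1) t(3)] by blast
    obtain r where r: "r \<in> G" "le r r1" "le r g" using G_props(4)[OF r1(1) g(1)] by blast
    have P: "r \<in> P" "r1 \<in> P" "q \<in> P" "u \<in> P" using G_props(1) r r1 q t by auto
    have "le r q" "le r u" using le_trans[OF P(1,2,3) r(2) r1(2)] le_trans[OF P(1,2,4) r(2) r1(3)] by auto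
    then have "F r \<sigma>' \<tau>'" using F_mono[OF P(3,1) _ nn q(2)] by blast
    then show False using s(3)[OF P(1) r(3) t(2) \<open>le r u\<close>] by blast
  qed
  then have "F g \<sigma> \<tau>" using g(2) nD n e by blast
  then show ?thesis using vl_eq[OF n] g(1) by blast
qed

section \<open>Names for sets, pairs and natural numbers\<close>

abbreviation "Ats \<equiv> elts S (Atoms S)"

lemma nc_names: "nc N \<Longrightarrow> x \<in> N \<Longrightarrow> x \<in> names S P"
  using names_iff by blast

text \<open>Attaching all conditions makes the members of the value independent of which conditions
  belong to \<open>G\<close>.\<close>

definition nm :: "'a set \<Rightarrow> 'a" where
  "nm X = rl (X \<times> P)"

lemma nm:
  assumes "isC X"
  shows "is_set S (nm X)" "nm X \<in> Univ S" "elts S (nm X) = prs (X \<times> P)" "graph S (nm X) = X \<times> P" "\<not> atom S (nm X)"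
  using rl[OF isR_prod[OF assms PC]] by (auto simp: nm_def is_set_def)

lemma nc_insert:
  assumes N: "nc N" and x: "x \<in> Univ S" and z: "\<And>z. z \<in> elts S x \<Longrightarrow> \<exists>\<sigma>\<in>N. \<exists>p\<in>P. z = pr \<sigma> p"
  shows "nc (insert x N)"
  unfolding nc_def
proof (intro conjI ballI impI)
  show "isC (insert x N)" using N x by (intro isC_insert) (simp_all add: nc_def)
  fix y z assume y: "y \<in> insert x N" "is_set S y" "z \<in> elts S y"
  show "\<exists>\<sigma>\<in>insert x N. \<exists>p\<in>P. z = pr \<sigma> p"
  proof (cases "y = x")
    case True
    then show ?thesis using z y(3) by blast
  next
    case False
    then show ?thesis using y N unfolding nc_def by blast
  qed
qed

lemma nc_nm:
  assumes N: "nc N" and X: "isC X" "X \<subseteq> N"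
  shows "nc (insert (nm X) N)"
  by (rule nc_insert[OF N nm(2)[OF X(1)]]) (use X(2) in \<open>auto simp: nm(3)[OF X(1)] prs_def\<close>)

lemma nm_names: "nc N \<Longrightarrow> isC X \<Longrightarrow> X \<subseteq> N \<Longrightarrow> nm X \<in> names S P"
  by (rule nc_names[OF nc_nm]) auto

lemma eltsE_nm: "nc N \<Longrightarrow> isC X \<Longrightarrow> X \<subseteq> N \<Longrightarrow> elts E (vl (nm X)) = vl ` X"
  using G_props(1,2) by (auto simp: eltsE[OF nm_names] nm(4))

lemma nm2:
  assumes "\<sigma> \<in> names S P" "\<tau> \<in> names S P"
  shows "nm {\<sigma>, \<tau>} \<in> names S P" "elts E (vl (nm {\<sigma>, \<tau>})) = {vl \<sigma>, vl \<tau>}" "is_set S (nm {\<sigma>, \<tau>})"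
proof -
  obtain N where N: "nc N" "\<sigma> \<in> N" "\<tau> \<in> N" by (rule names2[OF assms])
  have X: "isC {\<sigma>, \<tau>}" using names_U assms by (intro isC_upair)
  show "nm {\<sigma>, \<tau>} \<in> names S P" "elts E (vl (nm {\<sigma>, \<tau>})) = {vl \<sigma>, vl \<tau>}" "is_set S (nm {\<sigma>, \<tau>})"
    using nm_names[OF N(1) X] eltsE_nm[OF N(1) X] N nm(1)[OF X] by auto
qed

lemma nc_Ats: "nc Ats"
  unfolding nc_def using isC_elts[OF AtomsU] by (auto simp: is_set_def atom_def)

lemma atoms_name: "atoms_name S P = nm Ats"
proof -
  have e: "{z. \<exists>a\<in>Ats. \<exists>p\<in>P. is_opair S z a p} = prs (Ats \<times> P)"
    using eltsU PU unfolding is_opair_iff prs_def by blast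
  note m = nm[OF isC_elts[OF AtomsU]]
  show ?thesis unfolding atoms_name_def e
    by (rule the_equality) (use m(1,3) extens in auto)
qed

lemma AtomsE: "Atoms E = vl (nm Ats)"
  by (simp add: generic_ext_def atoms_name)

lemma elts_AtomsE: "elts E (Atoms E) = vl ` Ats"
  unfolding AtomsE by (rule eltsE_nm[OF nc_Ats isC_elts[OF AtomsU]]) simp

text \<open>The recursion lets an atom be equal to itself only, so equality with an atom is already
  decided in \<open>S\<close>.\<close>

lemma vl_atom_inj:
  assumes "\<tau> \<in> names S P" "a \<in> Ats" "vl \<tau> = vl a" shows "\<tau> = a"
proof -
  have a: "a \<in> names S P" "atom S a" using nc_names[OF nc_Ats] assms by (auto simp: atom_def)
  obtain p where "p \<in> G" "F p \<tau> a" using vl_eq[OF assms(1) a(1)] assms(3) by blast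
  then have "stp F p \<tau> a" using F_unfold assms(1) a(1) G_props(1) by blast
  then show ?thesis using stp_atom a(2) by blast
qed

lemma is_setE: "is_set E X \<longleftrightarrow> (\<exists>\<tau>\<in>names S P. is_set S \<tau> \<and> X = vl \<tau>)"
proof
  assume X: "is_set E X"
  then obtain \<tau> where \<tau>: "\<tau> \<in> names S P" "X = vl \<tau>" by (auto simp: is_set_def UnivE)
  have "\<not> atom S \<tau>" using X \<tau>(2) elts_AtomsE by (auto simp: is_set_def atom_def)
  then show "\<exists>\<tau>\<in>names S P. is_set S \<tau> \<and> X = vl \<tau>" using \<tau> names_U by (auto simp: is_set_def)
next
  assume "\<exists>\<tau>\<in>names S P. is_set S \<tau> \<and> X = vl \<tau>"
  then obtain \<tau> where \<tau>: "\<tau> \<in> names S P" "is_set S \<tau>" "X = vl \<tau>" by blast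
  have "\<not> atom E X"
  proof
    assume "atom E X"
    then obtain a where "a \<in> Ats" "vl \<tau> = vl a" unfolding atom_def elts_AtomsE \<tau>(3) by blast
    then have "\<tau> \<in> Ats" using vl_atom_inj[OF \<tau>(1)] by blast
    then show False using \<tau>(2) by (simp add: is_set_def atom_def)
  qed
  then show "is_set E X" using \<tau> by (simp add: is_set_def UnivE)
qed

lemma extE: "is_set E X \<Longrightarrow> is_set E Y \<Longrightarrow> elts E X = elts E Y \<Longrightarrow> X = Y"
  using vl_ext unfolding is_setE by (metis is_set_def)

definition op :: "'a \<Rightarrow> 'a \<Rightarrow> 'a" where
  "op a b = nm {nm {a, a}, nm {a, b}}"

lemma op_names: "\<sigma> \<in> names S P \<Longrightarrow> \<tau> \<in> names S P \<Longrightarrow> op \<sigma> \<tau> \<in> names S P"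
  unfolding op_def by (intro nm2)

lemma upairE:
  assumes "\<sigma> \<in> names S P" "\<tau> \<in> names S P"
  shows "is_upair E Z (vl \<sigma>) (vl \<tau>) \<longleftrightarrow> Z = vl (nm {\<sigma>, \<tau>})"
proof -
  have "is_set E (vl (nm {\<sigma>, \<tau>}))" using nm2[OF assms] is_setE by blast
  then show ?thesis unfolding is_upair_def using extE nm2(2)[OF assms] by metis
qed

lemma opairE:
  assumes "\<sigma> \<in> names S P" "\<tau> \<in> names S P"
  shows "is_opair E Z (vl \<sigma>) (vl \<tau>) \<longleftrightarrow> Z = vl (op \<sigma> \<tau>)"
  unfolding is_opair_def upairE[OF assms] upairE[OF assms(1,1)] op_def
  using upairE[OF nm2(1)[OF assms(1,1)] nm2(1)[OF assms]] by blast

text \<open>The canonical name of a successor: \<open>x\<close> receives itself as a further member,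
  attached to every condition.\<close>

definition sn :: "'a \<Rightarrow> 'a" where
  "sn x = mk (elts S x \<union> prs ({x} \<times> P))"

lemma sn:
  assumes "x \<in> Univ S"
  shows "is_set S (sn x)" "sn x \<in> Univ S" "elts S (sn x) = elts S x \<union> prs ({x} \<times> P)"
    "graph S (sn x) = graph S x \<union> {x} \<times> P"
proof -
  have i: "isC (elts S x \<union> prs ({x} \<times> P))" by (intro isC_Un isC_elts isC_prod isC_sing PC assms)
  show *: "is_set S (sn x)" "sn x \<in> Univ S" "elts S (sn x) = elts S x \<union> prs ({x} \<times> P)"
    using mk[OF i] by (auto simp: sn_def)
  have "pr a b \<in> prs ({x} \<times> P) \<longleftrightarrow> (a, b) \<in> {x} \<times> P" if "a \<in> Univ S" "b \<in> Univ S" for a b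
    using pr_inject[OF that assms] PU by (auto simp: prs_def)
  then have "(a, b) \<in> graph S (sn x) \<longleftrightarrow> (a, b) \<in> graph S x \<union> {x} \<times> P" for a b
    unfolding graph_iff *(3) using assms PU by (auto simp: graph_iff)
  then show "graph S (sn x) = graph S x \<union> {x} \<times> P" by auto
qed

text \<open>\<open>W\<close> names an inductive set of the extension, and \<open>nats E\<close> is
  contained in every such set. So the values of a function into \<open>\<omega>\<close> have names
  from one set of the ground model.\<close>

lemma natsE:
  assumes W: "nc W" "emp \<in> W" "\<And>x. x \<in> W \<Longrightarrow> is_set S x \<and> sn x \<in> W"
  shows "nats E \<subseteq> vl ` W"
proof -
  have WC: "isC W" using W(1) by (simp add: nc_def)
  have n: "x \<in> names S P" if "x \<in> W" for x using nc_names[OF W(1) that] .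
  have e: "elts E (vl (nm W)) = vl ` W" by (rule eltsE_nm[OF W(1) WC]) simp
  have s: "is_set E (vl x)" if "x \<in> W" for x using is_setE n W(3) that by blast
  have "inductive_in E (vl (nm W))" unfolding inductive_in_def e
  proof (intro conjI ballI)
    show "is_set E (vl (nm W))" using is_setE nm_names[OF W(1) WC] nm(1)[OF WC] by blast
    have "elts E (vl emp) = {}" unfolding eltsE[OF n[OF W(2)]] using emp(3) by (auto simp: graph_iff)
    then show "\<exists>z\<in>vl ` W. is_zero E z" using W(2) s[OF W(2)] by (auto simp: is_zero_def)
    fix X assume "X \<in> vl ` W"
    then obtain x where x: "x \<in> W" "X = vl x" by blast
    have xU: "x \<in> Univ S" using nc_U[OF W(1)] x by blast
    have sx: "sn x \<in> W" using W(3) x by blast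
    have "elts E (vl (sn x)) = insert (vl x) (elts E (vl x))"
      unfolding eltsE[OF n[OF sx]] eltsE[OF n[OF x(1)]] sn(4)[OF xU] using G_props(1,2) by auto
    then show "\<exists>y\<in>vl ` W. is_succ E y X" using s[OF sx] sx x(2) unfolding is_succ_def by blast
  qed
  then have "nats E \<subseteq> elts E (vl (nm W))"
    unfolding nats_def using UnivE nm_names[OF W(1) WC] by blast
  then show ?thesis unfolding e .
qed

text \<open>\<open>isnm\<close> and \<open>isop\<close> are parameter-free definitions of the names of unordered and ordered pairs,
  from which their invariance under automorphisms follows.\<close>

definition isnm :: "'a \<Rightarrow> 'a \<Rightarrow> 'a \<Rightarrow> bool" where
  "isnm z a b \<longleftrightarrow> is_set S z \<and> (\<forall>w\<in>Univ S. w \<in> elts S z \<longleftrightarrow> (\<exists>p\<in>P. is_opair S w a p \<or> is_opair S w b p))"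

lemma isnm_iff:
  assumes "a \<in> Univ S" "b \<in> Univ S" shows "isnm z a b \<longleftrightarrow> z = nm {a, b}"
proof -
  note m = nm[OF isC_upair[OF assms]]
  have eq: "(\<forall>w\<in>Univ S. w \<in> elts S z \<longleftrightarrow> (\<exists>p\<in>P. is_opair S w a p \<or> is_opair S w b p)) \<longleftrightarrow> elts S z = prs ({a, b} \<times> P)"
  proof -
    have "(\<exists>p\<in>P. is_opair S w a p \<or> is_opair S w b p) \<longleftrightarrow> w \<in> prs ({a, b} \<times> P)" for w
      using assms PU unfolding is_opair_iff prs_def by blast
    moreover have "prs ({a, b} \<times> P) \<subseteq> Univ S" using assms PU pr_props by (auto simp: prs_def)
    ultimately show ?thesis using eltsU' by blast
  qed
  show ?thesis unfolding isnm_def eq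
  proof
    assume "is_set S z \<and> elts S z = prs ({a, b} \<times> P)"
    then show "z = nm {a, b}" using extens[OF _ m(1)] m(3) by simp
  qed (simp add: m)
qed

definition isop :: "'a \<Rightarrow> 'a \<Rightarrow> 'a \<Rightarrow> bool" where
  "isop z a b \<longleftrightarrow> (\<exists>u\<in>Univ S. \<exists>v\<in>Univ S. isnm u a a \<and> isnm v a b \<and> isnm z u v)"

lemma isop_iff: assumes "a \<in> Univ S" "b \<in> Univ S" shows "isop z a b \<longleftrightarrow> z = op a b"
proof -
  have "nm {a, a} \<in> Univ S" "nm {a, b} \<in> Univ S" using nm(2) isC_upair assms by blast+
  then show ?thesis unfolding isop_def op_def by (auto simp: isnm_iff assms)
qed

lemma op_U: "a \<in> Univ S \<Longrightarrow> b \<in> Univ S \<Longrightarrow> op a b \<in> Univ S"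
  unfolding op_def by (intro nm(2) isC_upair)

lemma dfb_isnm: "X \<subseteq> Univ S \<Longrightarrow> tm S X z \<Longrightarrow> tm S X a \<Longrightarrow> tm S X b \<Longrightarrow> dfb S X (\<lambda>e. isnm (z e) (a e) (b e))"
  unfolding isnm_def
  by (intro dfb_notions dfb_base tm_intros dfb_bexK[where K="\<lambda>_. P"] dP PU; assumption)

lemma dfb_isop: "X \<subseteq> Univ S \<Longrightarrow> tm S X z \<Longrightarrow> tm S X a \<Longrightarrow> tm S X b \<Longrightarrow> dfb S X (\<lambda>e. isop (z e) (a e) (b e))"
  unfolding isop_def
  by (intro dfb_base dfb_isnm tm_intros; assumption)

text \<open>A strong form of \<open>q \<tturnstile> x \<in> \<tau>\<close>, which suffices by genericity.\<close>

definition fmem :: "'a \<Rightarrow> 'a \<Rightarrow> 'a \<Rightarrow> bool" where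
  "fmem q x \<tau> \<longleftrightarrow> (\<exists>(\<zeta>, s)\<in>graph S \<tau>. le q s \<and> F q x \<zeta>)"

lemma dfb_fmem: "X \<subseteq> Univ S \<Longrightarrow> tm S X q \<Longrightarrow> tm S X x \<Longrightarrow> tm S X t \<Longrightarrow> dfb S X (\<lambda>e. fmem (q e) (x e) (t e))"
  unfolding fmem_def
  by (intro dfb_bex_graph dfb_base dle dfb_forces_eq PU dP tm_intros; assumption)

lemma fmem_mono:
  assumes "fmem q x \<tau>" "q \<in> P" "r \<in> P" "le r q" "x \<in> names S P" "\<tau> \<in> names S P"
  shows "fmem r x \<tau>"
proof -
  obtain \<zeta> s where z: "(\<zeta>, s) \<in> graph S \<tau>" "le q s" "F q x \<zeta>" using assms(1) unfolding fmem_def by blast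
  have n: "\<zeta> \<in> names S P" "s \<in> P" using names_graph[OF assms(6) z(1)] by auto
  have "le r s" using le_trans[OF assms(3,2) n(2) assms(4) z(2)] .
  moreover have "F r x \<zeta>" by (rule F_mono[OF assms(2-5) n(1) z(3)])
  ultimately show ?thesis unfolding fmem_def using z(1) by blast
qed

lemma eltsE_fmem:
  assumes "x \<in> names S P" "\<tau> \<in> names S P"
  shows "vl x \<in> elts E (vl \<tau>) \<longleftrightarrow> (\<exists>q\<in>G. fmem q x \<tau>)"
proof
  assume "vl x \<in> elts E (vl \<tau>)"
  then obtain \<zeta> s where z: "vl x = vl \<zeta>" "(\<zeta>, s) \<in> graph S \<tau>" "s \<in> G" using eltsE[OF assms(2)] by blast
  have n: "\<zeta> \<in> names S P" using names_graph[OF assms(2) z(2)] by auto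
  obtain q where q: "q \<in> G" "F q x \<zeta>" using vl_eq[OF assms(1) n] z(1) by blast
  obtain r where r: "r \<in> G" "le r q" "le r s" using G_props(4)[OF q(1) z(3)] by blast
  have "F r x \<zeta>" using F_mono[OF _ _ r(2) assms(1) n q(2)] q(1) r(1) G_props(1) by blast
  then show "\<exists>q\<in>G. fmem q x \<tau>" using r z(2) unfolding fmem_def by blast
next
  assume "\<exists>q\<in>G. fmem q x \<tau>"
  then obtain q \<zeta> s where q: "q \<in> G" "(\<zeta>, s) \<in> graph S \<tau>" "le q s" "F q x \<zeta>" unfolding fmem_def by blast
  have n: "\<zeta> \<in> names S P" "s \<in> P" using names_graph[OF assms(2) q(2)] by auto
  have "s \<in> G" using G_props(3)[OF q(1) n(2) q(3)] .
  moreover have "vl x = vl \<zeta>" using vl_eq[OF assms(1) n(1)] q by blast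
  ultimately show "vl x \<in> elts E (vl \<tau>)" using eltsE[OF assms(2)] q(2) by blast
qed

text \<open>Genericity is used here for the last time: the conditions violating the conclusion would be
  dense.\<close>

lemma countable_atomsE:
  assumes W: "nc W" "emp \<in> W" "\<And>x. x \<in> W \<Longrightarrow> is_set S x \<and> sn x \<in> W"
    and c: "countable_in E (elts E (Atoms E))"
  obtains \<tau> p where "\<tau> \<in> names S P" "p \<in> P"
    "\<And>a r. a \<in> Ats \<Longrightarrow> r \<in> P \<Longrightarrow> le r p \<Longrightarrow> \<exists>q\<in>P. le q r \<and> (\<exists>x\<in>W. fmem q (op a x) \<tau>)"
    "\<And>a b q x. a \<in> Ats \<Longrightarrow> b \<in> Ats \<Longrightarrow> a \<noteq> b \<Longrightarrow> q \<in> P \<Longrightarrow> le q p \<Longrightarrow> x \<in> W \<Longrightarrow>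
       fmem q (op a x) \<tau> \<Longrightarrow> fmem q (op b x) \<tau> \<Longrightarrow> False"
proof -
  have WC: "isC W" using W(1) by (simp add: nc_def)
  have nW: "x \<in> names S P" if "x \<in> W" for x using nc_names[OF W(1) that] .
  have nA: "a \<in> names S P" if "a \<in> Ats" for a using nc_names[OF nc_Ats that] .
  have nop: "op a x \<in> names S P" if "a \<in> Ats" "x \<in> W" for a x using op_names nA nW that by blast
  obtain f where f: "f \<in> Univ E" "inj_in E f (vl ` Ats) (nats E)"
    using c unfolding countable_in_def elts_AtomsE by blast
  obtain \<tau> where \<tau>: "\<tau> \<in> names S P" "f = vl \<tau>" using f(1) UnivE by blast
  have \<tau>U: "\<tau> \<in> Univ S" by (rule names_U[OF \<tau>(1)])
  have dom: "Domain (graph E f) = vl ` Ats" and ran: "Range (graph E f) \<subseteq> vl ` W"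
    and inj: "single_valued ((graph E f)\<inverse>)"
    using f(2) natsE[OF W] unfolding inj_in_def fun_in_def by auto
  have gr: "(vl a, vl x) \<in> graph E f \<longleftrightarrow> (\<exists>q\<in>G. fmem q (op a x) \<tau>)" if "a \<in> Ats" "x \<in> W" for a x
    unfolding graph_def mem_Collect_eq case_prod_conv opairE[OF nA[OF that(1)] nW[OF that(2)]]
    using eltsE_fmem[OF nop[OF that] \<tau>(1)] \<tau>(2) by blast
  have WU: "W \<subseteq> Univ S" by (rule nc_U[OF W(1)])
  have AU: "Ats \<subseteq> Univ S" using eltsU by blast
  have one: "(\<exists>u\<in>Univ S. isop u a x \<and> fmem q u \<tau>) \<longleftrightarrow> fmem q (op a x) \<tau>" if "a \<in> Ats" "x \<in> W" for a x q
    using isop_iff[of a x] op_U[of a x] subsetD[OF AU that(1)] subsetD[OF WU that(2)] by simp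
  \<comment> \<open>\<open>A1\<close> says that two atoms share a value, \<open>A2\<close> that some
    atom gets no value below \<open>q\<close>. Both go through \<open>isop\<close>, because
    \<open>op\<close> is a description and not a term.\<close>
  define A1 where "A1 q \<longleftrightarrow> (\<exists>a\<in>Ats. \<exists>b\<in>Ats. a \<noteq> b \<and> (\<exists>x\<in>W. (\<exists>u\<in>Univ S. isop u a x \<and> fmem q u \<tau>) \<and>
     (\<exists>v\<in>Univ S. isop v b x \<and> fmem q v \<tau>)))" for q
  define A2 where "A2 q \<longleftrightarrow> (\<exists>a\<in>Ats. \<forall>r\<in>P. le r q \<longrightarrow> (\<forall>x\<in>W. \<not> (\<exists>u\<in>Univ S. isop u a x \<and> fmem r u \<tau>)))" for q
  have A1: "A1 q \<longleftrightarrow> (\<exists>a\<in>Ats. \<exists>b\<in>Ats. a \<noteq> b \<and> (\<exists>x\<in>W. fmem q (op a x) \<tau> \<and> fmem q (op b x) \<tau>))" for q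
    unfolding A1_def by (simp add: one cong: bex_cong)
  have A2: "A2 q \<longleftrightarrow> (\<exists>a\<in>Ats. \<forall>r\<in>P. le r q \<longrightarrow> (\<forall>x\<in>W. \<not> fmem r (op a x) \<tau>))" for q
    unfolding A2_def by (simp add: one cong: bex_cong ball_cong)
  have "\<exists>p\<in>P. \<forall>q\<in>P. le q p \<longrightarrow> \<not> (A1 q \<or> A2 q)"
  proof (rule ccontr)
    assume no: "\<not> ?thesis"
    have "\<exists>g\<in>G. A1 g \<or> A2 g"
    proof (rule G_dense)
      show "dfb S (Univ S) (\<lambda>e. A1 (e 0) \<or> A2 (e 0))" unfolding A1_def A2_def
        by (intro dfbs dfb_bexK[OF subset_refl, of "\<lambda>_. W", OF WU] dfb_ballK[OF subset_refl, of "\<lambda>_. W", OF WU]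
          dballP dPU dfb_isC[OF WC] dfb_isop[OF subset_refl] dfb_fmem[OF subset_refl] dleU \<tau>U AtomsU)
    qed (use no in blast)
    then obtain g where g: "g \<in> G" "A1 g \<or> A2 g" by blast
    from g(2) show False
    proof
      assume "A1 g"
      then obtain a b x where *: "a \<in> Ats" "b \<in> Ats" "a \<noteq> b" "x \<in> W" "fmem g (op a x) \<tau>" "fmem g (op b x) \<tau>"
        unfolding A1 by blast
      have "(vl a, vl x) \<in> graph E f" "(vl b, vl x) \<in> graph E f" using gr * g(1) by blast+
      then have "vl a = vl b" using inj by (auto simp: single_valued_def)
      then show False using vl_atom_inj[OF nA] * by blast
    next
      assume "A2 g"
      then obtain a where a: "a \<in> Ats" "\<And>r x. r \<in> P \<Longrightarrow> le r g \<Longrightarrow> x \<in> W \<Longrightarrow> \<not> fmem r (op a x) \<tau>"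
        unfolding A2 by blast
      have "vl a \<in> Domain (graph E f)" using a(1) dom by blast
      then obtain Y where Y: "(vl a, Y) \<in> graph E f" by blast
      then obtain x where x: "x \<in> W" "Y = vl x" using ran by blast
      obtain q where q: "q \<in> G" "fmem q (op a x) \<tau>" using gr[OF a(1) x(1)] Y x(2) by blast
      obtain r where r: "r \<in> G" "le r g" "le r q" using G_props(4)[OF g(1) q(1)] by blast
      have P: "q \<in> P" "r \<in> P" using q r G_props(1) by auto
      show False using a(2)[OF P(2) r(2) x(1)] fmem_mono[OF q(2) P r(3) nop[OF a(1) x(1)] \<tau>(1)] by blast
    qed
  qed
  then obtain p where p: "p \<in> P" "\<And>q. q \<in> P \<Longrightarrow> le q p \<Longrightarrow> \<not> A1 q \<and> \<not> A2 q" by blast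
  show thesis
  proof (rule that[OF \<tau>(1) p(1)])
    show "\<exists>q\<in>P. le q r \<and> (\<exists>x\<in>W. fmem q (op a x) \<tau>)" if "a \<in> Ats" "r \<in> P" "le r p" for a r
      using p(2)[OF that(2,3)] that(1) unfolding A2 by blast
    show False if "a \<in> Ats" "b \<in> Ats" "a \<noteq> b" "q \<in> P" "le q p" "x \<in> W" "fmem q (op a x) \<tau>" "fmem q (op b x) \<tau>" for a b q x
      using p(2)[OF that(4,5)] that unfolding A1 by blast
  qed
qed

end

section \<open>Absoluteness between \<open>V\<close> and \<open>B\<close>\<close>

context perm_mod
begin

lemma elts_ap: "\<pi> \<in> Perms V \<Longrightarrow> x \<in> Univ V \<Longrightarrow> elts V (ap \<pi> x) = ap \<pi> ` elts V x"
  using ap_set(2) ap_atom(2) atom_empty set_or_atom by (metis image_empty)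

lemma ap_fix_ext:
  assumes p: "\<pi> \<in> Perms V" and x: "is_set V x" and f: "\<And>y. y \<in> elts V x \<Longrightarrow> ap \<pi> y = y"
  shows "ap \<pi> x = x"
  by (rule extens[OF ap_set(1)[OF p x] x]) (use f in \<open>simp add: ap_set(2)[OF p x]\<close>)

lemma BisC_iff: "B.isC K \<longleftrightarrow> K \<subseteq> Univ B \<and> isC K \<and> mk K \<in> Univ B"
proof
  assume "B.isC K"
  then obtain u where u: "is_set B u" "elts B u = K" by (auto simp: B.isC_def)
  then have uB: "u \<in> Univ B" "is_set V u" by (auto simp: is_set_B)
  then have e: "elts V u = K" using elts_B_eq u(2) by blast
  then have "u = mk K" using mk_eqI uB by blast
  then show "K \<subseteq> Univ B \<and> isC K \<and> mk K \<in> Univ B" using uB e B_trans unfolding isC_def by blast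
next
  assume "K \<subseteq> Univ B \<and> isC K \<and> mk K \<in> Univ B"
  then show "B.isC K" using B_set unfolding B.isC_def by blast
qed

lemma Bmk: "B.isC K \<Longrightarrow> B.mk K = mk K"
  using B_set BisC_iff B.mk_eqI by metis

lemma BisC_fixed:
  assumes K: "isC K" "K \<subseteq> Univ B" and C: "C \<subseteq> Ats" "countable_in V C"
    and inv: "\<And>\<pi> y. \<pi> \<in> fixp C \<Longrightarrow> y \<in> K \<Longrightarrow> ap \<pi> y \<in> K"
  shows "B.isC K"
  using B_mk(1)[OF assms] K BisC_iff by blast

lemma Bpr: "a \<in> Univ B \<Longrightarrow> b \<in> Univ B \<Longrightarrow> B.pr a b = pr a b"
proof -
  assume a: "a \<in> Univ B" "b \<in> Univ B"
  have 1: "B.isC {a}" "B.isC {a, b}" using a B.isC_upair B.isC_sing by auto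
  then have "B.isC {B.mk {a}, B.mk {a, b}}" using B.mk(3) B.isC_upair by blast
  then show ?thesis unfolding B.pr_def pr_def using Bmk 1 by metis
qed

lemma pr_inB: "a \<in> Univ B \<Longrightarrow> b \<in> Univ B \<Longrightarrow> pr a b \<in> Univ B"
  using B.pr_props(1) Bpr by metis

lemma pr_inB_iff: "a \<in> Univ V \<Longrightarrow> b \<in> Univ V \<Longrightarrow> pr a b \<in> Univ B \<Longrightarrow> a \<in> Univ B \<and> b \<in> Univ B"
proof -
  assume a: "a \<in> Univ V" "b \<in> Univ V" and p: "pr a b \<in> Univ B"
  have "mk {a, b} \<in> Univ B" using B_trans[OF p] pr_props(3)[OF a] by blast
  then show ?thesis using B_trans mk(2)[OF isC_upair[OF a]] by blast
qed

lemma graph_B: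
  assumes f: "f \<in> Univ B" shows "graph B f = graph V f"
proof -
  have "(a, b) \<in> graph B f \<longleftrightarrow> (a, b) \<in> graph V f" for a b
  proof
    assume "(a, b) \<in> graph B f"
    then have "a \<in> Univ B" "b \<in> Univ B" "B.pr a b \<in> elts V f" using elts_B_eq[OF f] by (auto simp: B.graph_iff)
    then show "(a, b) \<in> graph V f" using Bpr[of a b] BU by (simp add: graph_iff)
  next
    assume g: "(a, b) \<in> graph V f"
    then have *: "a \<in> Univ V" "b \<in> Univ V" "pr a b \<in> elts V f" by (auto simp: graph_iff)
    then have "a \<in> Univ B \<and> b \<in> Univ B" using pr_inB_iff B_trans[OF f] by blast
    then show "(a, b) \<in> graph B f" using * Bpr elts_B_eq[OF f] by (simp add: B.graph_iff)
  qed
  then show ?thesis by auto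
qed

lemma Bprs: "R \<subseteq> Univ B \<times> Univ B \<Longrightarrow> B.prs R = prs R"
  using Bpr unfolding B.prs_def prs_def by (metis (no_types, lifting) mem_Sigma_iff subsetD)

lemma BisR_imp: "B.isR R \<Longrightarrow> isR R"
proof -
  assume R: "B.isR R"
  then have U: "R \<subseteq> Univ B \<times> Univ B" and "B.isC (prs R)" using Bprs[of R] by (auto simp: B.isR_def)
  moreover have "Univ B \<subseteq> Univ V" using BU by blast
  ultimately show "isR R" unfolding isR_def using BisC_iff[of "prs R"] by blast
qed

lemma BisR_intro: "R \<subseteq> Univ B \<times> Univ B \<Longrightarrow> B.isC (prs R) \<Longrightarrow> B.isR R"
  unfolding B.isR_def using Bprs by simp

lemma Brl: "B.isR R \<Longrightarrow> B.rl R = rl R"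
  unfolding B.rl_def rl_def B.isR_def using Bmk[of "prs R"] Bprs[of R] by simp

lemma Bemp: "B.emp = emp"
  unfolding B.emp_def emp_def by (rule Bmk[OF B.isC_empty])

lemma Bsuc: "x \<in> Univ B \<Longrightarrow> B.suc x = suc x"
  unfolding B.suc_def suc_def using Bmk[OF B.isC_insert[OF _ B.isC_elts]] elts_B_eq by simp

lemma ap_suc:
  assumes p: "\<pi> \<in> Perms V" and x: "x \<in> Univ V" shows "ap \<pi> (suc x) = suc (ap \<pi> x)"
  unfolding suc_def by (subst ap_mk(2)[OF p isC_insert[OF x isC_elts[OF x]]]) (simp add: elts_ap[OF p x])

lemma ap_emp: "\<pi> \<in> Perms V \<Longrightarrow> ap \<pi> emp = emp"
  by (rule ap_fix_ext) (simp_all add: emp)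

lemma nats_fixed:
  assumes "n \<in> nats V" shows "n \<in> Univ B" "\<And>\<pi>. \<pi> \<in> Perms V \<Longrightarrow> ap \<pi> n = n"
proof -
  have "n \<in> Univ B \<and> (\<forall>\<pi>\<in>Univ V. \<pi> \<in> Perms V \<longrightarrow> acts V \<pi> n n)"
  proof (rule nat_induct_in[OF _ _ _ assms])
    show "dfb V (Univ V) (\<lambda>e. e 0 \<in> Univ B \<and> (\<forall>\<pi>\<in>Univ V. \<pi> \<in> Perms V \<longrightarrow> acts V \<pi> (e 0) (e 0)))"
      by (intro dfbs dfb_B)
    show "emp \<in> Univ B \<and> (\<forall>\<pi>\<in>Univ V. \<pi> \<in> Perms V \<longrightarrow> acts V \<pi> emp emp)"
      using emp_inB acts_iff_ap emp(1) ap_emp by simp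
    fix n assume n: "n \<in> nats V" "n \<in> Univ B \<and> (\<forall>\<pi>\<in>Univ V. \<pi> \<in> Perms V \<longrightarrow> acts V \<pi> n n)"
    then have "ap \<pi> n = n" if "\<pi> \<in> Perms V" for \<pi> using acts_iff_ap[OF that natsU] Perms_props(1)[OF that] that by metis
    then have "ap \<pi> (suc n) = suc n" if "\<pi> \<in> Perms V" for \<pi> using that ap_suc natsU n(1) by simp
    moreover have "suc n \<in> Univ B" using B.suc(1) Bsuc n(2) by metis
    ultimately show "suc n \<in> Univ B \<and> (\<forall>\<pi>\<in>Univ V. \<pi> \<in> Perms V \<longrightarrow> acts V \<pi> (suc n) (suc n))"
      using acts_iff_ap suc(1) natsU n(1) by simp
  qed
  then show "n \<in> Univ B" "\<And>\<pi>. \<pi> \<in> Perms V \<Longrightarrow> ap \<pi> n = n"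
    using acts_iff_ap natsU[OF assms] Perms_props(1) by metis+
qed

lemma nats_BisC: "B.isC (nats V)"
proof (rule BisC_fixed[OF isC_nats _ _ countable_empty])
  show "nats V \<subseteq> Univ B" using nats_fixed(1) by blast
  show "ap \<pi> y \<in> nats V" if "\<pi> \<in> fixp {}" "y \<in> nats V" for \<pi> y using nats_fixed(2)[OF that(2) fixpD[OF that(1)]] that(2) by simp
qed simp

text \<open>\<open>nats V\<close> is an inductive set of \<open>B\<close>, and every inductive set
  of \<open>B\<close> is inductive in \<open>V\<close>.\<close>

lemma nats_B: "nats B = nats V"
proof
  have "inductive_in B (mk (nats V))"
    unfolding B.inductive_in_iff using B_set[OF isC_nats] nats_BisC BisC_iff Bemp Bsuc emp_nats suc_nats nats_fixed(1) by simp
  moreover have "mk (nats V) \<in> Univ B" "elts B (mk (nats V)) = nats V"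
    using B_set[OF isC_nats] nats_BisC BisC_iff by blast+
  ultimately show "nats B \<subseteq> nats V" unfolding nats_def[of B] by blast
  show "nats V \<subseteq> nats B"
  proof
    fix n assume n: "n \<in> nats V"
    have "n \<in> elts B w" if w: "w \<in> Univ B" "inductive_in B w" for w
    proof -
      have e: "elts B w = elts V w" by (rule elts_B_eq[OF w(1)])
      have "inductive_in V w" using w(2) unfolding B.inductive_in_iff inductive_in_iff e is_set_B Bemp
        using Bsuc B_trans[OF w(1)] by metis
      then show ?thesis using n BU[OF w(1)] unfolding e nats_def by blast
    qed
    then show "n \<in> nats B" using nats_fixed(1)[OF n] unfolding nats_def[of B] by blast
  qed
qed

lemma elts_B_nat: "n \<in> nats V \<Longrightarrow> elts B n = elts V n"
  using elts_B_eq nats_fixed by blast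

lemma countable_B_imp: "countable_in B K \<Longrightarrow> countable_in V K"
  unfolding B.countable_in_iff countable_in_iff nats_B using BisR_imp by blast

lemma finite_B_imp: "finite_in B K \<Longrightarrow> finite_in V K"
  unfolding B.finite_in_iff finite_in_iff nats_B using BisR_imp elts_B_nat by metis

lemma AtsB: "Ats \<subseteq> Univ B"
  using atom_inB by (auto simp: atom_def)

text \<open>A permutation fixing \<open>K\<close> pointwise fixes every pair of an atom of
  \<open>K\<close> and a natural number, so \<open>K\<close> supports the relation. This is why
  countability and finiteness of sets of atoms are absolute.\<close>

lemma BisR_atoms_nats:
  assumes K: "K \<subseteq> Ats" "countable_in V K" and R: "isR R" "Domain R = K" "Range R \<subseteq> nats V"
  shows "B.isR R"
proof (rule BisR_intro)
  show RB: "R \<subseteq> Univ B \<times> Univ B"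
  proof (rule subrelI)
    fix a n assume an: "(a, n) \<in> R"
    then have "a \<in> Ats" "n \<in> nats V" using R(2,3) K(1) by auto
    then show "(a, n) \<in> Univ B \<times> Univ B" using AtsB nats_fixed(1) by blast
  qed
  show "B.isC (prs R)"
  proof (rule BisC_fixed[OF _ _ K])
    show "isC (prs R)" using R(1) by (simp add: isR_def)
    show "prs R \<subseteq> Univ B" using RB pr_inB by (auto simp: prs_def)
    fix \<pi> y assume p: "\<pi> \<in> fixp K" "y \<in> prs R"
    then obtain a n where a: "y = pr a n" "(a, n) \<in> R" by (auto simp: prs_def)
    have "ap \<pi> a = a" using p a(2) R(2) by (auto simp: fixp_def)
    moreover have "ap \<pi> n = n" using nats_fixed(2)[OF _ fixpD[OF p(1)]] a(2) R(3) by blast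
    ultimately show "ap \<pi> y \<in> prs R" using ap_pr[OF fixpD[OF p(1)]] isR_U[OF R(1) a(2)] a p(2) by simp
  qed
qed

lemma countable_B: "K \<subseteq> Ats \<Longrightarrow> countable_in V K \<Longrightarrow> countable_in B K"
  using BisR_atoms_nats unfolding B.countable_in_iff nats_B by (metis countable_in_iff)

lemma finite_B: "K \<subseteq> Ats \<Longrightarrow> finite_in V K \<Longrightarrow> finite_in B K"
proof -
  assume K: "K \<subseteq> Ats" "finite_in V K"
  then obtain n R where R: "n \<in> nats V" "isR R" "single_valued R" "single_valued (R\<inverse>)" "Domain R = K" "Range R \<subseteq> elts V n"
    by (auto simp: finite_in_iff)
  have "B.isR R" using R nats_elts by (intro BisR_atoms_nats[OF K(1) finite_countable[OF K(2)]]) auto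
  then show ?thesis unfolding B.finite_in_iff nats_B using R elts_B_nat by metis
qed

lemma bits_B: "bits B = {emp, suc emp}"
proof -
  have s: "is_set B (suc emp)" "elts B (suc emp) = {emp}"
    using B.suc(2,3)[OF B.emp(1)] B.emp(3) Bemp Bsuc emp_inB by auto
  have "is_one B b \<longleftrightarrow> b = suc emp" for b
    unfolding is_one_def B.is_zero_iff Bemp using s B.extens by auto
  then show ?thesis unfolding bits_def B.is_zero_iff Bemp by auto
qed

section \<open>Conditions\<close>

lemma QQ_props:
  assumes h: "h \<in> QQ B"
  shows "h \<in> Univ B" "is_set V h" "single_valued (graph V h)" "fun_in B h (Domain (graph V h)) (bits B)"
    "Domain (graph V h) \<subseteq> nats V" "Range (graph V h) \<subseteq> {emp, suc emp}" "elts V h = prs (graph V h)" "graph B h = graph V h"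
proof -
  obtain D where D: "h \<in> Univ B" "D \<subseteq> nats B" "fun_in B h D (bits B)" using h by (auto simp: QQ_def)
  show g: "graph B h = graph V h" by (rule graph_B[OF D(1)])
  have f: "is_set B h" "single_valued (graph V h)" "Domain (graph V h) = D" "Range (graph V h) \<subseteq> bits B"
    using D(3) unfolding fun_in_def g by auto
  show "h \<in> Univ B" by fact
  show "is_set V h" using f(1) is_set_B by blast
  show "single_valued (graph V h)" by fact
  show "fun_in B h (Domain (graph V h)) (bits B)" using D f by simp
  show "Domain (graph V h) \<subseteq> nats V" using D f nats_B by simp
  show "Range (graph V h) \<subseteq> {emp, suc emp}" using f bits_B by simp
  obtain R where R: "B.isR R" "h = B.rl R" using D(3) unfolding B.fun_in_iff by blast
  have "h = rl R" using R Brl by simp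
  then show "elts V h = prs (graph V h)" using rl[OF BisR_imp[OF R(1)]] by simp
qed

lemma QQ_fixed: assumes "h \<in> QQ B" "\<pi> \<in> Perms V" shows "ap \<pi> h = h"
proof (rule ap_fix_ext[OF assms(2)])
  note q = QQ_props[OF assms(1)]
  show "is_set V h" by (rule q)
  fix y assume "y \<in> elts V h"
  then obtain n b where y: "y = pr n b" "(n, b) \<in> graph V h" using q(7) by (auto simp: prs_def)
  have "n \<in> nats V" "b \<in> nats V" using y(2) q(5,6) emp_nats suc_nats by blast+
  then show "ap \<pi> y = y" using y(1) ap_pr[OF assms(2)] natsU nats_fixed(2)[OF _ assms(2)] by simp
qed

lemma QQ_eqI: "h \<in> QQ B \<Longrightarrow> h' \<in> QQ B \<Longrightarrow> graph V h = graph V h' \<Longrightarrow> h = h'"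
  using QQ_props(2,7) extens by metis

lemma II_iff: "h \<in> QQ B \<Longrightarrow> h \<in> II B \<longleftrightarrow> emp \<in> Range (graph V h)"
  unfolding II_def B.is_zero_iff Bemp using QQ_props(8) by auto

text \<open>Outside \<open>II\<close> an element of \<open>Q\<close> has the value 1 throughout its
  domain, so the domain determines it.\<close>

lemma QQ_not_II: 
  assumes "h \<in> QQ B" "h' \<in> QQ B" "h \<notin> II B" "h' \<notin> II B" "Domain (graph V h) = Domain (graph V h')"
  shows "h = h'"
proof (rule QQ_eqI[OF assms(1,2)])
  have *: "graph V k = Domain (graph V k) \<times> {suc emp}" if "k \<in> QQ B" "k \<notin> II B" for k
  proof (intro equalityI subrelI)
    fix x y assume xy: "(x, y) \<in> graph V k"
    then show "(x, y) \<in> Domain (graph V k) \<times> {suc emp}"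
      using that(2) QQ_props(6)[OF that(1)] II_iff[OF that(1)] by auto
  next
    fix x y assume "(x, y) \<in> Domain (graph V k) \<times> {suc emp}"
    then obtain z where z: "(x, z) \<in> graph V k" "y = suc emp" by auto
    then have "z = suc emp" using that(2) QQ_props(6)[OF that(1)] II_iff[OF that(1)] by auto
    then show "(x, y) \<in> graph V k" using z by simp
  qed
  show "graph V h = graph V h'" using *[OF assms(1,3)] *[OF assms(2,4)] assms(5) by simp
qed

text \<open>This recovers values of a weaker condition from those of a stronger one: fibres of the
  stronger condition refine fibres of the weaker one.\<close>

lemma QQ_restrict:
  assumes "h \<in> QQ B" "h' \<in> QQ B" "g \<in> QQ B" "graph V h \<subseteq> graph V g" "graph V h' \<subseteq> graph V g"
    "Domain (graph V h) = Domain (graph V h')"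
  shows "h = h'"
proof (rule QQ_eqI[OF assms(1,2)])
  have s: "single_valued (graph V g)" by (rule QQ_props(3)[OF assms(3)])
  have *: "graph V k \<subseteq> graph V k'" if kk: "graph V k \<subseteq> graph V g" "graph V k' \<subseteq> graph V g" "Domain (graph V k) = Domain (graph V k')" for k k'
  proof (rule subrelI)
    fix x y assume xy: "(x, y) \<in> graph V k"
    then obtain z where z: "(x, z) \<in> graph V k'" using kk(3) by blast
    have "y = z" using single_valuedD[OF s] xy z kk(1,2) by blast
    then show "(x, y) \<in> graph V k'" using z by simp
  qed
  show "graph V h = graph V h'" using *[OF assms(4,5,6)] *[OF assms(5,4) assms(6)[symmetric]] by blast
qed

text \<open>The value \<open>f(a)\<close> for a condition \<open>f\<close>.\<close>

definition pv :: "'a \<Rightarrow> 'a \<Rightarrow> 'a" where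
  "pv f a = (THE h. (a, h) \<in> graph V f)"

lemma PPn_props:
  assumes f: "f \<in> PPn B n" and n: "n \<in> nats V"
  shows "f \<in> Univ B" "\<And>a h. (a, h) \<in> graph V f \<longleftrightarrow> a \<in> Ats \<and> h = pv f a"
    "\<And>a. a \<in> Ats \<Longrightarrow> pv f a \<in> QQ B" "\<And>a. a \<in> Ats \<Longrightarrow> Domain (graph V (pv f a)) = elts V n"
    "countable_in V {a \<in> Ats. pv f a \<in> II B}"
    "\<And>t. fun_in B t (elts V n) (bits B) \<Longrightarrow> \<not> finite_in V {a \<in> Ats. pv f a = t}"
    "elts V f = prs (graph V f)" "is_set V f"
proof -
  show fB: "f \<in> Univ B" using f by (simp add: PPn_def)
  have g: "graph B f = graph V f" by (rule graph_B[OF fB])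
  have fi: "fun_in B f Ats (QQ B)" using f by (simp add: PPn_def B_simps elts_B_Atoms)
  then have f1: "is_set B f" "single_valued (graph V f)" "Domain (graph V f) = Ats" "Range (graph V f) \<subseteq> QQ B"
    unfolding fun_in_def g by auto
  show "is_set V f" using f1 is_set_B by blast
  have pv: "(a, pv f a) \<in> graph V f" if a: "a \<in> Ats" for a
  proof -
    obtain h where h: "(a, h) \<in> graph V f" using a unfolding f1(3)[symmetric] by blast
    show ?thesis unfolding pv_def by (rule theI[where P="\<lambda>h. (a, h) \<in> graph V f", OF h]) (rule single_valuedD[OF f1(2) _ h])
  qed
  show gr: "(a, h) \<in> graph V f \<longleftrightarrow> a \<in> Ats \<and> h = pv f a" for a h
  proof
    assume h: "(a, h) \<in> graph V f"
    then have a: "a \<in> Ats" unfolding f1(3)[symmetric] by blast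
    show "a \<in> Ats \<and> h = pv f a" using a single_valuedD[OF f1(2) h pv[OF a]] by simp
  qed (use pv in blast)
  show Q: "pv f a \<in> QQ B" if "a \<in> Ats" for a using pv[OF that] f1(4) by blast
  show "Domain (graph V (pv f a)) = elts V n" if "a \<in> Ats" for a
  proof -
    have "\<forall>(a, h)\<in>graph V f. Domain (graph B h) = elts B n" using f unfolding PPn_def g mem_Collect_eq by (elim conjE)
    from bspec[OF this pv[OF that]] have "Domain (graph B (pv f a)) = elts B n" by simp
    then show ?thesis using QQ_props(8)[OF Q[OF that]] elts_B_nat[OF n] by simp
  qed
  have "countable_in B {a. \<exists>h\<in>II B. (a, h) \<in> graph B f}" using f by (simp add: PPn_def)
  moreover have "{a. \<exists>h\<in>II B. (a, h) \<in> graph B f} = {a \<in> Ats. pv f a \<in> II B}" unfolding g gr by blast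
  ultimately show "countable_in V {a \<in> Ats. pv f a \<in> II B}" using countable_B_imp by simp
  show "\<not> finite_in V {a \<in> Ats. pv f a = t}" if t: "fun_in B t (elts V n) (bits B)" for t
  proof
    assume "finite_in V {a \<in> Ats. pv f a = t}"
    then have "finite_in B {a \<in> Ats. pv f a = t}" by (intro finite_B) auto
    moreover have "{a \<in> Ats. pv f a = t} = {a. (a, t) \<in> graph B f}" unfolding g gr by blast
    moreover have "t \<in> Univ B" using B.fun_inU[OF t] .
    ultimately show False using f t elts_B_nat[OF n] by (auto simp: PPn_def)
  qed
  obtain R where R: "B.isR R" "f = B.rl R" using fi unfolding B.fun_in_iff by blast
  have "f = rl R" using R Brl by simp
  then show "elts V f = prs (graph V f)" using rl[OF BisR_imp[OF R(1)]] by simp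
qed

lemma P_le_iff:
  assumes "f \<in> PPn B n" "n \<in> nats V" "g \<in> PPn B m" "m \<in> nats V"
  shows "P_le B f g \<longleftrightarrow> (\<forall>a\<in>Ats. graph V (pv g a) \<subseteq> graph V (pv f a))"
proof -
  note F = PPn_props[OF assms(1,2)] and G = PPn_props[OF assms(3,4)]
  have gf: "graph B f = graph V f" and gg: "graph B g = graph V g" using graph_B F(1) G(1) by auto
  show ?thesis unfolding P_le_def Q_le_def gf gg F(2) G(2)
    using QQ_props(8)[OF F(3)] QQ_props(8)[OF G(3)] by (simp add: Ball_def)
qed

text \<open>The values of \<open>v\<close> are fixed by all permutations, so a countable
  \<open>C\<close> under which the arguments may be moved freely supports the function and puts it
  into \<open>B\<close>. The clauses on cardinality are checked in \<open>V\<close>, where they mean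
  the same for sets of atoms.\<close>

lemma PPn_intro:
  assumes n: "n \<in> nats V" and R: "isR {(a, h). a \<in> Ats \<and> h = v a}"
    and C: "C \<subseteq> Ats" "countable_in V C" "\<And>\<pi> a. \<pi> \<in> fixp C \<Longrightarrow> a \<in> Ats \<Longrightarrow> v (ap \<pi> a) = v a"
    and Q: "\<And>a. a \<in> Ats \<Longrightarrow> v a \<in> QQ B" "\<And>a. a \<in> Ats \<Longrightarrow> Domain (graph V (v a)) = elts V n"
    and I: "countable_in V {a \<in> Ats. v a \<in> II B}"
    and t: "\<And>t. fun_in B t (elts V n) (bits B) \<Longrightarrow> \<not> finite_in V {a \<in> Ats. v a = t}"
  obtains f where "f \<in> PPn B n" "\<And>a. a \<in> Ats \<Longrightarrow> pv f a = v a"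
proof -
  let ?R = "{(a, h). a \<in> Ats \<and> h = v a}"
  have RB: "?R \<subseteq> Univ B \<times> Univ B" using AtsB Q(1) QQ_props(1) by auto
  have BR: "B.isR ?R"
  proof (rule BisR_intro[OF RB BisC_fixed[OF _ _ C(1,2)]])
    show "isC (prs ?R)" using R by (simp add: isR_def)
    show "prs ?R \<subseteq> Univ B" using RB pr_inB by (auto simp: prs_def)
    fix \<pi> y assume p: "\<pi> \<in> fixp C" "y \<in> prs ?R"
    then obtain a where a: "a \<in> Ats" "y = pr a (v a)" by (auto simp: prs_def)
    have pP: "\<pi> \<in> Perms V" by (rule fixpD[OF p(1)])
    have "ap \<pi> y = pr (ap \<pi> a) (v a)"
      using a ap_pr[OF pP] AtsB BU QQ_props(1) Q(1) QQ_fixed[OF _ pP] by (metis subsetD)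
    moreover have "ap \<pi> a \<in> Ats" using ap_atom(2)[OF pP] a(1) by (simp add: atom_def)
    ultimately show "ap \<pi> y \<in> prs ?R" using C(3)[OF p(1) a(1)] unfolding prs_def by force
  qed
  let ?f = "B.rl ?R"
  have g: "graph B ?f = ?R" "?f \<in> Univ B" using B.rl[OF BR] by auto
  have gV: "graph V ?f = ?R" using g graph_B by simp
  have pv: "pv ?f a = v a" if "a \<in> Ats" for a unfolding pv_def gV using that by simp
  have "?f \<in> PPn B n" unfolding PPn_def g(1) B_simps elts_B_Atoms elts_B_nat[OF n]
  proof (intro CollectI conjI ballI impI)
    show "?f \<in> Univ B" by (rule g)
    show "fun_in B ?f Ats (QQ B)" by (rule B.fun_in_rl[OF BR]) (use Q(1) in \<open>auto simp: single_valued_def\<close>)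
    show "case x of (a, h) \<Rightarrow> Domain (graph B h) = elts V n" if x: "x \<in> graph B ?f" for x
    proof -
      obtain a where a: "x = (a, v a)" "a \<in> Ats" using x unfolding g(1) by auto
      show ?thesis using Q(2)[OF a(2)] QQ_props(8)[OF Q(1)[OF a(2)]] a(1) by simp
    qed
    have "{a. \<exists>h\<in>II B. (a, h) \<in> ?R} = {a \<in> Ats. v a \<in> II B}" by auto
    then show "countable_in B {a. \<exists>h\<in>II B. (a, h) \<in> graph B ?f}" unfolding g(1) using I countable_B[of "{a \<in> Ats. v a \<in> II B}"] by auto
    fix u assume "u \<in> Univ B" "fun_in B u (elts V n) (bits B)"
    then have "\<not> finite_in V {a \<in> Ats. v a = u}" using t by blast
    moreover have "{a. (a, u) \<in> ?R} = {a \<in> Ats. v a = u}" by auto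
    ultimately show "\<not> finite_in B {a. (a, u) \<in> graph B ?f}" unfolding g(1) using finite_B_imp by auto
  qed
  then show thesis using that pv by blast
qed

lemma PP_obtain:
  assumes "f \<in> PP B" obtains n where "n \<in> nats V" "f \<in> PPn B n"
  using assms nats_B by (auto simp: PP_def)

lemma prs_mono_B: "R \<subseteq> R' \<Longrightarrow> B.prs R \<subseteq> B.prs R'"
  unfolding B.prs_def by blast

text \<open>Conditions are subsets of a product that is itself a set of \<open>B\<close>, so power
  set and separation in \<open>B\<close> apply.\<close>

lemma PP_BisC: "B.isC (PP B)"
proof -
  have b: "B.isC (bits B)" unfolding bits_B using B.isC_upair B.emp(1) B.suc(1) Bemp Bsuc emp_inB by metis
  let ?Q = "{h. is_set B h \<and> elts B h \<subseteq> B.prs (nats V \<times> bits B)}"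
  have Q: "B.isC ?Q" by (intro B.isC_Pow B.isC_prod nats_BisC b)
  let ?P = "{f. is_set B f \<and> elts B f \<subseteq> B.prs (elts B (Atoms B) \<times> ?Q)}"
  have P: "B.isC ?P" by (intro B.isC_Pow B.isC_prod Q B.isC_elts B.AtomsU)
  have *: "is_set B f \<and> elts B f \<subseteq> B.prs (A \<times> L)" if f: "fun_in B f A L" for f A L
  proof -
    obtain R where "B.isR R" "f = B.rl R" "Domain R = A" "Range R \<subseteq> L" using f unfolding B.fun_in_iff by blast
    then show ?thesis using B.rl[of R] by (auto simp: B.prs_def)
  qed
  have q: "QQ B \<subseteq> ?Q"
  proof
    fix h assume "h \<in> QQ B"
    then obtain D where "D \<subseteq> nats B" "fun_in B h D (bits B)" by (auto simp: QQ_def)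
    moreover from this have "B.prs (D \<times> bits B) \<subseteq> B.prs (nats V \<times> bits B)" using nats_B by (intro prs_mono_B) blast
    ultimately show "h \<in> ?Q" using *[of h D "bits B"] by blast
  qed
  have "PP B \<subseteq> ?P"
  proof
    fix f assume "f \<in> PP B"
    then have "fun_in B f (elts B (Atoms B)) (QQ B)" by (auto simp: PP_def PPn_def)
    moreover have "B.prs (elts B (Atoms B) \<times> QQ B) \<subseteq> B.prs (elts B (Atoms B) \<times> ?Q)" using q by (intro prs_mono_B) blast
    ultimately show "f \<in> ?P" using *[of f "elts B (Atoms B)" "QQ B"] by blast
  qed
  then show ?thesis by (rule B.isC_subset[OF P]) (intro B.dfb_PP[OF subset_refl] tm_intros)
qed

lemma forcing_B:
  assumes "generic_filter B (PP B) (P_le B) G"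
  shows "forcing B (PP B) (P_le B) G"
proof unfold_locales
  show "B.isC (PP B)" by (rule PP_BisC)
  show "dfb B X (\<lambda>e. t e \<in> PP B)" if "X \<subseteq> Univ B" "tm B X t" for X t using B.dfb_PP that by blast
  show "dfb B X (\<lambda>e. P_le B (t e) (u e))" if "X \<subseteq> Univ B" "tm B X t" "tm B X u" for X t u using B.dfb_P_le that by blast
  show "P_le B p p" if p: "p \<in> PP B" for p
  proof -
    obtain n where "n \<in> nats V" "p \<in> PPn B n" using p by (rule PP_obtain)
    then show ?thesis using P_le_iff by blast
  qed
  show "P_le B p r" if pqr: "p \<in> PP B" "q \<in> PP B" "r \<in> PP B" and le: "P_le B p q" "P_le B q r" for p q r
  proof -
    obtain n where n: "n \<in> nats V" "p \<in> PPn B n" using pqr(1) by (rule PP_obtain)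
    obtain m where m: "m \<in> nats V" "q \<in> PPn B m" using pqr(2) by (rule PP_obtain)
    obtain k where k: "k \<in> nats V" "r \<in> PPn B k" using pqr(3) by (rule PP_obtain)
    show ?thesis using le unfolding P_le_iff[OF n(2,1) m(2,1)] P_le_iff[OF m(2,1) k(2,1)] P_le_iff[OF n(2,1) k(2,1)]
      by blast
  qed
  show "generic_filter B (PP B) (P_le B) G" by fact
qed

lemma ap_PP: "\<pi> \<in> Perms V \<Longrightarrow> p \<in> PP B \<Longrightarrow> ap \<pi> p \<in> PP B"
proof -
  assume p: "\<pi> \<in> Perms V" "p \<in> PP B"
  have "dfb B {} (\<lambda>e. e 0 \<in> PP B)" by (intro B.dfb_PP empty_subsetI tm_intros)
  from dfb_invariant[OF this empty_subsetI p(1), of "\<lambda>_. p"] show ?thesis using p(2) B.PPU by auto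
qed

end

section \<open>Transpositions and canonical names of natural numbers\<close>

context perm_mod
begin

lemma ex_transposition:
  assumes a: "a \<in> Ats" "b \<in> Ats"
  obtains \<pi> where "\<pi> \<in> Perms V" "ap \<pi> a = b" "ap \<pi> b = a"
    "\<And>c. c \<in> Ats \<Longrightarrow> c \<noteq> a \<Longrightarrow> c \<noteq> b \<Longrightarrow> ap \<pi> c = c"
proof -
  have U: "a \<in> Univ V" "b \<in> Univ V" using a AtsU by auto
  let ?R = "{(c, d). c \<in> Ats \<and> ((c = a \<and> d = b) \<or> (c = b \<and> d = a) \<or> (c \<noteq> a \<and> c \<noteq> b \<and> d = c))}"
  have R: "isR ?R"
  proof (rule isR_dfb[OF isC_Ats isC_Ats])
    show "dfb V (Univ V) (\<lambda>e. (e 0, e 1) \<in> ?R)" unfolding mem_Collect_eq case_prod_conv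
      by (intro dfbs U AtomsU)
  qed (use a in auto)
  have p: "rl ?R \<in> Perms V"
  proof (rule rl_Perms[OF R])
    show "single_valued ?R" "single_valued (?R\<inverse>)" by (auto simp: single_valued_def)
    show "Domain ?R = Ats" by auto
    show "Range ?R = Ats" using a by auto
  qed
  have g: "ap (rl ?R) c = d" if "(c, d) \<in> ?R" for c d
  proof -
    have "atom V c" using that by (simp add: atom_def)
    then show ?thesis using ap_atom(1)[OF p] that rl(4)[OF R] by simp
  qed
  show thesis by (rule that[OF p]) (rule g, use a in simp)+
qed

text \<open>\<open>W\<close> is the set of canonical names of natural numbers, generated from \<open>\<emptyset>\<close> by
  \<open>x \<mapsto> x \<union> {x} \<times> P\<close>.  It is built in \<open>V\<close>, where recursion is available.\<close>

lemma ex_W: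
  obtains W where "isC W" "W \<subseteq> Univ B" "emp \<in> W" "\<And>x \<pi>. x \<in> W \<Longrightarrow> \<pi> \<in> Perms V \<Longrightarrow> ap \<pi> x = x"
    "\<And>x. x \<in> W \<Longrightarrow> is_set V x" "\<And>x z. x \<in> W \<Longrightarrow> z \<in> elts V x \<Longrightarrow> \<exists>\<sigma>\<in>W. \<exists>p\<in>PP B. z = pr \<sigma> p"
    "\<And>x. x \<in> W \<Longrightarrow> mk (elts V x \<union> prs ({x} \<times> PP B)) \<in> W"
proof -
  have PC: "isC (PP B)" using PP_BisC BisC_iff by blast
  have PB: "PP B \<subseteq> Univ B" using B.PPU by blast
  obtain m where m: "m \<in> Univ V" "PP B = elts V m" using isC_iff[OF PC] by blast
  define H where "H x = mk (elts V x \<union> prs ({x} \<times> PP B))" for x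
  have i: "isC (elts V x \<union> prs ({x} \<times> PP B))" if "x \<in> Univ V" for x
    by (intro isC_Un isC_elts isC_prod isC_sing PC that)
  note Hm = mk[OF i, folded H_def]
  have dH: "dfb V (Univ V) (\<lambda>e. e 0 = H (e 1))"
  proof (rule dfb_cong[where Q="\<lambda>e. is_set V (e 0) \<and> (\<forall>z\<in>Univ V. z \<in> elts V (e 0) \<longleftrightarrow> z \<in> elts V (e 1) \<or> (\<exists>p\<in>elts V m. is_opair V z (e 1) p))"])
    show "dfb V (Univ V) (\<lambda>e. is_set V (e 0) \<and> (\<forall>z\<in>Univ V. z \<in> elts V (e 0) \<longleftrightarrow> z \<in> elts V (e 1) \<or> (\<exists>p\<in>elts V m. is_opair V z (e 1) p)))"
      by (intro dfbs m)
    fix e :: "nat \<Rightarrow> 'a" assume e: "range e \<subseteq> Univ V"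
    then have e1: "e 1 \<in> Univ V" by auto
    note h = Hm[OF this]
    have o: "(\<exists>p\<in>elts V m. is_opair V z (e 1) p) \<longleftrightarrow> z \<in> prs ({e 1} \<times> PP B)" for z
      unfolding m(2) is_opair_iff prs_def using e1 eltsU by blast
    have U: "elts V (e 1) \<union> prs ({e 1} \<times> PP B) \<subseteq> Univ V" by (rule isC_sub_Univ[OF i[OF e1]])
    have "elts V (e 0) = elts V (e 1) \<union> prs ({e 1} \<times> PP B) \<longleftrightarrow>
      (\<forall>z\<in>Univ V. z \<in> elts V (e 0) \<longleftrightarrow> z \<in> elts V (e 1) \<or> (\<exists>p\<in>elts V m. is_opair V z (e 1) p))"
      unfolding o using U eltsU'[of "e 0"] by blast
    moreover have "e 0 = H (e 1) \<longleftrightarrow> is_set V (e 0) \<and> elts V (e 0) = elts V (e 1) \<union> prs ({e 1} \<times> PP B)"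
    proof
      assume "is_set V (e 0) \<and> elts V (e 0) = elts V (e 1) \<union> prs ({e 1} \<times> PP B)"
      then show "e 0 = H (e 1)" unfolding H_def by (intro mk_eqI) simp_all
    qed (simp only: h simp_thms)
    ultimately show "(e 0 = H (e 1)) = (is_set V (e 0) \<and> (\<forall>z\<in>Univ V. z \<in> elts V (e 0) \<longleftrightarrow> z \<in> elts V (e 1) \<or> (\<exists>p\<in>elts V m. is_opair V z (e 1) p)))"
      by simp
  qed
  obtain R where R: "isR R" "single_valued R" "Domain R = nats V" "(emp, emp) \<in> R"
    "\<And>n y. (n, y) \<in> R \<Longrightarrow> (suc n, H y) \<in> R"
    using nat_recursion[OF Hm(3) emp(1) dH] by blast
  define W where "W = Range R"
  have WC: "isC W" unfolding W_def by (rule isC_field(2)[OF R(1)])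
  have pP: "ap \<pi> ` PP B = PP B" if p: "\<pi> \<in> Perms V" for \<pi>
  proof
    show "ap \<pi> ` PP B \<subseteq> PP B" using ap_PP[OF p] by blast
    show "PP B \<subseteq> ap \<pi> ` PP B"
    proof
      fix q assume q: "q \<in> PP B"
      have "ap (inv_perm \<pi>) q \<in> PP B" by (rule ap_PP[OF inv_perm(1)[OF p] q])
      then show "q \<in> ap \<pi> ` PP B" using ap_inverse(2)[OF p] BU PB q by (metis imageI subsetD)
    qed
  qed
  have step: "H x \<in> Univ B \<and> (\<forall>\<pi>\<in>Perms V. ap \<pi> (H x) = H x)" if x: "x \<in> Univ B" and f: "\<And>\<pi>. \<pi> \<in> Perms V \<Longrightarrow> ap \<pi> x = x" for x
  proof -
    have xU: "x \<in> Univ V" by (rule BU[OF x])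
    have inv: "ap \<pi> y \<in> elts V x \<union> prs ({x} \<times> PP B)" if p: "\<pi> \<in> Perms V" and y: "y \<in> elts V x \<union> prs ({x} \<times> PP B)" for \<pi> y
      using y
    proof
      assume "y \<in> elts V x"
      then have "ap \<pi> y \<in> elts V (ap \<pi> x)" using ap_mem[OF p xU eltsU] by blast
      then show ?thesis using f[OF p] by simp
    next
      assume "y \<in> prs ({x} \<times> PP B)"
      then obtain q where q: "q \<in> PP B" "y = pr x q" by (auto simp: prs_def)
      then have "ap \<pi> y = pr x (ap \<pi> q)" using ap_pr[OF p xU] BU PB f[OF p] by auto
      then show ?thesis using ap_PP[OF p q(1)] unfolding prs_def by blast
    qed
    have s: "elts V x \<union> prs ({x} \<times> PP B) \<subseteq> Univ B"
      using B_trans[OF x] pr_inB[OF x] PB by (auto simp: prs_def)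
    have "H x \<in> Univ B \<and> supp {} (H x)" unfolding H_def
      using B_mk[OF i[OF xU] s _ countable_empty] inv fixpD by blast
    then show ?thesis by (auto simp: supp_def fixp_def)
  qed
  let ?I = "\<lambda>x. x \<in> Univ B \<and> is_set V x \<and> (\<forall>\<pi>\<in>Univ V. \<pi> \<in> Perms V \<longrightarrow> acts V \<pi> x x) \<and>
     (\<forall>z\<in>elts V x. \<exists>\<sigma>\<in>Univ V. \<sigma> \<in> W \<and> (\<exists>p\<in>elts V m. is_opair V z \<sigma> p))"
  have inv: "\<forall>x\<in>Univ V. (n, x) \<in> R \<longrightarrow> ?I x" if "n \<in> nats V" for n
  proof (rule nat_induct_in[OF _ _ _ that])
    show "dfb V (Univ V) (\<lambda>e. \<forall>x\<in>Univ V. (e 0, x) \<in> R \<longrightarrow> ?I x)"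
      by (intro dfbs dfb_isR R dfb_B dfb_isC[OF WC] m)
    have "x = emp" if "(emp, x) \<in> R" for x by (rule single_valuedD[OF R(2) that R(4)])
    then show "\<forall>x\<in>Univ V. (emp, x) \<in> R \<longrightarrow> ?I x"
      using emp emp_inB acts_iff_ap[OF _ emp(1)] ap_emp by auto
    fix n assume n: "n \<in> nats V" and IH: "\<forall>x\<in>Univ V. (n, x) \<in> R \<longrightarrow> ?I x"
    show "\<forall>x\<in>Univ V. (suc n, x) \<in> R \<longrightarrow> ?I x"
    proof (intro ballI impI)
      fix x assume x: "(suc n, x) \<in> R"
      obtain y where y: "(n, y) \<in> R" using n unfolding R(3)[symmetric] by blast
      have xH: "x = H y" by (rule single_valuedD[OF R(2) x R(5)[OF y]])
      have yU: "y \<in> Univ V" using isR_U[OF R(1) y] by blast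
      have yW: "y \<in> W" using y W_def by blast
      have I: "y \<in> Univ B" "\<And>\<pi>. \<pi> \<in> Perms V \<Longrightarrow> ap \<pi> y = y"
        "\<forall>z\<in>elts V y. \<exists>\<sigma>\<in>Univ V. \<sigma> \<in> W \<and> (\<exists>p\<in>elts V m. is_opair V z \<sigma> p)"
        using IH y yU acts_iff_ap[OF _ yU] Perms_props(1) by auto
      have 1: "x \<in> Univ B" "\<forall>\<pi>\<in>Perms V. ap \<pi> x = x" using step[OF I(1,2)] xH by auto
      have 2: "\<forall>\<pi>\<in>Univ V. \<pi> \<in> Perms V \<longrightarrow> acts V \<pi> x x" using 1 acts_iff_ap[OF _ BU[OF 1(1)]] by simp
      have 3: "\<forall>z\<in>elts V x. \<exists>\<sigma>\<in>Univ V. \<sigma> \<in> W \<and> (\<exists>p\<in>elts V m. is_opair V z \<sigma> p)"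
      proof
        fix z assume "z \<in> elts V x"
        then consider "z \<in> elts V y" | "z \<in> prs ({y} \<times> PP B)" using Hm(2)[OF yU] xH by blast
        then show "\<exists>\<sigma>\<in>Univ V. \<sigma> \<in> W \<and> (\<exists>p\<in>elts V m. is_opair V z \<sigma> p)"
        proof cases
          case 1
          then show ?thesis using I(3) by blast
        next
          case 2
          then show ?thesis using yU yW eltsU unfolding prs_def m(2) is_opair_iff by blast
        qed
      qed
      show "?I x"
        using 1(1) 2 3 Hm(1)[OF yU] xH by blast
    qed
  qed
  have WI: "?I x" if "x \<in> W" for x
  proof -
    have "\<exists>n. (n, x) \<in> R" using that unfolding W_def by blast
    then obtain n where n: "(n, x) \<in> R" ..
    have "n \<in> nats V" using n unfolding R(3)[symmetric] by blast
    then show ?thesis using inv n isR_U[OF R(1) n] by blast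
  qed
  show thesis
  proof (rule that[OF WC])
    show "W \<subseteq> Univ B" using WI by blast
    show "emp \<in> W" using R(4) W_def by blast
    show "ap \<pi> x = x" if "x \<in> W" "\<pi> \<in> Perms V" for x \<pi>
      using WI[OF that(1)] acts_iff_ap[OF that(2) BU, of x x] Perms_props(1)[OF that(2)] that(2) by metis
    show "is_set V x" if "x \<in> W" for x using WI[OF that] by blast
    show "\<exists>\<sigma>\<in>W. \<exists>p\<in>PP B. z = pr \<sigma> p" if "x \<in> W" "z \<in> elts V x" for x z
      using WI[OF that(1)] that(2) unfolding m(2) is_opair_iff by blast
    show "mk (elts V x \<union> prs ({x} \<times> PP B)) \<in> W" if "x \<in> W" for x
      using that R(5) unfolding W_def H_def by blast
  qed
qed

end

section \<open>Uncountability of the atoms\<close>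

locale ext = perm_mod V for V :: "'a str" +
  fixes G :: "'a set"
  assumes AC_V: "AC V" and uncountable: "\<not> countable_in V Ats"
    and gen: "generic_filter B (PP B) (P_le B) G"
begin

sublocale Fo: forcing B "PP B" "P_le B" G
  by (rule forcing_B[OF gen])

lemma ex_outside: "countable_in V X \<Longrightarrow> \<exists>a\<in>Ats. a \<notin> X"
  using uncountable countable_subset[OF _ isC_Ats] by blast

lemma finite_empty: "finite_in V {}"
  using finite_subset[OF finite_sing[OF emp(1)] isC_empty] by simp

lemma Ats_B: "Fo.Ats = Ats"
  by (simp add: B_simps elts_B_Atoms)

text \<open>\<open>isop\<close> and \<open>fmem\<close> are definable in \<open>B\<close> without
  parameters. The former shows that permutations commute with \<open>op\<close>, the latter gives
  the claim.\<close>

lemma fmem_invariant: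
  assumes p: "\<pi> \<in> Perms V" and U: "q \<in> Univ B" "a \<in> Univ B" "x \<in> Univ B" "\<tau> \<in> Univ B"
  shows "Fo.fmem (ap \<pi> q) (Fo.op (ap \<pi> a) (ap \<pi> x)) (ap \<pi> \<tau>) \<longleftrightarrow> Fo.fmem q (Fo.op a x) \<tau>"
proof -
  define e where "e i = (if i = 0 then q else if i = 1 then Fo.op a x else if i = 2 then \<tau> else if i = 3 then a else x)" for i :: nat
  have e: "range e \<subseteq> Univ B" using U Fo.op_U by (auto simp: e_def)
  have 1: "dfb B {} (\<lambda>e. Fo.isop (e 1) (e 3) (e 4))" by (intro Fo.dfb_isop tm_intros empty_subsetI)
  have "Fo.isop (Fo.op a x) a x" using Fo.isop_iff U by blast
  then have "Fo.isop (ap \<pi> (Fo.op a x)) (ap \<pi> a) (ap \<pi> x)"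
    using dfb_invariant[OF 1 empty_subsetI p _ e] by (simp add: e_def)
  then have o: "ap \<pi> (Fo.op a x) = Fo.op (ap \<pi> a) (ap \<pi> x)" using Fo.isop_iff ap_B[OF p] U by blast
  have 2: "dfb B {} (\<lambda>e. Fo.fmem (e 0) (e 1) (e 2))" by (intro Fo.dfb_fmem tm_intros empty_subsetI)
  show ?thesis using dfb_invariant[OF 2 empty_subsetI p _ e] o by (simp add: e_def)
qed

text \<open>The transposition of \<open>a\<close> and \<open>b\<close> fixes \<open>\<tau>\<close>
  since the support \<open>C\<close> avoids both. It fixes \<open>q\<close> since it moves no value
  and exchanges two arguments that carry the same one.\<close>

lemma swap:
  assumes q: "q \<in> PPn B n" "n \<in> nats V" and a: "a \<in> Ats" "b \<in> Ats" "pv q a = pv q b"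
    and C: "supp C \<tau>" "a \<notin> C" "b \<notin> C" and \<tau>: "\<tau> \<in> Univ B"
    and x: "x \<in> Univ B" "\<And>\<pi>. \<pi> \<in> Perms V \<Longrightarrow> ap \<pi> x = x"
    and f: "Fo.fmem q (Fo.op a x) \<tau>"
  shows "Fo.fmem q (Fo.op b x) \<tau>"
proof -
  note Q = PPn_props[OF q]
  obtain \<pi> where p: "\<pi> \<in> Perms V" "ap \<pi> a = b" "ap \<pi> b = a"
    "\<And>c. c \<in> Ats \<Longrightarrow> c \<noteq> a \<Longrightarrow> c \<noteq> b \<Longrightarrow> ap \<pi> c = c" by (rule ex_transposition[OF a(1,2)]) blast
  have "C \<subseteq> Ats" using C(1) by (simp add: supp_def)
  then have "\<pi> \<in> fixp C" using p C(2,3) unfolding fixp_def by blast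
  then have t: "ap \<pi> \<tau> = \<tau>" using C(1) by (simp add: supp_def)
  have inv: "ap \<pi> (ap \<pi> c) = c" if "c \<in> Ats" for c using p that by metis
  have pA: "ap \<pi> c \<in> Ats" if "c \<in> Ats" for c using p a that by metis
  have pvq: "pv q (ap \<pi> c) = pv q c" if "c \<in> Ats" for c using p a that by metis
  have img: "ap \<pi> (pr c (pv q c)) = pr (ap \<pi> c) (pv q (ap \<pi> c))" if "c \<in> Ats" for c
  proof -
    have U: "c \<in> Univ V" "pv q c \<in> Univ V" using that AtsU BU QQ_props(1)[OF Q(3)] by auto
    show ?thesis using ap_pr[OF p(1) U] QQ_fixed[OF Q(3)[OF that] p(1)] pvq[OF that] by simp
  qed
  have e: "elts V q = (\<lambda>c. pr c (pv q c)) ` Ats" unfolding Q(7) prs_def using Q(2) by auto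
  have "ap \<pi> ` elts V q = elts V q"
  proof
    show "ap \<pi> ` elts V q \<subseteq> elts V q" unfolding e using img pA by auto
    show "elts V q \<subseteq> ap \<pi> ` elts V q"
    proof
      fix y assume "y \<in> elts V q"
      then obtain c where c: "c \<in> Ats" "y = pr c (pv q c)" unfolding e by blast
      have "ap \<pi> (pr (ap \<pi> c) (pv q (ap \<pi> c))) = y" using img[OF pA[OF c(1)]] inv c by simp
      then show "y \<in> ap \<pi> ` elts V q" unfolding e using pA[OF c(1)] by (metis (no_types, lifting) imageI)
    qed
  qed
  then have pq: "ap \<pi> q = q" by (intro extens ap_set p Q) (simp add: ap_set p Q)
  show ?thesis using fmem_invariant[OF p(1) Q(1) _ x(1) \<tau>, of a] f AtsB a(1) pq t p(2) x(2)[OF p(1)] by auto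
qed

lemma not_countable: "\<not> countable_in Fo.E (elts Fo.E (Atoms Fo.E))"
proof
  assume cnt: "countable_in Fo.E (elts Fo.E (Atoms Fo.E))"
  obtain W where W: "isC W" "W \<subseteq> Univ B" "emp \<in> W" "\<And>x \<pi>. x \<in> W \<Longrightarrow> \<pi> \<in> Perms V \<Longrightarrow> ap \<pi> x = x"
    "\<And>x. x \<in> W \<Longrightarrow> is_set V x" "\<And>x z. x \<in> W \<Longrightarrow> z \<in> elts V x \<Longrightarrow> \<exists>\<sigma>\<in>W. \<exists>p\<in>PP B. z = pr \<sigma> p"
    "\<And>x. x \<in> W \<Longrightarrow> mk (elts V x \<union> prs ({x} \<times> PP B)) \<in> W" by (rule ex_W) blast
  have PB: "PP B \<subseteq> Univ B" using B.PPU by blast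
  have WB: "B.isC W"
    by (rule BisC_fixed[OF W(1,2) _ countable_empty]) (use W(4) fixpD in auto)
  have W1: "Fo.nc W" unfolding Fo.nc_def
  proof (intro conjI ballI impI WB)
    fix x z assume x: "x \<in> W" and "is_set B x" "z \<in> elts B x"
    then have "z \<in> elts V x" using elts_B_eq W(2) by blast
    from W(6)[OF x this] obtain \<sigma> p where "\<sigma> \<in> W" "p \<in> PP B" "z = pr \<sigma> p" by blast
    then show "\<exists>\<sigma>\<in>W. \<exists>p\<in>PP B. z = B.pr \<sigma> p" using Bpr W(2) PB by (metis subsetD)
  qed
  have W2: "is_set B x \<and> Fo.sn x \<in> W" if x: "x \<in> W" for x
  proof -
    have xB: "x \<in> Univ B" using x W(2) by blast
    have i: "B.isC (elts B x \<union> B.prs ({x} \<times> PP B))"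
      by (intro B.isC_Un B.isC_elts B.isC_prod B.isC_sing PP_BisC xB)
    have "{x} \<times> PP B \<subseteq> Univ B \<times> Univ B" using xB PB by auto
    then have "Fo.sn x = mk (elts V x \<union> prs ({x} \<times> PP B))"
      unfolding Fo.sn_def Bmk[OF i] using Bprs elts_B_eq[OF xB] by simp
    then show ?thesis using W(5,7) x xB is_set_B by simp
  qed
  have W3: "B.emp \<in> W" using W(3) Bemp by simp
  obtain \<tau> p where \<tau>: "\<tau> \<in> names B (PP B)" and pP: "p \<in> PP B"
    and dec: "\<And>a r. a \<in> Fo.Ats \<Longrightarrow> r \<in> PP B \<Longrightarrow> P_le B r p \<Longrightarrow> \<exists>q\<in>PP B. P_le B q r \<and> (\<exists>x\<in>W. Fo.fmem q (Fo.op a x) \<tau>)"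
    and inj: "\<And>a b q x. a \<in> Fo.Ats \<Longrightarrow> b \<in> Fo.Ats \<Longrightarrow> a \<noteq> b \<Longrightarrow> q \<in> PP B \<Longrightarrow> P_le B q p \<Longrightarrow> x \<in> W \<Longrightarrow>
       Fo.fmem q (Fo.op a x) \<tau> \<Longrightarrow> Fo.fmem q (Fo.op b x) \<tau> \<Longrightarrow> False"
    by (rule Fo.countable_atomsE[OF W1 W3 W2 cnt]) blast+
  have \<tau>B: "\<tau> \<in> Univ B" by (rule Fo.names_U[OF \<tau>])
  obtain n where n: "n \<in> nats V" "p \<in> PPn B n" by (rule PP_obtain[OF pP])
  note Pp = PPn_props[OF n(2,1)]
  obtain C0 where C0: "supp C0 \<tau>" using B_sym[OF \<tau>B] by blast
  \<comment> \<open>Adding the exceptional atoms of \<open>p\<close> to the support makes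
    \<open>p\<close> constant off \<open>C\<close>. Values there can then be reassigned without
    leaving the conditions below \<open>p\<close>.\<close>
  define C where "C = C0 \<union> {a \<in> Ats. pv p a \<in> II B}"
  have C: "C \<subseteq> Ats" "countable_in V C" using C0 Pp(5) countable_Un unfolding C_def supp_def by auto
  have CS: "supp C \<tau>" by (rule supp_mono[OF C0 _ C]) (simp add: C_def)
  have Cp: "pv p a \<notin> II B" if "a \<in> Ats" "a \<notin> C" for a using that C_def by blast
  have pc: "pv p a = pv p b" if "a \<in> Ats" "a \<notin> C" "b \<in> Ats" "b \<notin> C" for a b
    using QQ_not_II[OF Pp(3)[OF that(1)] Pp(3)[OF that(3)] Cp[OF that(1,2)] Cp[OF that(3,4)]]
      Pp(4)[OF that(1)] Pp(4)[OF that(3)] by simp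
  have clash: False if q: "q \<in> PPn B k" "k \<in> nats V" "P_le B q p" and ab: "a \<in> Ats" "b \<in> Ats" "a \<noteq> b" "a \<notin> C" "b \<notin> C"
    "pv q a = pv q b" and x: "x \<in> W" "Fo.fmem q (Fo.op a x) \<tau>" for q k a b x
  proof -
    have "Fo.fmem q (Fo.op b x) \<tau>"
      by (rule swap[OF q(1,2) ab(1,2,6) CS ab(4,5) \<tau>B _ _ x(2)]) (use x(1) W(2,4) in auto)
    moreover have "q \<in> PP B" using q nats_B by (auto simp: PP_def)
    ultimately show False using inj[of a b q x] ab(1-3) q(3) x Ats_B by blast
  qed
  obtain a where a: "a \<in> Ats" "a \<notin> C" using ex_outside[OF C(2)] by blast
  obtain q x where q: "q \<in> PP B" "P_le B q p" and x: "x \<in> W" "Fo.fmem q (Fo.op a x) \<tau>"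
    using dec[of a p] a(1) Ats_B pP Fo.le_refl[OF pP] by blast
  obtain m where m: "m \<in> nats V" "q \<in> PPn B m" by (rule PP_obtain[OF q(1)])
  note Qp = PPn_props[OF m(2,1)]
  have qp: "graph V (pv p c) \<subseteq> graph V (pv q c)" if "c \<in> Ats" for c
    using q(2) P_le_iff[OF m(2,1) n(2,1)] that by blast
  define N where "N = {c \<in> Ats. pv q c \<in> II B}"
  define X where "X = C \<union> N"
  have N: "countable_in V N" "N \<subseteq> Ats" using Qp(5) N_def by auto
  have X: "countable_in V X" unfolding X_def by (intro countable_Un C N)
  have qc: "pv q c = pv q d" if "c \<in> Ats" "c \<notin> N" "d \<in> Ats" "d \<notin> N" for c d
    using QQ_not_II[OF Qp(3)[OF that(1)] Qp(3)[OF that(3)]] Qp(4)[OF that(1)] Qp(4)[OF that(3)] that by (simp add: N_def)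
  define t where "t = pv q a"
  have tQ: "t \<in> QQ B" "Domain (graph V t) = elts V m" using Qp(3,4) a t_def by auto
  show False
  proof (cases "t \<in> II B")
    case False
    \<comment> \<open>uncountably many atoms share the value \<open>t\<close> under \<open>q\<close>\<close>
    have "countable_in V (X \<union> {a})" by (intro countable_Un X countable_sing) (use a AtsU in blast)
    then obtain b where b: "b \<in> Ats" "b \<notin> X \<union> {a}" using ex_outside by blast
    have "a \<notin> N" using False by (simp add: N_def t_def)
    then have "pv q a = pv q b" using qc a b X_def by blast
    then show False using clash[OF m(2,1) q(2) a(1) b(1) _ a(2) _ _ x] b X_def by blast
  next
    case True
    \<comment> \<open>Possibly only \<open>a\<close> has the value \<open>t\<close> outside \<open>C\<close>, so \<open>q\<close> is discarded. The condition
      \<open>p'\<close> moves the fibre of \<open>q\<close> over \<open>t\<close> off \<open>C\<close>, replacing \<open>K \<inter> C\<close> by a copy \<open>Ev\<close> of \<open>K\<close>. Since fibres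
      of stronger conditions refine those of \<open>p'\<close> and are infinite, two atoms outside \<open>C\<close> get identified.\<close>
    define K where "K = {c \<in> Ats. pv q c = t}"
    have KA: "K \<subseteq> Ats" by (auto simp: K_def)
    have KN: "K \<subseteq> N" using True by (auto simp: K_def N_def)
    have tU: "t \<in> Univ V" using QQ_props(1)[OF tQ(1)] BU by blast
    have qU: "q \<in> Univ V" using Qp(1) BU by blast
    have fib: "isC {c \<in> Ats. pv q c = s}" if "s \<in> Univ V" for s
    proof -
      have "isC {c \<in> Ats. (c, s) \<in> graph V q}" by (intro isC_sep isC_Ats dfbs qU that)
      moreover have "{c \<in> Ats. (c, s) \<in> graph V q} = {c \<in> Ats. pv q c = s}" using Qp(2) by auto
      ultimately show ?thesis by simp
    qed
    have KC: "isC K" unfolding K_def by (rule fib[OF tU])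
    have Kc: "countable_in V K" by (rule countable_subset[OF N(1) KC KN])
    have tfun: "fun_in B t (elts V m) (bits B)" using QQ_props(4)[OF tQ(1)] tQ(2) by simp
    have Kinf: "\<not> finite_in V K" unfolding K_def by (rule Qp(6)[OF tfun])
    \<comment> \<open>\<open>K\<close> is numbered by \<open>I\<close>, and \<open>E0\<close> sends
      the numbers to atoms outside \<open>X\<close>. All of \<open>K\<close> is copied, because its
      part outside \<open>C\<close> may be finite.\<close>
    obtain E0 where E0: "isR E0" "single_valued E0" "single_valued (E0\<inverse>)" "Domain E0 = nats V" "Range E0 \<subseteq> Ats - X"
      by (rule uncountable_injection[OF AC_V isC_Ats uncountable X])
    obtain I where I: "isR I" "single_valued I" "single_valued (I\<inverse>)" "Domain I = K" "Range I \<subseteq> nats V"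
      using Kc unfolding countable_in_iff by blast
    define J where "J = I O E0"
    have J: "isR J" "single_valued J" "single_valued (J\<inverse>)"
      unfolding J_def converse_relcomp by (intro isR_comp single_valued_relcomp I E0)+
    have JD: "Domain J = K" unfolding J_def using I(4,5) E0(4) by blast
    define Ev where "Ev = Range J"
    have EvX: "Ev \<subseteq> Ats - X" unfolding Ev_def J_def using E0(5) by blast
    have EvC: "isC Ev" unfolding Ev_def by (rule isC_field(2)[OF J(1)])
    have Evc: "countable_in V Ev"
      by (rule countable_inj[OF Kc isR_converse[OF J(1)]]) (use J JD Ev_def in auto)
    have Evinf: "\<not> finite_in V Ev"
      using finite_inj[OF _ J JD] Kinf unfolding Ev_def by blast
    \<comment> \<open>The value \<open>u\<close> is the one that \<open>q\<close> takes on all atoms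
      outside \<open>N\<close>, hence on uncountably many. It serves for the atoms that have to
      leave the fibre over \<open>t\<close>.\<close>
    obtain b0 where b0: "b0 \<in> Ats" "b0 \<notin> X" using ex_outside[OF X] by blast
    define u where "u = pv q b0"
    have uQ: "u \<in> QQ B" "Domain (graph V u) = elts V m" "u \<notin> II B"
      using Qp(3,4) b0 by (auto simp: u_def X_def N_def)
    have tu: "t \<noteq> u" using True uQ(3) by blast
    have uU: "u \<in> Univ V" using QQ_props(1)[OF uQ(1)] BU by blast
    have qu: "pv q c = u" if "c \<in> Ats" "c \<notin> N" for c using qc[OF that b0(1)] b0(2) by (simp add: u_def X_def)
    \<comment> \<open>Fresh atoms get \<open>t\<close>, atoms of \<open>K\<close> in
      \<open>C\<close> get \<open>u\<close>, and all others keep their value, in particular those of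
      \<open>K\<close> outside \<open>C\<close>. No atom of \<open>C\<close> remains over
      \<open>t\<close>.\<close>
    define v where "v c = (if c \<in> Ev then t else if c \<in> C \<and> c \<in> K then u else pv q c)" for c
    have vC: "v c \<noteq> t" if "c \<in> C" for c
      using that EvX C(1) tu by (auto simp: v_def X_def K_def)
    obtain Cq where Cq: "supp Cq q" using B_sym[OF Qp(1)] by blast
    then have Cq': "Cq \<subseteq> Ats" "countable_in V Cq" by (auto simp: supp_def)
    obtain p' where p': "p' \<in> PPn B m" "\<And>c. c \<in> Ats \<Longrightarrow> pv p' c = v c"
    proof (rule PPn_intro[OF m(1)])
      show "isR {(c, h). c \<in> Ats \<and> h = v c}"
      proof (rule isR_dfb[OF isC_Ats isC_Un[OF isC_field(2)[OF isR_graph[OF qU]] isC_upair[OF tU uU]]])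
        have "dfb V (Univ V) (\<lambda>e. e 0 \<in> Ats \<and> (if e 0 \<in> Ev then e 1 = t else if e 0 \<in> C \<and> e 0 \<in> K then e 1 = u else (e 0, e 1) \<in> graph V q))"
          by (intro dfbs dfb_isC[OF EvC] dfb_isC[OF KC] dfb_isC[OF countable_isC[OF C(2)]] tU uU qU AtomsU)
        then show "dfb V (Univ V) (\<lambda>e. (e 0, e 1) \<in> {(c, h). c \<in> Ats \<and> h = v c})"
          by (rule dfb_cong) (auto simp: v_def Qp(2))
        have "pv q c \<in> Range (graph V q)" if "c \<in> Ats" for c using Qp(2)[of c "pv q c"] that by blast
        then show "{(c, h). c \<in> Ats \<and> h = v c} \<subseteq> Ats \<times> (Range (graph V q) \<union> {t, u})" by (auto simp: v_def)
      qed
      \<comment> \<open>A permutation fixing this set pointwise preserves the case distinction in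
        \<open>v\<close>, and \<open>Cq\<close> takes care of the values copied from
        \<open>q\<close>.\<close>
      show "Ev \<union> C \<union> K \<union> Cq \<subseteq> Ats" using EvX C(1) Cq' by (auto simp: K_def)
      show "countable_in V (Ev \<union> C \<union> K \<union> Cq)" by (intro countable_Un Evc C Kc Cq')
      show "v (ap \<pi> c) = v c" if p: "\<pi> \<in> fixp (Ev \<union> C \<union> K \<union> Cq)" and c: "c \<in> Ats" for \<pi> c
      proof -
        have pP: "\<pi> \<in> Perms V" and fx: "\<And>c. c \<in> Ev \<union> C \<union> K \<union> Cq \<Longrightarrow> ap \<pi> c = c" using p by (auto simp: fixp_def)
        have cU: "c \<in> Univ V" using c AtsU by blast
        have mem: "ap \<pi> c \<in> L \<longleftrightarrow> c \<in> L" if L: "L \<subseteq> Ev \<union> C \<union> K \<union> Cq" "L \<subseteq> Ats" for L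
        proof
          assume l: "ap \<pi> c \<in> L"
          then have "ap \<pi> (ap \<pi> c) = ap \<pi> c" using fx L by blast
          then have "ap \<pi> c = c" using ap_inj[OF pP ap_U[OF pP cU] cU] by blast
          then show "c \<in> L" using l by simp
        next
          assume "c \<in> L"
          then show "ap \<pi> c \<in> L" using fx L by (metis subsetD)
        qed
        have "\<pi> \<in> fixp Cq" using fixp_mono[of Cq "Ev \<union> C \<union> K \<union> Cq"] p by blast
        then have "ap \<pi> q = q" using Cq by (simp add: supp_def)
        moreover have "(c, pv q c) \<in> graph V q" using Qp(2) c by blast
        moreover have "pv q c \<in> Univ V" using QQ_props(1)[OF Qp(3)[OF c]] BU by blast
        ultimately have "(ap \<pi> c, ap \<pi> (pv q c)) \<in> graph V q" using ap_graph[OF pP qU cU] by metis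
        then have "pv q (ap \<pi> c) = pv q c" using QQ_fixed[OF Qp(3)[OF c] pP] Qp(2) by simp
        moreover have "ap \<pi> c \<in> Ev \<longleftrightarrow> c \<in> Ev" "ap \<pi> c \<in> C \<longleftrightarrow> c \<in> C" "ap \<pi> c \<in> K \<longleftrightarrow> c \<in> K"
          using EvX C(1) KA by (intro mem; blast)+
        ultimately show ?thesis unfolding v_def by simp
      qed
      show "v c \<in> QQ B" "Domain (graph V (v c)) = elts V m" if "c \<in> Ats" for c
        using tQ uQ Qp(3,4) that by (auto simp: v_def)
      have "{c \<in> Ats. v c \<in> II B} = (N - (C \<inter> K)) \<union> Ev"
        using True uQ(3) EvX by (auto simp: v_def N_def)
      moreover have "countable_in V ((N - (C \<inter> K)) \<union> Ev)"
        by (intro countable_Un Evc countable_subset[OF N(1)] isC_Diff isC_Int countable_isC[OF N(1)] countable_isC[OF C(2)] KC) blast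
      ultimately show "countable_in V {c \<in> Ats. v c \<in> II B}" by simp
      fix s assume s: "fun_in B s (elts V m) (bits B)"
      have sU: "s \<in> Univ V" using B.fun_inU[OF s] BU by blast
      show "\<not> finite_in V {c \<in> Ats. v c = s}"
      proof
        assume fin: "finite_in V {c \<in> Ats. v c = s}"
        show False
        \<comment> \<open>The fibre over \<open>t\<close> contains the infinite \<open>Ev\<close>,
          and the one over \<open>u\<close> contains all but countably many atoms. Any other fibre
          loses nothing to \<open>Ev\<close>, where \<open>q\<close> has the value
          \<open>u\<close>.\<close>
        proof (cases "s = t")
          case True
          have "Ev \<subseteq> {c \<in> Ats. v c = s}" using EvX True by (auto simp: v_def)
          then show False using finite_subset[OF fin EvC] Evinf by blast
        next
          case st: False
          have "{c \<in> Ats. pv q c = s} - Ev \<subseteq> {c \<in> Ats. v c = s}" using st by (auto simp: v_def K_def)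
          then have f: "finite_in V ({c \<in> Ats. pv q c = s} - Ev)"
            by (intro finite_subset[OF fin] isC_Diff fib sU EvC)
          show False
          proof (cases "s = u")
            case True
            have "Ats \<subseteq> N \<union> Ev \<union> ({c \<in> Ats. pv q c = s} - Ev)" using qu True by blast
            then show False
              using countable_subset[OF countable_Un[OF countable_Un[OF N(1) Evc] finite_countable[OF f]] isC_Ats] uncountable by blast
          next
            case False
            have "{c \<in> Ats. pv q c = s} - Ev = {c \<in> Ats. pv q c = s}" using EvX qu False by (auto simp: X_def)
            then show False using f Qp(6)[OF s] by simp
          qed
        qed
      qed
    qed blast
    note P' = PPn_props[OF p'(1) m(1)]
    have p'P: "p' \<in> PP B" using p'(1) m(1) nats_B by (auto simp: PP_def)
    have "graph V (pv p c) \<subseteq> graph V (pv p' c)" if c: "c \<in> Ats" for c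
    proof -
      have tq: "graph V (pv p a) \<subseteq> graph V t" using qp[OF a(1)] by (simp add: t_def)
      \<comment> \<open>In the first case \<open>c\<close> is off \<open>C\<close>, where
        \<open>p(c) = p(a)\<close> is contained in \<open>t\<close>. In the second,
        \<open>p(c)\<close> and \<open>p(a)\<close> are restrictions of \<open>t\<close> to the same
        domain, hence equal, and \<open>p(a) = p(b0)\<close> is contained in
        \<open>u\<close>.\<close>
      consider "c \<in> Ev" | "c \<notin> Ev" "c \<in> C" "c \<in> K" | "c \<notin> Ev" "\<not> (c \<in> C \<and> c \<in> K)" by blast
      then show ?thesis
      proof cases
        case 1
        then have "c \<notin> C" using EvX by (auto simp: X_def)
        then show ?thesis using pc[OF c _ a] tq p'(2)[OF c] 1 by (simp add: v_def)
      next
        case 2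
        then have "graph V (pv p c) \<subseteq> graph V t" using qp[OF c] by (simp add: K_def)
        then have "pv p c = pv p a" using QQ_restrict[OF Pp(3)[OF c] Pp(3)[OF a(1)] tQ(1) _ tq] Pp(4)[OF c] Pp(4)[OF a(1)] by simp
        moreover have "pv p a = pv p b0" using pc[OF a b0(1)] b0(2) X_def by blast
        ultimately show ?thesis using qp[OF b0(1)] p'(2)[OF c] 2 by (simp add: v_def u_def)
      next
        case 3
        then have "v c = pv q c" by (auto simp: v_def)
        then show ?thesis using qp[OF c] p'(2)[OF c] by simp
      qed
    qed
    then have p'p: "P_le B p' p" using P_le_iff[OF p'(1) m(1) n(2,1)] by blast
    have "Ev \<noteq> {}" using Evinf finite_empty by auto
    then obtain a' where a': "a' \<in> Ev" by blast
    have a'A: "a' \<in> Ats" "a' \<notin> C" using a' EvX by (auto simp: X_def)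
    obtain r y where r: "r \<in> PP B" "P_le B r p'" and y: "y \<in> W" "Fo.fmem r (Fo.op a' y) \<tau>"
      using dec[of a' p'] a'A(1) Ats_B p'P p'p by blast
    obtain k where k: "k \<in> nats V" "r \<in> PPn B k" by (rule PP_obtain[OF r(1)])
    note Rp = PPn_props[OF k(2,1)]
    have rp: "P_le B r p" by (rule Fo.le_trans[OF r(1) p'P pP r(2) p'p])
    define s where "s = pv r a'"
    have sQ: "s \<in> QQ B" "Domain (graph V s) = elts V k" using Rp(3,4) a'A by (auto simp: s_def)
    have sfun: "fun_in B s (elts V k) (bits B)" using QQ_props(4)[OF sQ(1)] sQ(2) by simp
    \<comment> \<open>Fibres of a condition over functions defined on its whole length are infinite,
      so \<open>a'\<close> is not alone in its fibre.\<close>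
    have "\<exists>b\<in>Ats. pv r b = s \<and> b \<noteq> a'"
    proof (rule ccontr)
      assume "\<not> ?thesis"
      then have "{b \<in> Ats. pv r b = s} = {a'}" using a'A s_def by blast
      moreover have "finite_in V {a'}" using finite_sing a'A AtsU by blast
      ultimately show False using Rp(6)[OF sfun] by simp
    qed
    then obtain b where b: "b \<in> Ats" "pv r b = s" "b \<noteq> a'" by blast
    have vs: "graph V (v c) \<subseteq> graph V (pv r c)" if "c \<in> Ats" for c
      using r(2) P_le_iff[OF k(2,1) p'(1) m(1)] that p'(2) by auto
    \<comment> \<open>Both \<open>v b\<close> and \<open>t\<close> are restrictions of
      \<open>s\<close> to the domain \<open>m\<close>. So \<open>b\<close> lies in the fibre of
      \<open>p'\<close> over \<open>t\<close>, which avoids \<open>C\<close>.\<close>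
    have "graph V (v b) \<subseteq> graph V s" using vs[OF b(1)] b(2) by simp
    moreover have "graph V t \<subseteq> graph V s" using vs[OF a'A(1)] a' by (simp add: s_def v_def)
    moreover have "v b \<in> QQ B" "Domain (graph V (v b)) = elts V m" using P'(3,4)[OF b(1)] p'(2)[OF b(1)] by auto
    ultimately have "v b = t" using QQ_restrict[OF _ tQ(1) sQ(1)] tQ(2) by simp
    then have bC: "b \<notin> C" using vC by blast
    show False
      by (rule clash[OF k(2,1) rp a'A(1) b(1) _ a'A(2) bC _ y]) (use b s_def in auto)
  qed
qed

end

theorem theorem5p29:
  fixes V B :: "'a str" and G :: "'a set" and BG :: "'a set str"
  assumes "ZFA V" and "AC V"
    and "greater_aleph0_in V (elts V (Atoms V))"
    and "B = perm_model V"
    and "generic_filter B (PP B) (P_le B) G"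
    and "BG = generic_ext B (PP B) (P_le B) G"
  shows "\<not> countable_in BG (elts BG (Atoms BG))"
proof -
  interpret zfa V by (rule ZFA_imp_zfa[OF assms(1)])
  interpret perm_mod V by unfold_locales
  interpret ext V G
    by unfold_locales (use assms in \<open>auto simp: greater_aleph0_in_def\<close>)
  show ?thesis using not_countable assms by simp
qed

end
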